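(* Let $X$ be a locally compact Hausdorff space. Then $\dim_{\mathrm{nuc}} C_0(X)=\mathrm{dr}\,C_0(X)$. In particular, if $X$ is second countable, then $\dim_{\mathrm{nuc}} C_0(X)=\mathrm{dr}\,C_0(X)=\dim X$, where $\dim X$ is the topological covering dimension of $X$.
   Context: C.p. means completely positive; c.p.c. means completely positive and contractive. A c.p. map $\varphi:A\to B$ between $C^*$-algebras has order zero if for all $a,b\in A_+$, $ab=0$ implies $\varphi(a)\varphi(b)=0$. Nuclear dimension: a (not necessarily separable) $C^*$-algebra $A$ satisfies $\dim_{\mathrm{nuc}}A\le n$ if there is a net $(F_\lambda,\psi_\lambda,\varphi_\lambda)_{\lambda\in\Lambda}$ with $F_\lambda$ finite-dimensional $C^*$-algebras and $\psi_\lambda:A\to F_\lambda$, $\varphi_\lambda:F_\lambda\to A$ c.p. maps such that (i) $\varphi_\lambda\circ\psi_\lambda(a)\to a$ uniformly on finite subsets of $A$; (ii) $\|\psi_\lambda\|\le 1$; (iii) each $F_\lambda$ decomposes into $n+1$ ideals $F_\lambda=F_\lambda^{(0)}\oplus\dots\oplus F_\lambda^{(n)}$ such that $\varphi_\lambda|_{F_\lambda^{(i)}}$ is a c.p.c. order zero map for $i=0,\dots,n$. $\dim_{\mathrm{nuc}}A$ is the least such $n\in\{0,1,2,\dots\}$, and $\infty$ if there is none. Decomposition rank: $\mathrm{dr}\,A\le n$ is defined in exactly the same way (also for nonseparable $A$), with the extra condition that the maps $\varphi_\lambda:F_\lambda\to A$ themselves are contractive; $\mathrm{dr}\,A$ is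 the least such $n$, and $\infty$ if there is none. *)

theory Defs
  imports "HOL-Analysis.Analysis" "HOL-Algebra.Module" "HOL-Library.Extended_Nat"
begin

section \<open>C*-algebras\<close>

definition complex_ring :: "complex ring" where
  "complex_ring = \<lparr>carrier = UNIV, mult = (*), one = 1, zero = 0, add = (+)\<rparr>"

text \<open>
  Algebras are not assumed to be unital. The record field \<open>one\<close>, inherited from the ring records of
  the library, carries no meaning: no axiom below mentions it.
\<close>

record 'a star_algebra = "(complex, 'a) module" +
  adj :: "'a \<Rightarrow> 'a"

record 'a cstar_algebra = "'a star_algebra" +
  cnorm :: "'a \<Rightarrow> real"

locale star_algebra = module complex_ring A for A (structure) +
  assumes m_closed: "\<lbrakk>x \<in> carrier A; y \<in> carrier A\<rbrakk> \<Longrightarrow> x \<otimes> y \<in> carrier A"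
    and m_assoc: "\<lbrakk>x \<in> carrier A; y \<in> carrier A; z \<in> carrier A\<rbrakk> \<Longrightarrow> (x \<otimes> y) \<otimes> z = x \<otimes> (y \<otimes> z)"
    and l_distr: "\<lbrakk>x \<in> carrier A; y \<in> carrier A; z \<in> carrier A\<rbrakk>
      \<Longrightarrow> (x \<oplus> y) \<otimes> z = x \<otimes> z \<oplus> y \<otimes> z"
    and r_distr: "\<lbrakk>x \<in> carrier A; y \<in> carrier A; z \<in> carrier A\<rbrakk>
      \<Longrightarrow> z \<otimes> (x \<oplus> y) = z \<otimes> x \<oplus> z \<otimes> y"
    and smult_m_left: "\<lbrakk>x \<in> carrier A; y \<in> carrier A\<rbrakk> \<Longrightarrow> (c \<odot> x) \<otimes> y = c \<odot> (x \<otimes> y)"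
    and smult_m_right: "\<lbrakk>x \<in> carrier A; y \<in> carrier A\<rbrakk> \<Longrightarrow> x \<otimes> (c \<odot> y) = c \<odot> (x \<otimes> y)"
    and adj_closed: "x \<in> carrier A \<Longrightarrow> adj A x \<in> carrier A"
    and adj_adj: "x \<in> carrier A \<Longrightarrow> adj A (adj A x) = x"
    and adj_add: "\<lbrakk>x \<in> carrier A; y \<in> carrier A\<rbrakk> \<Longrightarrow> adj A (x \<oplus> y) = adj A x \<oplus> adj A y"
    and adj_smult: "x \<in> carrier A \<Longrightarrow> adj A (c \<odot> x) = cnj c \<odot> adj A x"
    and adj_mult: "\<lbrakk>x \<in> carrier A; y \<in> carrier A\<rbrakk> \<Longrightarrow> adj A (x \<otimes> y) = adj A y \<otimes> adj A x"

locale cstar_algebra = star_algebra A for A (structure) +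
  assumes cnorm_nonneg: "x \<in> carrier A \<Longrightarrow> 0 \<le> cnorm A x"
    and cnorm_eq_0: "x \<in> carrier A \<Longrightarrow> cnorm A x = 0 \<longleftrightarrow> x = \<zero>"
    and cnorm_triangle: "\<lbrakk>x \<in> carrier A; y \<in> carrier A\<rbrakk>
      \<Longrightarrow> cnorm A (x \<oplus> y) \<le> cnorm A x + cnorm A y"
    and cnorm_smult: "x \<in> carrier A \<Longrightarrow> cnorm A (c \<odot> x) = cmod c * cnorm A x"
    and cnorm_mult: "\<lbrakk>x \<in> carrier A; y \<in> carrier A\<rbrakk>
      \<Longrightarrow> cnorm A (x \<otimes> y) \<le> cnorm A x * cnorm A y"
    and cstar_identity: "x \<in> carrier A \<Longrightarrow> cnorm A (adj A x \<otimes> x) = (cnorm A x)\<^sup>2"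
    and complete: "\<lbrakk>\<And>k. s k \<in> carrier A;
        \<forall>e>0. \<exists>N. \<forall>i\<ge>N. \<forall>j\<ge>N. cnorm A (s i \<ominus> s j) < e\<rbrakk>
      \<Longrightarrow> \<exists>l\<in>carrier A. (\<lambda>k. cnorm A (s k \<ominus> l)) \<longlonglongrightarrow> 0"

definition finite_dimensional :: "('a, 'm) star_algebra_scheme \<Rightarrow> bool" where
  "finite_dimensional A \<longleftrightarrow> (\<exists>S. finite S \<and> S \<subseteq> carrier A \<and>
     (\<forall>x\<in>carrier A. \<exists>c. x = (\<Oplus>\<^bsub>A\<^esub>s\<in>S. c s \<odot>\<^bsub>A\<^esub> s)))"

definition positive_elements :: "('a, 'm) star_algebra_scheme \<Rightarrow> 'a set" where
  "positive_elements A = {adj A x \<otimes>\<^bsub>A\<^esub> x | x. x \<in> carrier A}"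

text \<open>
  The *-algebra \<open>M\<^sub>k(A)\<close>; its C*-norm is not needed, since positivity of elements depends on the
  *-algebra structure only.
\<close>

definition matrix_algebra ::
    "nat \<Rightarrow> ('a, 'm) star_algebra_scheme \<Rightarrow> (nat \<Rightarrow> nat \<Rightarrow> 'a) star_algebra" where
  "matrix_algebra k A =
    \<lparr>carrier = {..<k} \<rightarrow>\<^sub>E {..<k} \<rightarrow>\<^sub>E carrier A,
     mult = (\<lambda>a b. \<lambda>i\<in>{..<k}. \<lambda>j\<in>{..<k}. \<Oplus>\<^bsub>A\<^esub>l\<in>{..<k}. a i l \<otimes>\<^bsub>A\<^esub> b l j),
     one = undefined,
     zero = (\<lambda>i\<in>{..<k}. \<lambda>j\<in>{..<k}. \<zero>\<^bsub>A\<^esub>),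
     add = (\<lambda>a b. \<lambda>i\<in>{..<k}. \<lambda>j\<in>{..<k}. a i j \<oplus>\<^bsub>A\<^esub> b i j),
     smult = (\<lambda>c a. \<lambda>i\<in>{..<k}. \<lambda>j\<in>{..<k}. c \<odot>\<^bsub>A\<^esub> a i j),
     adj = (\<lambda>a. \<lambda>i\<in>{..<k}. \<lambda>j\<in>{..<k}. adj A (a j i))\<rparr>"

definition amplification :: "nat \<Rightarrow> ('a \<Rightarrow> 'b) \<Rightarrow> (nat \<Rightarrow> nat \<Rightarrow> 'a) \<Rightarrow> nat \<Rightarrow> nat \<Rightarrow> 'b" where
  "amplification k f a = (\<lambda>i\<in>{..<k}. \<lambda>j\<in>{..<k}. f (a i j))"

definition linear_map ::
    "('a, 'm) star_algebra_scheme \<Rightarrow> ('b, 'n) star_algebra_scheme \<Rightarrow> ('a \<Rightarrow> 'b) \<Rightarrow> bool" where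
  "linear_map A B f \<longleftrightarrow> f \<in> carrier A \<rightarrow> carrier B \<and>
     (\<forall>x\<in>carrier A. \<forall>y\<in>carrier A. f (x \<oplus>\<^bsub>A\<^esub> y) = f x \<oplus>\<^bsub>B\<^esub> f y) \<and>
     (\<forall>c. \<forall>x\<in>carrier A. f (c \<odot>\<^bsub>A\<^esub> x) = c \<odot>\<^bsub>B\<^esub> f x)"

definition cp_map ::
    "('a, 'm) star_algebra_scheme \<Rightarrow> ('b, 'n) star_algebra_scheme \<Rightarrow> ('a \<Rightarrow> 'b) \<Rightarrow> bool" where
  "cp_map A B f \<longleftrightarrow> linear_map A B f \<and>
     (\<forall>k. \<forall>a\<in>positive_elements (matrix_algebra k A).
        amplification k f a \<in> positive_elements (matrix_algebra k B))"

definition contractive ::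
    "('a, 'm) cstar_algebra_scheme \<Rightarrow> ('b, 'n) cstar_algebra_scheme \<Rightarrow> ('a \<Rightarrow> 'b) \<Rightarrow> bool" where
  "contractive A B f \<longleftrightarrow> (\<forall>x\<in>carrier A. cnorm B (f x) \<le> cnorm A x)"

definition order_zero ::
    "('a, 'm) star_algebra_scheme \<Rightarrow> ('b, 'n) star_algebra_scheme \<Rightarrow> ('a \<Rightarrow> 'b) \<Rightarrow> bool" where
  "order_zero A B f \<longleftrightarrow> (\<forall>a\<in>positive_elements A. \<forall>b\<in>positive_elements A.
     a \<otimes>\<^bsub>A\<^esub> b = \<zero>\<^bsub>A\<^esub> \<longrightarrow> f a \<otimes>\<^bsub>B\<^esub> f b = \<zero>\<^bsub>B\<^esub>)"

text \<open>
  Two-sided ideals. They are only used in finite-dimensional C*-algebras, where they are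
  automatically norm-closed and hence closed under the involution.
\<close>

definition two_sided_ideal :: "'a set \<Rightarrow> ('a, 'm) star_algebra_scheme \<Rightarrow> bool" where
  "two_sided_ideal I A \<longleftrightarrow> I \<subseteq> carrier A \<and> \<zero>\<^bsub>A\<^esub> \<in> I \<and>
     (\<forall>x\<in>I. \<forall>y\<in>I. x \<oplus>\<^bsub>A\<^esub> y \<in> I) \<and> (\<forall>c. \<forall>x\<in>I. c \<odot>\<^bsub>A\<^esub> x \<in> I) \<and>
     (\<forall>x\<in>I. \<forall>a\<in>carrier A. a \<otimes>\<^bsub>A\<^esub> x \<in> I \<and> x \<otimes>\<^bsub>A\<^esub> a \<in> I)"

definition ideal_decomposition :: "nat \<Rightarrow> (nat \<Rightarrow> 'a set) \<Rightarrow> ('a, 'm) star_algebra_scheme \<Rightarrow> bool" where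
  "ideal_decomposition n I A \<longleftrightarrow> (\<forall>i\<le>n. two_sided_ideal (I i) A) \<and>
     (\<forall>x\<in>carrier A. \<exists>!y. y \<in> (\<Pi>\<^sub>E i\<in>{..n}. I i) \<and> x = (\<Oplus>\<^bsub>A\<^esub>i\<in>{..n}. y i))"


section \<open>Nuclear dimension and decomposition rank\<close>

definition nuclear_approximant ::
    "nat \<Rightarrow> 'a cstar_algebra \<Rightarrow> 'b cstar_algebra \<Rightarrow> ('a \<Rightarrow> 'b) \<Rightarrow> ('b \<Rightarrow> 'a) \<Rightarrow> bool" where
  "nuclear_approximant n A F \<psi> \<phi> \<longleftrightarrow>
     cstar_algebra F \<and> finite_dimensional F \<and>
     cp_map A F \<psi> \<and> cp_map F A \<phi> \<and> contractive A F \<psi> \<and>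
     (\<exists>I. ideal_decomposition n I F \<and>
        (\<forall>i\<le>n. let F\<^sub>i = F\<lparr>carrier := I i\<rparr> in
           cp_map F\<^sub>i A \<phi> \<and> contractive F\<^sub>i A \<phi> \<and> order_zero F\<^sub>i A \<phi>))"

definition directed_set :: "'i set \<Rightarrow> ('i \<Rightarrow> 'i \<Rightarrow> bool) \<Rightarrow> bool" where
  "directed_set \<Lambda> rel \<longleftrightarrow> \<Lambda> \<noteq> {} \<and> (\<forall>i\<in>\<Lambda>. rel i i) \<and>
     (\<forall>i\<in>\<Lambda>. \<forall>j\<in>\<Lambda>. \<forall>k\<in>\<Lambda>. rel i j \<longrightarrow> rel j k \<longrightarrow> rel i k) \<and>
     (\<forall>i\<in>\<Lambda>. \<forall>j\<in>\<Lambda>. \<exists>k\<in>\<Lambda>. rel i k \<and> rel j k)"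

definition tends_to_identity ::
    "'a cstar_algebra \<Rightarrow> 'i set \<Rightarrow> ('i \<Rightarrow> 'i \<Rightarrow> bool) \<Rightarrow> ('i \<Rightarrow> 'a \<Rightarrow> 'a) \<Rightarrow> bool" where
  "tends_to_identity A \<Lambda> rel T \<longleftrightarrow> (\<forall>S e. finite S \<and> S \<subseteq> carrier A \<and> 0 < e \<longrightarrow>
     (\<exists>i0\<in>\<Lambda>. \<forall>i\<in>\<Lambda>. rel i0 i \<longrightarrow> (\<forall>a\<in>S. cnorm A (T i a \<ominus>\<^bsub>A\<^esub> a) < e)))"

definition nuclear_net ::
    "nat \<Rightarrow> 'a cstar_algebra \<Rightarrow> 'i set \<Rightarrow> ('i \<Rightarrow> 'i \<Rightarrow> bool) \<Rightarrow>
     ('i \<Rightarrow> 'b cstar_algebra) \<Rightarrow> ('i \<Rightarrow> 'a \<Rightarrow> 'b) \<Rightarrow> ('i \<Rightarrow> 'b \<Rightarrow> 'a) \<Rightarrow> bool" where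
  "nuclear_net n A \<Lambda> rel F \<psi> \<phi> \<longleftrightarrow> directed_set \<Lambda> rel \<and>
     (\<forall>i\<in>\<Lambda>. nuclear_approximant n A (F i) (\<psi> i) (\<phi> i)) \<and>
     tends_to_identity A \<Lambda> rel (\<lambda>i. \<phi> i \<circ> \<psi> i)"

text \<open>
  HOL does not quantify over types inside a formula, so the nets are indexed by directed subsets of
  one fixed type, and the finite-dimensional algebras have their carriers in one fixed type.
  Neither choice is a restriction: a finite-dimensional algebra embeds as a set into
  \<open>nat \<Rightarrow> complex\<close> by coordinates, and a net indexed by any directed set can be reindexed by the
  pairs of a finite subset of the algebra and a tolerance \<open>1/(k+1)\<close>. See
  \<open>nuclear_dim_leI\<close> and \<open>decomp_rank_leI\<close> below.
\<close>

definition nuclear_dim_le :: "'a cstar_algebra \<Rightarrow> nat \<Rightarrow> bool" where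
  "nuclear_dim_le A n \<longleftrightarrow>
     (\<exists>(\<Lambda> :: ('a set \<times> nat) set) rel (F :: _ \<Rightarrow> (nat \<Rightarrow> complex) cstar_algebra) \<psi> \<phi>.
        nuclear_net n A \<Lambda> rel F \<psi> \<phi>)"

definition decomp_rank_le :: "'a cstar_algebra \<Rightarrow> nat \<Rightarrow> bool" where
  "decomp_rank_le A n \<longleftrightarrow>
     (\<exists>(\<Lambda> :: ('a set \<times> nat) set) rel (F :: _ \<Rightarrow> (nat \<Rightarrow> complex) cstar_algebra) \<psi> \<phi>.
        nuclear_net n A \<Lambda> rel F \<psi> \<phi> \<and> (\<forall>i\<in>\<Lambda>. contractive (F i) A (\<phi> i)))"

text \<open>The infimum of the empty set in \<^typ>\<open>enat\<close> is \<open>\<infinity>\<close>.\<close>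

definition nuclear_dimension :: "'a cstar_algebra \<Rightarrow> enat" where
  "nuclear_dimension A = Inf {enat n | n. nuclear_dim_le A n}"

definition decomposition_rank :: "'a cstar_algebra \<Rightarrow> enat" where
  "decomposition_rank A = Inf {enat n | n. decomp_rank_le A n}"


section \<open>The algebra of functions vanishing at infinity\<close>

text \<open>
  Functions on the space are represented by functions on the type that are zero outside
  \<^term>\<open>topspace X\<close>; hence the supremum over the type is the supremum over the space
  (and is \<open>0\<close> if the space is empty).
\<close>

definition C0_functions :: "'x topology \<Rightarrow> ('x \<Rightarrow> complex) set" where
  "C0_functions X = {f. continuous_map X euclidean f \<and> (\<forall>x. x \<notin> topspace X \<longrightarrow> f x = 0) \<and>
     (\<forall>e>0. compactin X {x \<in> topspace X. e \<le> cmod (f x)})}"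

definition C0 :: "'x topology \<Rightarrow> ('x \<Rightarrow> complex) cstar_algebra" where
  "C0 X =
    \<lparr>carrier = C0_functions X,
     mult = (\<lambda>f g x. f x * g x),
     one = undefined,
     zero = (\<lambda>x. 0),
     add = (\<lambda>f g x. f x + g x),
     smult = (\<lambda>c f x. c * f x),
     adj = (\<lambda>f x. cnj (f x)),
     cnorm = (\<lambda>f. SUP x. cmod (f x))\<rparr>"


section \<open>Covering dimension\<close>

definition covering_dim_le :: "'x topology \<Rightarrow> nat \<Rightarrow> bool" where
  "covering_dim_le X n \<longleftrightarrow>
     (\<forall>\<U>. finite \<U> \<and> (\<forall>U\<in>\<U>. openin X U) \<and> \<Union>\<U> = topspace X \<longrightarrow>
        (\<exists>\<V>. finite \<V> \<and> (\<forall>V\<in>\<V>. openin X V) \<and> \<Union>\<V> = topspace X \<and>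
           (\<forall>V\<in>\<V>. \<exists>U\<in>\<U>. V \<subseteq> U) \<and>
           (\<forall>x\<in>topspace X. card {V \<in> \<V>. x \<in> V} \<le> n + 1)))"

text \<open>
  Like the two dimensions above, the covering dimension takes values in \<open>{0, 1, 2, \<dots>, \<infinity>}\<close>;
  in particular the empty space has dimension \<open>0\<close> (and not \<open>-1\<close>), in accordance with
  the dimensions of the zero algebra.
\<close>

definition covering_dimension :: "'x topology \<Rightarrow> enat" where
  "covering_dimension X = Inf {enat n | n. covering_dim_le X n}"


section \<open>\<open>C\<^sub>0(X)\<close> is a C*-algebra\<close>

lemma cring_complex_ring: "cring complex_ring"
  by (rule cringI, rule abelian_groupI)
     (auto simp: complex_ring_def algebra_simps Bex_def exI[of _ "- _"]
       intro!: monoid.intro Group.comm_monoidI exI[of _ "- _"] dest: eq_neg_iff_add_eq_0[THEN iffD1])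

lemma C0_bounded:
  assumes "f \<in> C0_functions X"
  shows "bdd_above (range (\<lambda>x. cmod (f x)))"
proof -
  have f: "continuous_map X euclidean f" "compactin X {x \<in> topspace X. 1 \<le> cmod (f x)}"
    using assms unfolding C0_functions_def by auto
  let ?K = "{x \<in> topspace X. 1 \<le> cmod (f x)}"
  have "compactin euclidean (f ` ?K)"
    using f image_compactin by blast
  then have "bounded (f ` ?K)"
    by (simp add: compact_imp_bounded)
  then obtain B where B: "\<And>x. x \<in> ?K \<Longrightarrow> cmod (f x) \<le> B"
    unfolding bounded_iff by blast
  have "cmod (f x) \<le> max B 1" for x
    using B[of x] assms unfolding C0_functions_def by (cases "x \<in> ?K") (force+)
  then show ?thesis unfolding bdd_above_def by blast
qed

lemma C0_functions_if_bounded: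
  assumes f: "continuous_map X euclidean (f :: 'x \<Rightarrow> complex)" "\<And>x. x \<notin> topspace X \<Longrightarrow> f x = 0"
    and g: "\<And>e. e > 0 \<Longrightarrow> \<exists>K. compactin X K \<and> (\<forall>x. e \<le> cmod (f x) \<longrightarrow> x \<in> K)"
  shows "f \<in> C0_functions X"
proof -
  have "compactin X {x \<in> topspace X. e \<le> cmod (f x)}" if e: "e > 0" for e
  proof -
    obtain K where K: "compactin X K" "\<And>x. e \<le> cmod (f x) \<Longrightarrow> x \<in> K"
      using g[OF e] by blast
    have "closedin euclidean {z::complex. e \<le> cmod z}"
      by (simp add: closed_Collect_le continuous_on_norm_id)
    from closedin_continuous_map_preimage[OF f(1) this]
    have "closedin X {x \<in> topspace X. e \<le> cmod (f x)}" by simp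
    then show ?thesis
      by (rule closed_compactin[OF K(1), rotated]) (use K(2) in auto)
  qed
  then show ?thesis using f unfolding C0_functions_def by auto
qed

lemma C0_compact:
  assumes "f \<in> C0_functions X" "e > 0"
  shows "compactin X {x \<in> topspace X. e \<le> cmod (f x)}"
    and "\<And>x. e \<le> cmod (f x) \<Longrightarrow> x \<in> {x \<in> topspace X. e \<le> cmod (f x)}"
  using assms unfolding C0_functions_def by force+

lemma C0_zero: "(\<lambda>x. 0) \<in> C0_functions X"
  by (rule C0_functions_if_bounded) (auto intro!: exI[of _ "{}"])

lemma C0_add:
  assumes "f \<in> C0_functions X" "g \<in> C0_functions X"
  shows "(\<lambda>x. f x + g x) \<in> C0_functions X"
proof (rule C0_functions_if_bounded)
  show "continuous_map X euclidean (\<lambda>x. f x + g x)"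
    using assms unfolding C0_functions_def by (auto intro: continuous_map_add)
  fix e :: real assume e: "e > 0"
  let ?K = "\<lambda>h. {x \<in> topspace X. e/2 \<le> cmod (h x)}"
  have "compactin X (?K f \<union> ?K g)"
    using assms e by (intro compactin_Un C0_compact) auto
  moreover have "x \<in> ?K f \<union> ?K g" if "e \<le> cmod (f x + g x)" for x
  proof -
    have "e/2 \<le> cmod (f x) \<or> e/2 \<le> cmod (g x)"
      using that norm_triangle_ineq[of "f x" "g x"] by linarith
    then show ?thesis using C0_compact(2)[of _ X "e/2" x] assms e by (metis (no_types, lifting) UnI1 UnI2 half_gt_zero)
  qed
  ultimately show "\<exists>K. compactin X K \<and> (\<forall>x. e \<le> cmod (f x + g x) \<longrightarrow> x \<in> K)" by blast
qed (use assms in \<open>auto simp: C0_functions_def\<close>)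

lemma C0_bounded_mult:
  assumes f: "f \<in> C0_functions X" and h: "continuous_map X euclidean (\<lambda>x. h x)"
     "\<And>x. x \<notin> topspace X \<Longrightarrow> h x = 0" and B: "\<And>x. cmod (h x) \<le> B * cmod (f x)"
  shows "h \<in> C0_functions X"
proof (rule C0_functions_if_bounded)
  fix e :: real assume e: "e > 0"
  define d where "d = e / (\<bar>B\<bar> + 1)"
  have d: "d > 0" using e by (simp add: d_def)
  have "d \<le> cmod (f x)" if "e \<le> cmod (h x)" for x
  proof -
    have "e \<le> B * cmod (f x)" using that B[of x] by linarith
    also have "\<dots> \<le> (\<bar>B\<bar> + 1) * cmod (f x)" by (intro mult_right_mono) auto
    finally show ?thesis by (simp add: d_def field_simps)
  qed
  then show "\<exists>K. compactin X K \<and> (\<forall>x. e \<le> cmod (h x) \<longrightarrow> x \<in> K)"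
    using C0_compact[OF f d] by blast
qed (use assms in auto)

lemma C0_smult:
  assumes "f \<in> C0_functions X" shows "(\<lambda>x. c * f x) \<in> C0_functions X"
  by (rule C0_bounded_mult[OF assms, where B = "cmod c"])
     (use assms continuous_map_compose[of X euclidean f euclidean "\<lambda>z. c * z"] in
       \<open>auto simp: C0_functions_def norm_mult o_def continuous_intros\<close>)

lemma C0_cnj:
  assumes "f \<in> C0_functions X" shows "(\<lambda>x. cnj (f x)) \<in> C0_functions X"
proof (rule C0_bounded_mult[OF assms, where B = 1])
  have "continuous_map X euclidean (cnj \<circ> f)"
    using assms unfolding C0_functions_def
    by (intro continuous_map_compose[of X euclidean]) (auto intro: continuous_intros)
  then show "continuous_map X euclidean (\<lambda>x. cnj (f x))" by (simp add: o_def)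
qed (use assms in \<open>auto simp: C0_functions_def\<close>)

lemma C0_cmod_le:
  assumes "f \<in> C0_functions X" shows "cmod (f x) \<le> (SUP x. cmod (f x))"
  using C0_bounded[OF assms] by (rule cSUP_upper[rotated]) auto

lemma C0_mult:
  assumes "f \<in> C0_functions X" "g \<in> C0_functions X"
  shows "(\<lambda>x. f x * g x) \<in> C0_functions X"
proof (rule C0_bounded_mult[OF assms(2), where B = "SUP x. cmod (f x)"])
  show "cmod (f x * g x) \<le> (SUP x. cmod (f x)) * cmod (g x)" for x
    using C0_cmod_le[OF assms(1), of x] by (simp add: norm_mult mult_right_mono)
  have "continuous_map X (prod_topology euclidean euclidean) (\<lambda>x. (f x, g x))"
    using assms unfolding C0_functions_def by (intro continuous_map_pairedI) auto
  then have "continuous_map X euclidean (\<lambda>x. (f x, g x))"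
    by (simp only: prod_topology_euclidean)
  then have "continuous_map X euclidean ((\<lambda>(a, b). a * b) \<circ> (\<lambda>x. (f x, g x)))"
    by (rule continuous_map_compose) (auto simp: split_def intro!: continuous_intros)
  then show "continuous_map X euclidean (\<lambda>x. f x * g x)" by (simp add: o_def)
qed (use assms in \<open>auto simp: C0_functions_def\<close>)

lemma C0_limit:
  assumes s: "\<And>k :: nat. s k \<in> C0_functions X"
    and lim: "\<And>e. e > 0 \<Longrightarrow> \<exists>N. \<forall>k\<ge>N. \<forall>x. cmod (s k x - l x) \<le> e"
  shows "l \<in> C0_functions X"
proof (rule C0_functions_if_bounded)
  have "continuous_map X Met_TC.mtopology l"
  proof (rule Met_TC.continuous_map_uniform_limit[where F = sequentially])
    show "\<forall>\<^sub>F k in sequentially. continuous_map X Met_TC.mtopology (s k)"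
      using s by (simp add: C0_functions_def)
    fix e :: real assume "e > 0"
    then obtain N where "\<And>k x. k \<ge> N \<Longrightarrow> cmod (s k x - l x) \<le> e/2"
      using lim[of "e/2"] by auto
    then have "\<And>k x. k \<ge> N \<Longrightarrow> cmod (s k x - l x) < e"
      using \<open>e > 0\<close> by (smt (verit) field_sum_of_halves)
    then show "\<forall>\<^sub>F k in sequentially. \<forall>x\<in>topspace X. l x \<in> UNIV \<and> dist (s k x) (l x) < e"
      by (auto simp: eventually_sequentially dist_norm)
  qed auto
  then show "continuous_map X euclidean l" by simp
  show "l x = 0" if "x \<notin> topspace X" for x
  proof (rule ccontr)
    assume "l x \<noteq> 0"
    then obtain N where "cmod (s N x - l x) \<le> cmod (l x) / 2"
      using lim[of "cmod (l x) / 2"] by auto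
    with s[of N] that \<open>l x \<noteq> 0\<close> show False by (auto simp: C0_functions_def)
  qed
  fix e :: real assume e: "e > 0"
  then obtain N where N: "\<And>x. cmod (s N x - l x) \<le> e/2"
    using lim[of "e/2"] by auto
  have "e/2 \<le> cmod (s N x)" if "e \<le> cmod (l x)" for x
    using N[of x] that norm_triangle_ineq2[of "l x" "s N x"] by (simp add: norm_minus_commute)
  then show "\<exists>K. compactin X K \<and> (\<forall>x. e \<le> cmod (l x) \<longrightarrow> x \<in> K)"
    using C0_compact[OF s, of "e/2" N] e by (meson half_gt_zero)
qed

lemma cstar_algebra_C0: "cstar_algebra (C0 (X :: 'x topology))"
proof -
  have ab: "abelian_group (C0 X)"
  proof (rule abelian_groupI)
    fix f assume "f \<in> carrier (C0 X)"
    then show "\<exists>g\<in>carrier (C0 X). g \<oplus>\<^bsub>C0 X\<^esub> f = \<zero>\<^bsub>C0 X\<^esub>"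
      using C0_smult[of f X "-1"] by (intro bexI[of _ "\<lambda>x. - 1 * f x"]) (auto simp: C0_def)
  qed (auto simp: C0_def C0_add C0_zero algebra_simps)
  have inv: "\<ominus>\<^bsub>C0 X\<^esub> g = (\<lambda>x. - g x)" if "g \<in> C0_functions X" for g
  proof -
    have "(\<lambda>x. - g x) \<in> C0_functions X" using C0_smult[OF that, of "-1"] by simp
    then show ?thesis
      using that by (intro abelian_group.minus_equality[OF ab, symmetric, THEN sym]) (auto simp: C0_def)
  qed
  have diff: "f \<ominus>\<^bsub>C0 X\<^esub> g = (\<lambda>x. f x - g x)" "(\<lambda>x. f x - g x) \<in> C0_functions X"
    if "f \<in> C0_functions X" "g \<in> C0_functions X" for f g
    using inv[OF that(2)] C0_add[OF that(1) C0_smult[OF that(2), of "-1"]]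
    by (auto simp: a_minus_def C0_def)
  have norm_le: "cmod (f x) \<le> cnorm (C0 X) f" if "f \<in> C0_functions X" for f x
    using C0_cmod_le[OF that] by (simp add: C0_def)
  have norm_leI: "cnorm (C0 X) f \<le> B" if "\<And>x. cmod (f x) \<le> B" for f B
    unfolding C0_def using that by (auto intro: cSUP_least)
  have norm_nonneg: "0 \<le> cnorm (C0 X) f" if "f \<in> C0_functions X" for f
    using norm_le[OF that] norm_ge_zero order_trans by blast
  have md: "module complex_ring (C0 X)"
    by (rule moduleI[OF cring_complex_ring ab])
       (auto simp: C0_def C0_smult complex_ring_def algebra_simps)
  have st: "star_algebra (C0 X)"
    by (intro star_algebra.intro md star_algebra_axioms.intro)
       (auto simp: C0_def C0_mult C0_cnj algebra_simps)
  show ?thesis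
  proof (intro cstar_algebra.intro st cstar_algebra_axioms.intro)
    fix f g c
    assume f: "f \<in> carrier (C0 X)" 
    then have f': "f \<in> C0_functions X" by (simp add: C0_def)
    show "0 \<le> cnorm (C0 X) f" using norm_nonneg f' .
    show "(cnorm (C0 X) f = 0) = (f = \<zero>\<^bsub>C0 X\<^esub>)"
    proof
      assume "cnorm (C0 X) f = 0"
      then have "f x = 0" for x using norm_le[OF f', of x] by simp
      then show "f = \<zero>\<^bsub>C0 X\<^esub>" by (auto simp: C0_def)
    qed (simp add: C0_def)
    show "cnorm (C0 X) (c \<odot>\<^bsub>C0 X\<^esub> f) = cmod c * cnorm (C0 X) f"
    proof (rule antisym)
      show "cnorm (C0 X) (c \<odot>\<^bsub>C0 X\<^esub> f) \<le> cmod c * cnorm (C0 X) f"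
        by (rule norm_leI) (use norm_le[OF f'] in \<open>auto simp: C0_def norm_mult intro: mult_left_mono\<close>)
      show "cmod c * cnorm (C0 X) f \<le> cnorm (C0 X) (c \<odot>\<^bsub>C0 X\<^esub> f)"
      proof (cases "c = 0")
        case False
        have "cnorm (C0 X) f \<le> cnorm (C0 X) (c \<odot>\<^bsub>C0 X\<^esub> f) / cmod c"
        proof (rule norm_leI)
          fix x
          have "cmod (c * f x) \<le> cnorm (C0 X) (\<lambda>x. c * f x)"
            by (rule norm_le[OF C0_smult[OF f']])
          then show "cmod (f x) \<le> cnorm (C0 X) (c \<odot>\<^bsub>C0 X\<^esub> f) / cmod c"
            using False by (simp add: C0_def norm_mult field_simps)
        qed
        then show ?thesis using False by (simp add: field_simps)
      qed (simp add: C0_def)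
    qed
    show "cnorm (C0 X) (adj (C0 X) f \<otimes>\<^bsub>C0 X\<^esub> f) = (cnorm (C0 X) f)\<^sup>2"
    proof (rule antisym)
      show "cnorm (C0 X) (adj (C0 X) f \<otimes>\<^bsub>C0 X\<^esub> f) \<le> (cnorm (C0 X) f)\<^sup>2"
        by (rule norm_leI)
           (use norm_le[OF f'] norm_nonneg[OF f'] in
             \<open>auto simp: C0_def norm_mult power2_eq_square intro!: mult_mono\<close>)
      have "cnorm (C0 X) f \<le> sqrt (cnorm (C0 X) (adj (C0 X) f \<otimes>\<^bsub>C0 X\<^esub> f))"
      proof (rule norm_leI)
        fix x
        have "cmod (cnj (f x) * f x) \<le> cnorm (C0 X) (\<lambda>x. cnj (f x) * f x)"
          by (rule norm_le[OF C0_mult[OF C0_cnj[OF f'] f']])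
        then have "(cmod (f x))\<^sup>2 \<le> cnorm (C0 X) (adj (C0 X) f \<otimes>\<^bsub>C0 X\<^esub> f)"
          by (simp add: C0_def norm_mult power2_eq_square)
        then show "cmod (f x) \<le> sqrt (cnorm (C0 X) (adj (C0 X) f \<otimes>\<^bsub>C0 X\<^esub> f))"
          by (rule real_le_rsqrt)
      qed
      then show "(cnorm (C0 X) f)\<^sup>2 \<le> cnorm (C0 X) (adj (C0 X) f \<otimes>\<^bsub>C0 X\<^esub> f)"
        using norm_nonneg[OF f'] by (metis order_trans real_sqrt_ge_0_iff real_sqrt_pow2 power_mono)
    qed
    assume "g \<in> carrier (C0 X)"
    then have g': "g \<in> C0_functions X" by (simp add: C0_def)
    show "cnorm (C0 X) (f \<oplus>\<^bsub>C0 X\<^esub> g) \<le> cnorm (C0 X) f + cnorm (C0 X) g"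
    proof (rule norm_leI)
      show "cmod ((f \<oplus>\<^bsub>C0 X\<^esub> g) x) \<le> cnorm (C0 X) f + cnorm (C0 X) g" for x
        using norm_triangle_ineq[of "f x" "g x"] norm_le[OF f', of x] norm_le[OF g', of x]
        by (simp add: C0_def)
    qed
    show "cnorm (C0 X) (f \<otimes>\<^bsub>C0 X\<^esub> g) \<le> cnorm (C0 X) f * cnorm (C0 X) g"
    proof (rule norm_leI)
      show "cmod ((f \<otimes>\<^bsub>C0 X\<^esub> g) x) \<le> cnorm (C0 X) f * cnorm (C0 X) g" for x
      proof -
        have "(f \<otimes>\<^bsub>C0 X\<^esub> g) x = f x * g x" by (simp add: C0_def)
        then have "cmod ((f \<otimes>\<^bsub>C0 X\<^esub> g) x) = cmod (f x) * cmod (g x)"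
          by (simp only: norm_mult)
        also have "\<dots> \<le> cnorm (C0 X) f * cnorm (C0 X) g"
          by (rule mult_mono[OF norm_le[OF f'] norm_le[OF g'] norm_nonneg[OF f'] norm_ge_zero])
        finally show ?thesis .
      qed
    qed
  next
    fix s :: "nat \<Rightarrow> 'x \<Rightarrow> complex"
    assume "\<And>k. s k \<in> carrier (C0 X)"
    then have s: "s k \<in> C0_functions X" for k by (simp add: C0_def)
    assume C: "\<forall>e>0. \<exists>N. \<forall>i\<ge>N. \<forall>j\<ge>N. cnorm (C0 X) (s i \<ominus>\<^bsub>C0 X\<^esub> s j) < e"
    have C': "\<exists>N. \<forall>i\<ge>N. \<forall>j\<ge>N. \<forall>x. cmod (s i x - s j x) < e" if "e > 0" for e
    proof -
      obtain N where N: "\<And>i j. i \<ge> N \<Longrightarrow> j \<ge> N \<Longrightarrow> cnorm (C0 X) (s i \<ominus>\<^bsub>C0 X\<^esub> s j) < e"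
        using C \<open>e > 0\<close> by blast
      have "cmod (s i x - s j x) < e" if "i \<ge> N" "j \<ge> N" for i j x
        using norm_le[OF diff(2)[OF s[of i] s[of j]], of x] N[OF that] by (simp add: diff(1)[OF s s])
      then show ?thesis by blast
    qed
    have "Cauchy (\<lambda>k. s k x)" for x
      unfolding Cauchy_iff using C' by blast
    then have conv: "convergent (\<lambda>k. s k x)" for x
      by (rule Cauchy_convergent)
    define l where "l x = lim (\<lambda>k. s k x)" for x
    have l: "(\<lambda>k. s k x) \<longlonglongrightarrow> l x" for x
      using conv[of x] unfolding l_def convergent_LIMSEQ_iff .
    have lim: "\<exists>N. \<forall>k\<ge>N. \<forall>x. cmod (s k x - l x) \<le> e" if e: "e > 0" for e
    proof -
      obtain N where N: "\<And>i j x. i \<ge> N \<Longrightarrow> j \<ge> N \<Longrightarrow> cmod (s i x - s j x) < e"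
        using C'[OF e] by blast
      have "cmod (s k x - l x) \<le> e" if "k \<ge> N" for k x
      proof (rule LIMSEQ_le_const2)
        show "(\<lambda>j. cmod (s k x - s j x)) \<longlonglongrightarrow> cmod (s k x - l x)"
          by (intro tendsto_intros l)
        show "\<exists>M. \<forall>j\<ge>M. cmod (s k x - s j x) \<le> e"
          using N that by (meson less_imp_le)
      qed
      then show ?thesis by blast
    qed
    have lC: "l \<in> C0_functions X" by (rule C0_limit[OF s lim])
    have "(\<lambda>k. cnorm (C0 X) (s k \<ominus>\<^bsub>C0 X\<^esub> l)) \<longlonglongrightarrow> 0"
    proof (rule LIMSEQ_I)
      fix r :: real assume "r > 0"
      then obtain N where N: "\<And>k x. k \<ge> N \<Longrightarrow> cmod (s k x - l x) \<le> r/2"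
        using lim[of "r/2"] by auto
      have "norm (cnorm (C0 X) (s k \<ominus>\<^bsub>C0 X\<^esub> l) - 0) < r" if "k \<ge> N" for k
      proof -
        have "cnorm (C0 X) (s k \<ominus>\<^bsub>C0 X\<^esub> l) \<le> r/2"
          unfolding diff(1)[OF s lC] by (rule norm_leI) (use N that in auto)
        moreover have "0 \<le> cnorm (C0 X) (s k \<ominus>\<^bsub>C0 X\<^esub> l)"
          unfolding diff(1)[OF s lC] by (rule norm_nonneg[OF diff(2)[OF s lC]])
        ultimately show ?thesis using \<open>r > 0\<close> by simp
      qed
      then show "\<exists>N. \<forall>k\<ge>N. norm (cnorm (C0 X) (s k \<ominus>\<^bsub>C0 X\<^esub> l) - 0) < r" by blast
    qed
    moreover have "l \<in> carrier (C0 X)" using lC by (simp add: C0_def)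
    ultimately show "\<exists>l\<in>carrier (C0 X). (\<lambda>k. cnorm (C0 X) (s k \<ominus>\<^bsub>C0 X\<^esub> l)) \<longlonglongrightarrow> 0"
      by (rule bexI)
  qed
qed


section \<open>Independence of the types of indices and of finite-dimensional algebras\<close>

lemma finsum_additive:
  assumes A: "abelian_monoid A" and B: "abelian_monoid B"
    and h: "h \<in> carrier A \<rightarrow> carrier B" "h \<zero>\<^bsub>A\<^esub> = \<zero>\<^bsub>B\<^esub>"
    and add: "\<And>x y. \<lbrakk>x \<in> carrier A; y \<in> carrier A\<rbrakk> \<Longrightarrow> h (x \<oplus>\<^bsub>A\<^esub> y) = h x \<oplus>\<^bsub>B\<^esub> h y"
    and S: "finite S" "f \<in> S \<rightarrow> carrier A"
  shows "h (\<Oplus>\<^bsub>A\<^esub>s\<in>S. f s) = (\<Oplus>\<^bsub>B\<^esub>s\<in>S. h (f s))"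
  using S
proof (induction S rule: finite_induct)
  case empty
  then show ?case
    by (simp add: abelian_monoid.finsum_empty[OF A] abelian_monoid.finsum_empty[OF B] h)
next
  case (insert x S)
  have hB: "(\<lambda>s. h (f s)) \<in> S \<rightarrow> carrier B" "h (f x) \<in> carrier B" using insert h by auto
  have fA: "f \<in> S \<rightarrow> carrier A" "f x \<in> carrier A" using insert by auto
  show ?case
    using insert.IH[OF fA(1)] abelian_monoid.finsum_closed[OF A fA(1)]
    by (simp add: abelian_monoid.finsum_insert[OF A insert.hyps fA]
        abelian_monoid.finsum_insert[OF B insert.hyps hB] add fA)
qed

definition transport :: "('a \<Rightarrow> 'b) \<Rightarrow> 'a cstar_algebra \<Rightarrow> 'b cstar_algebra" where
  "transport h F = (let g = inv_into (carrier F) h in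
    \<lparr>carrier = h ` carrier F,
     mult = (\<lambda>x y. h (g x \<otimes>\<^bsub>F\<^esub> g y)),
     one = undefined,
     zero = h \<zero>\<^bsub>F\<^esub>,
     add = (\<lambda>x y. h (g x \<oplus>\<^bsub>F\<^esub> g y)),
     smult = (\<lambda>c x. h (c \<odot>\<^bsub>F\<^esub> g x)),
     adj = (\<lambda>x. h (adj F (g x))),
     cnorm = (\<lambda>x. cnorm F (g x))\<rparr>)"

lemma cp_map_comp:
  assumes "cp_map A B f" "cp_map B C g"
  shows "cp_map A C (g \<circ> f)"
proof -
  have f: "f \<in> carrier A \<rightarrow> carrier B" using assms by (simp add: cp_map_def linear_map_def)
  have "amplification k (g \<circ> f) a = amplification k g (amplification k f a)" for k a
    by (auto simp: amplification_def fun_eq_iff)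
  then show ?thesis using assms f unfolding cp_map_def linear_map_def by (auto simp: Pi_iff)
qed

text \<open>The carrier of \<open>A\<close> may be an ideal that is not known to be closed under the involution.\<close>

lemma cp_map_hom:
  assumes A: "abelian_monoid A" and B: "abelian_monoid B"
    and h: "h \<in> carrier A \<rightarrow> carrier B" "h \<zero>\<^bsub>A\<^esub> = \<zero>\<^bsub>B\<^esub>"
    and add: "\<And>x y. \<lbrakk>x \<in> carrier A; y \<in> carrier A\<rbrakk> \<Longrightarrow> h (x \<oplus>\<^bsub>A\<^esub> y) = h x \<oplus>\<^bsub>B\<^esub> h y"
    and sm: "\<And>c x. x \<in> carrier A \<Longrightarrow> h (c \<odot>\<^bsub>A\<^esub> x) = c \<odot>\<^bsub>B\<^esub> h x"
    and cl: "\<And>x y. \<lbrakk>x \<in> carrier A; y \<in> carrier A\<rbrakk> \<Longrightarrow> adj A x \<otimes>\<^bsub>A\<^esub> y \<in> carrier A"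
    and mu: "\<And>x y. \<lbrakk>x \<in> carrier A; y \<in> carrier A\<rbrakk>
       \<Longrightarrow> h (adj A x \<otimes>\<^bsub>A\<^esub> y) = adj B (h x) \<otimes>\<^bsub>B\<^esub> h y"
    and clB: "\<And>x y. \<lbrakk>x \<in> carrier B; y \<in> carrier B\<rbrakk> \<Longrightarrow> adj B x \<otimes>\<^bsub>B\<^esub> y \<in> carrier B"
  shows "cp_map A B h"
  unfolding cp_map_def
proof (intro conjI allI ballI)
  show "linear_map A B h" using h add sm by (simp add: linear_map_def)
  fix k a assume "a \<in> positive_elements (matrix_algebra k A)"
  then obtain y where y: "y \<in> carrier (matrix_algebra k A)"
    and a: "a = adj (matrix_algebra k A) y \<otimes>\<^bsub>matrix_algebra k A\<^esub> y"
    unfolding positive_elements_def by blast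
  have y': "y i j \<in> carrier A" if "i < k" "j < k" for i j
    using y that by (auto simp: matrix_algebra_def PiE_iff)
  have c: "(\<Oplus>\<^bsub>A\<^esub>l\<in>{..<k}. restrict (\<lambda>j. restrict (\<lambda>i. adj A (y i j)) {..<k}) {..<k} i l \<otimes>\<^bsub>A\<^esub> y l j)
     = (\<Oplus>\<^bsub>A\<^esub>l\<in>{..<k}. adj A (y l i) \<otimes>\<^bsub>A\<^esub> y l j)" if "i < k" "j < k" for i j
    using that cl y' by (intro abelian_monoid.finsum_cong'[OF A]) auto
  have cB: "(\<Oplus>\<^bsub>B\<^esub>l\<in>{..<k}. restrict (\<lambda>j. restrict (\<lambda>i. adj B (amplification k h y i j)) {..<k}) {..<k} i l
         \<otimes>\<^bsub>B\<^esub> amplification k h y l j)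
     = (\<Oplus>\<^bsub>B\<^esub>l\<in>{..<k}. adj B (h (y l i)) \<otimes>\<^bsub>B\<^esub> h (y l j))" if "i < k" "j < k" for i j
    using that clB y' h by (intro abelian_monoid.finsum_cong'[OF B]) (auto simp: amplification_def Pi_iff)
  have "h (\<Oplus>\<^bsub>A\<^esub>l\<in>{..<k}. adj A (y l i) \<otimes>\<^bsub>A\<^esub> y l j)
      = (\<Oplus>\<^bsub>B\<^esub>l\<in>{..<k}. adj B (h (y l i)) \<otimes>\<^bsub>B\<^esub> h (y l j))" if "i < k" "j < k" for i j
  proof -
    have "h (\<Oplus>\<^bsub>A\<^esub>l\<in>{..<k}. adj A (y l i) \<otimes>\<^bsub>A\<^esub> y l j)
        = (\<Oplus>\<^bsub>B\<^esub>l\<in>{..<k}. h (adj A (y l i) \<otimes>\<^bsub>A\<^esub> y l j))"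
      using that cl y' by (intro finsum_additive[OF A B h]) (auto simp: add)
    also have "\<dots> = (\<Oplus>\<^bsub>B\<^esub>l\<in>{..<k}. adj B (h (y l i)) \<otimes>\<^bsub>B\<^esub> h (y l j))"
      using that clB y' h mu by (intro abelian_monoid.finsum_cong'[OF B]) (auto simp: Pi_iff)
    finally show ?thesis .
  qed
  then have "amplification k h a
     = adj (matrix_algebra k B) (amplification k h y) \<otimes>\<^bsub>matrix_algebra k B\<^esub> amplification k h y"
    unfolding a using c cB
    by (auto simp: matrix_algebra_def amplification_def fun_eq_iff restrict_def)
  moreover have "amplification k h y \<in> carrier (matrix_algebra k B)"
    using y' h by (auto simp: matrix_algebra_def amplification_def Pi_iff PiE_iff)
  ultimately show "amplification k h a \<in> positive_elements (matrix_algebra k B)"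
    unfolding positive_elements_def by blast
qed

context
  fixes F :: "'a cstar_algebra" and h :: "'a \<Rightarrow> 'b"
  assumes F: "cstar_algebra F" and inj: "inj_on h (carrier F)"
begin

interpretation F: cstar_algebra F by (rule F)

abbreviation "hinv \<equiv> inv_into (carrier F) h"
abbreviation "Fh \<equiv> transport h F"

lemma hinv_h: "x \<in> carrier F \<Longrightarrow> hinv (h x) = x"
  using inj by simp

lemma transport_sel:
  "carrier Fh = h ` carrier F" "\<zero>\<^bsub>Fh\<^esub> = h \<zero>\<^bsub>F\<^esub>"
  "x \<oplus>\<^bsub>Fh\<^esub> y = h (hinv x \<oplus>\<^bsub>F\<^esub> hinv y)" "x \<otimes>\<^bsub>Fh\<^esub> y = h (hinv x \<otimes>\<^bsub>F\<^esub> hinv y)"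
  "c \<odot>\<^bsub>Fh\<^esub> x = h (c \<odot>\<^bsub>F\<^esub> hinv x)" "adj Fh x = h (adj F (hinv x))" "cnorm Fh x = cnorm F (hinv x)"
  by (simp_all add: transport_def Let_def)

lemmas F_cl = F.smult_closed[unfolded complex_ring_def, simplified] F.m_closed F.adj_closed

lemma transport_abelian: "abelian_group Fh"
proof (rule abelian_groupI)
  fix x assume "x \<in> carrier Fh"
  then show "\<exists>y\<in>carrier Fh. y \<oplus>\<^bsub>Fh\<^esub> x = \<zero>\<^bsub>Fh\<^esub>"
    by (auto simp: transport_sel hinv_h F.M.l_neg intro!: bexI[of _ "\<ominus>\<^bsub>F\<^esub> _"])
qed (auto simp: transport_sel hinv_h F.M.a_ac)

lemma transport_minus:
  assumes "x \<in> carrier F" "y \<in> carrier F"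
  shows "h x \<ominus>\<^bsub>Fh\<^esub> h y = h (x \<ominus>\<^bsub>F\<^esub> y)"
proof -
  have "\<ominus>\<^bsub>Fh\<^esub> h y = h (\<ominus>\<^bsub>F\<^esub> y)"
    using assms by (intro abelian_group.minus_equality[OF transport_abelian])
      (auto simp: transport_sel hinv_h F.M.l_neg)
  then show ?thesis using assms by (simp add: a_minus_def transport_sel hinv_h)
qed

lemma transport_cstar: "cstar_algebra Fh"
proof (intro cstar_algebra.intro star_algebra.intro cstar_algebra_axioms.intro star_algebra_axioms.intro)
  show "module complex_ring Fh"
    using F.smult_l_distr F.smult_r_distr F.smult_assoc1 F.smult_one
    by (intro moduleI transport_abelian F.R.is_cring)
       (auto simp: transport_sel hinv_h complex_ring_def F_cl)
  fix s :: "nat \<Rightarrow> 'b" assume s: "\<And>k. s k \<in> carrier Fh"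
    and C: "\<forall>e>0. \<exists>N. \<forall>i\<ge>N. \<forall>j\<ge>N. cnorm Fh (s i \<ominus>\<^bsub>Fh\<^esub> s j) < e"
  define t where "t k = hinv (s k)" for k
  have t: "t k \<in> carrier F" "s k = h (t k)" for k
    using s[of k] by (auto simp: t_def transport_sel hinv_h)
  have "\<exists>l\<in>carrier F. (\<lambda>k. cnorm F (t k \<ominus>\<^bsub>F\<^esub> l)) \<longlonglongrightarrow> 0"
    using C by (intro F.complete t) (simp add: t(2) transport_minus t(1) transport_sel hinv_h)
  then show "\<exists>l\<in>carrier Fh. (\<lambda>k. cnorm Fh (s k \<ominus>\<^bsub>Fh\<^esub> l)) \<longlonglongrightarrow> 0"
    by (auto simp: transport_sel(1) t(2) transport_minus t(1) transport_sel(7) hinv_h)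
qed (use F.m_assoc F.l_distr F.r_distr F.smult_m_left F.smult_m_right F.adj_adj F.adj_add
       F.adj_smult F.adj_mult F.cnorm_nonneg F.cnorm_eq_0 F.cnorm_triangle F.cnorm_smult
       F.cnorm_mult F.cstar_identity
     in \<open>auto simp: transport_sel hinv_h F_cl inj_on_eq_iff[OF inj]\<close>)

lemma ideal_abelian_monoid:
  assumes "two_sided_ideal I F"
  shows "abelian_monoid (F\<lparr>carrier := I\<rparr>)"
  using assms unfolding two_sided_ideal_def
  by (intro abelian_monoidI) (auto simp: F.M.a_ac subset_iff)

lemma transport_ideal:
  assumes "two_sided_ideal I F"
  shows "two_sided_ideal (h ` I) Fh"
  using assms unfolding two_sided_ideal_def
  by (auto simp: transport_sel hinv_h subset_iff)

lemma transport_ideal_abelian_monoid: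
  assumes "two_sided_ideal I F"
  shows "abelian_monoid (Fh\<lparr>carrier := h ` I\<rparr>)"
  using assms unfolding two_sided_ideal_def
  by (intro abelian_monoidI) (auto simp: transport_sel F.M.a_ac subset_iff hinv_h)

lemma cp_hinv:
  assumes "two_sided_ideal I F"
  shows "cp_map (Fh\<lparr>carrier := h ` I\<rparr>) (F\<lparr>carrier := I\<rparr>) hinv"
  by (rule cp_map_hom[OF transport_ideal_abelian_monoid[OF assms] ideal_abelian_monoid[OF assms]])
     (use assms in \<open>auto simp: two_sided_ideal_def transport_sel hinv_h F_cl subset_iff\<close>)

lemma ideal_top: "two_sided_ideal (carrier F) F"
  by (auto simp: two_sided_ideal_def F_cl)

lemma cp_h: "cp_map F Fh h"
  by (rule cp_map_hom)
     (use transport_abelian in \<open>auto simp: transport_sel hinv_h F_cl abelian_group_def F.M.abelian_monoid_axioms\<close>)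

lemma transport_finite_dimensional:
  assumes "finite_dimensional F" shows "finite_dimensional Fh"
proof -
  obtain S where S: "finite S" "S \<subseteq> carrier F"
    and span: "\<And>x. x \<in> carrier F \<Longrightarrow> \<exists>c. x = (\<Oplus>\<^bsub>F\<^esub>s\<in>S. c s \<odot>\<^bsub>F\<^esub> s)"
    using assms unfolding finite_dimensional_def by blast
  have Tm: "abelian_monoid Fh" using transport_abelian by (simp add: abelian_group_def)
  have "\<exists>c. h x = (\<Oplus>\<^bsub>Fh\<^esub>t\<in>h ` S. c t \<odot>\<^bsub>Fh\<^esub> t)" if x: "x \<in> carrier F" for x
  proof -
    obtain c where c: "x = (\<Oplus>\<^bsub>F\<^esub>s\<in>S. c s \<odot>\<^bsub>F\<^esub> s)" using span[OF x] by blast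
    have "h x = (\<Oplus>\<^bsub>Fh\<^esub>s\<in>S. h (c s \<odot>\<^bsub>F\<^esub> s))"
      unfolding c using S
      by (intro finsum_additive[OF F.M.abelian_monoid_axioms Tm]) (auto simp: transport_sel hinv_h F_cl subset_iff)
    also have "\<dots> = (\<Oplus>\<^bsub>Fh\<^esub>s\<in>S. c (hinv (h s)) \<odot>\<^bsub>Fh\<^esub> h s)"
      using S by (intro abelian_monoid.finsum_cong'[OF Tm]) (auto simp: transport_sel hinv_h F_cl subset_iff)
    also have "\<dots> = (\<Oplus>\<^bsub>Fh\<^esub>t\<in>h ` S. c (hinv t) \<odot>\<^bsub>Fh\<^esub> t)"
      using S inj by (intro abelian_monoid.finsum_reindex[OF Tm, symmetric])
        (auto simp: transport_sel hinv_h F_cl subset_iff inj_on_subset)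
    finally show ?thesis by (intro exI[of _ "\<lambda>t. c (hinv t)"])
  qed
  then show ?thesis
    unfolding finite_dimensional_def using S by (intro exI[of _ "h ` S"]) (auto simp: transport_sel)
qed

lemma transport_decomposition:
  assumes dec: "ideal_decomposition n I F"
  shows "ideal_decomposition n (\<lambda>i. h ` I i) Fh"
  unfolding ideal_decomposition_def
proof (intro conjI allI impI ballI)
  have I: "\<And>i. i \<le> n \<Longrightarrow> two_sided_ideal (I i) F"
    and ex1: "\<And>x. x \<in> carrier F \<Longrightarrow> \<exists>!y. y \<in> (\<Pi>\<^sub>E i\<in>{..n}. I i) \<and> x = (\<Oplus>\<^bsub>F\<^esub>i\<in>{..n}. y i)"
    using dec unfolding ideal_decomposition_def by blast+
  have Tm: "abelian_monoid Fh" using transport_abelian by (simp add: abelian_group_def)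
  have IF: "\<And>i x. i \<le> n \<Longrightarrow> x \<in> I i \<Longrightarrow> x \<in> carrier F"
    using I unfolding two_sided_ideal_def by blast
  show "two_sided_ideal (h ` I i) Fh" if "i \<le> n" for i using transport_ideal I that by blast
  fix z assume "z \<in> carrier Fh"
  then obtain x where x: "x \<in> carrier F" "z = h x" by (auto simp: transport_sel)
  have sum: "(\<Oplus>\<^bsub>Fh\<^esub>i\<in>{..n}. h (y i)) = h (\<Oplus>\<^bsub>F\<^esub>i\<in>{..n}. y i)"
    if "\<And>i. i \<le> n \<Longrightarrow> y i \<in> carrier F" for y
    using that by (intro finsum_additive[OF F.M.abelian_monoid_axioms Tm, symmetric])
      (auto simp: transport_sel hinv_h)
  obtain y where y: "y \<in> (\<Pi>\<^sub>E i\<in>{..n}. I i)" "x = (\<Oplus>\<^bsub>F\<^esub>i\<in>{..n}. y i)"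
    and uniq: "\<And>y'. \<lbrakk>y' \<in> (\<Pi>\<^sub>E i\<in>{..n}. I i); x = (\<Oplus>\<^bsub>F\<^esub>i\<in>{..n}. y' i)\<rbrakk> \<Longrightarrow> y' = y"
    using ex1[OF x(1)] by metis
  have yF: "y i \<in> carrier F" if "i \<le> n" for i using y IF that by (auto simp: PiE_iff)
  show "\<exists>!w. w \<in> (\<Pi>\<^sub>E i\<in>{..n}. h ` I i) \<and> z = (\<Oplus>\<^bsub>Fh\<^esub>i\<in>{..n}. w i)"
  proof (intro ex1I conjI; (elim conjE)?)
    let ?w = "\<lambda>i\<in>{..n}. h (y i)"
    show "?w \<in> (\<Pi>\<^sub>E i\<in>{..n}. h ` I i)" using y by (auto simp: PiE_iff)
    have "(\<Oplus>\<^bsub>Fh\<^esub>i\<in>{..n}. ?w i) = (\<Oplus>\<^bsub>Fh\<^esub>i\<in>{..n}. h (y i))"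
      using yF by (intro abelian_monoid.finsum_cong'[OF Tm]) (auto simp: transport_sel)
    then show "z = (\<Oplus>\<^bsub>Fh\<^esub>i\<in>{..n}. ?w i)" using sum[OF yF] y x by simp
    fix w assume w: "w \<in> (\<Pi>\<^sub>E i\<in>{..n}. h ` I i)" "z = (\<Oplus>\<^bsub>Fh\<^esub>i\<in>{..n}. w i)"
    define y' where "y' = (\<lambda>i\<in>{..n}. hinv (w i))"
    have y'I: "y' i \<in> I i" "h (y' i) = w i" if "i \<le> n" for i
    proof -
      have "w i \<in> h ` I i" using w that by (auto simp: PiE_iff)
      then obtain v where v: "v \<in> I i" "w i = h v" by blast
      then show "y' i \<in> I i" "h (y' i) = w i" using that IF hinv_h by (auto simp: y'_def)
    qed
    have "z = (\<Oplus>\<^bsub>Fh\<^esub>i\<in>{..n}. h (y' i))"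
      unfolding w(2) using y'I IF
      by (intro abelian_monoid.finsum_cong'[OF Tm]) (auto simp: transport_sel)
    also have "\<dots> = h (\<Oplus>\<^bsub>F\<^esub>i\<in>{..n}. y' i)" using sum y'I IF by blast
    finally have "x = (\<Oplus>\<^bsub>F\<^esub>i\<in>{..n}. y' i)"
      using x inj y'I IF by (simp add: inj_on_eq_iff[OF inj] F.M.finsum_closed)
    then have "y' = y" using y'I by (intro uniq) (auto simp: y'_def)
    then show "w = ?w"
      using y'I w by (auto simp: fun_eq_iff PiE_iff extensional_def restrict_def)
  qed
qed

lemma transport_approximant:
  assumes "nuclear_approximant n A F \<psi> \<phi>"
  shows "nuclear_approximant n A Fh (h \<circ> \<psi>) (\<phi> \<circ> hinv)"
proof -
  obtain I where fd: "finite_dimensional F" and cp: "cp_map A F \<psi>" "cp_map F A \<phi>" "contractive A F \<psi>"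
    and I: "ideal_decomposition n I F"
    and Ii: "\<And>i. i \<le> n \<Longrightarrow> cp_map (F\<lparr>carrier := I i\<rparr>) A \<phi> \<and> contractive (F\<lparr>carrier := I i\<rparr>) A \<phi>
       \<and> order_zero (F\<lparr>carrier := I i\<rparr>) A \<phi>"
    using assms unfolding nuclear_approximant_def Let_def by blast
  have \<psi>: "\<psi> x \<in> carrier F" if "x \<in> carrier A" for x
    using cp that unfolding cp_map_def linear_map_def by blast
  have gT: "cp_map Fh F hinv" using cp_hinv[OF ideal_top] by (simp add: transport_sel(1)[symmetric])
  have "cp_map (Fh\<lparr>carrier := h ` I i\<rparr>) A (\<phi> \<circ> hinv) \<and> contractive (Fh\<lparr>carrier := h ` I i\<rparr>) A (\<phi> \<circ> hinv)
       \<and> order_zero (Fh\<lparr>carrier := h ` I i\<rparr>) A (\<phi> \<circ> hinv)" if i: "i \<le> n" for i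
  proof (intro conjI)
    have id: "two_sided_ideal (I i) F" using I i by (auto simp: ideal_decomposition_def)
    then have IF: "x \<in> carrier F" if "x \<in> I i" for x using that by (auto simp: two_sided_ideal_def)
    have IM: "x \<otimes>\<^bsub>F\<^esub> y \<in> I i" if "x \<in> carrier F" "y \<in> I i" for x y
      using that id by (auto simp: two_sided_ideal_def)
    show "cp_map (Fh\<lparr>carrier := h ` I i\<rparr>) A (\<phi> \<circ> hinv)"
      using cp_map_comp[OF cp_hinv[OF id]] Ii[OF i] by blast
    show "contractive (Fh\<lparr>carrier := h ` I i\<rparr>) A (\<phi> \<circ> hinv)"
      using Ii[OF i] IF by (auto simp: contractive_def transport_sel hinv_h)
    show "order_zero (Fh\<lparr>carrier := h ` I i\<rparr>) A (\<phi> \<circ> hinv)"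
      unfolding order_zero_def
    proof (intro ballI impI)
      fix a b assume a: "a \<in> positive_elements (Fh\<lparr>carrier := h ` I i\<rparr>)"
        and b: "b \<in> positive_elements (Fh\<lparr>carrier := h ` I i\<rparr>)"
        and ab: "a \<otimes>\<^bsub>Fh\<lparr>carrier := h ` I i\<rparr>\<^esub> b = \<zero>\<^bsub>Fh\<lparr>carrier := h ` I i\<rparr>\<^esub>"
      obtain x where x: "x \<in> I i" "a = h (adj F x \<otimes>\<^bsub>F\<^esub> x)"
        using a IF by (auto simp: positive_elements_def transport_sel hinv_h F_cl)
      obtain y where y: "y \<in> I i" "b = h (adj F y \<otimes>\<^bsub>F\<^esub> y)"
        using b IF by (auto simp: positive_elements_def transport_sel hinv_h F_cl)
      have "h ((adj F x \<otimes>\<^bsub>F\<^esub> x) \<otimes>\<^bsub>F\<^esub> (adj F y \<otimes>\<^bsub>F\<^esub> y)) = h \<zero>\<^bsub>F\<^esub>"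
        using ab x y IF by (simp add: transport_sel hinv_h F_cl)
      then have "(adj F x \<otimes>\<^bsub>F\<^esub> x) \<otimes>\<^bsub>F\<^esub> (adj F y \<otimes>\<^bsub>F\<^esub> y) = \<zero>\<^bsub>F\<^esub>"
        using inj x y IF by (simp add: inj_on_eq_iff[OF inj] F_cl)
      moreover have "adj F x \<otimes>\<^bsub>F\<^esub> x \<in> positive_elements (F\<lparr>carrier := I i\<rparr>)"
        "adj F y \<otimes>\<^bsub>F\<^esub> y \<in> positive_elements (F\<lparr>carrier := I i\<rparr>)"
        using x y by (auto simp: positive_elements_def)
      ultimately show "(\<phi> \<circ> hinv) a \<otimes>\<^bsub>A\<^esub> (\<phi> \<circ> hinv) b = \<zero>\<^bsub>A\<^esub>"
        using Ii[OF i] x y IF by (simp add: order_zero_def hinv_h F_cl)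
    qed
  qed
  then show ?thesis
    unfolding nuclear_approximant_def Let_def
    using transport_cstar transport_finite_dimensional[OF fd] cp_map_comp[OF cp(1) cp_h] cp_map_comp[OF gT cp(2)]
      cp(3) \<psi> transport_decomposition[OF I]
    by (auto simp: contractive_def transport_sel hinv_h)
qed

lemma transport_contractive: "contractive F A \<phi> \<Longrightarrow> contractive Fh A (\<phi> \<circ> hinv)"
  by (auto simp: contractive_def transport_sel hinv_h)

end

lemma finite_dimensional_embeds:
  assumes F: "cstar_algebra F" and fd: "finite_dimensional F"
  shows "\<exists>h :: 'a \<Rightarrow> nat \<Rightarrow> complex. inj_on h (carrier F)"
proof -
  interpret cstar_algebra F by (rule F)
  obtain S c where S: "finite S" "S \<subseteq> carrier F"
    and span: "\<And>x. x \<in> carrier F \<Longrightarrow> x = (\<Oplus>\<^bsub>F\<^esub>s\<in>S. c x s \<odot>\<^bsub>F\<^esub> s)"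
    using fd unfolding finite_dimensional_def by metis
  obtain e where e: "bij_betw e {..<card S} S"
    using ex_bij_betw_nat_finite[OF S(1)] by (auto simp: atLeast0LessThan)
  have "x = y" if xy: "x \<in> carrier F" "y \<in> carrier F" "(\<lambda>k. c x (e k)) = (\<lambda>k. c y (e k))" for x y
  proof -
    have "c x s = c y s" if "s \<in> S" for s
      using that e xy(3) by (metis bij_betw_imp_surj_on image_iff)
    then have "(\<Oplus>\<^bsub>F\<^esub>s\<in>S. c x s \<odot>\<^bsub>F\<^esub> s) = (\<Oplus>\<^bsub>F\<^esub>s\<in>S. c y s \<odot>\<^bsub>F\<^esub> s)"
      using S smult_closed[unfolded complex_ring_def, simplified]
      by (intro M.finsum_cong') (auto simp: subset_iff)
    then show ?thesis using span xy by metis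
  qed
  then show ?thesis by (intro exI[of _ "\<lambda>x k. c x (e k)"] inj_onI)
qed

lemma net_reindex:
  fixes A :: "'a cstar_algebra" and F :: "'i \<Rightarrow> 'b cstar_algebra"
  assumes net: "nuclear_net n A \<Lambda> rel F \<psi> \<phi>"
  obtains \<Lambda>' :: "('a set \<times> nat) set" and rel' and F' :: "_ \<Rightarrow> (nat \<Rightarrow> complex) cstar_algebra"
    and \<psi>' \<phi>' where "nuclear_net n A \<Lambda>' rel' F' \<psi>' \<phi>'"
    and "(\<And>i. i \<in> \<Lambda> \<Longrightarrow> contractive (F i) A (\<phi> i)) \<Longrightarrow> (\<And>i. i \<in> \<Lambda>' \<Longrightarrow> contractive (F' i) A (\<phi>' i))"
proof -
  have dir: "directed_set \<Lambda> rel" and ap: "\<And>i. i \<in> \<Lambda> \<Longrightarrow> nuclear_approximant n A (F i) (\<psi> i) (\<phi> i)"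
    and tend: "tends_to_identity A \<Lambda> rel (\<lambda>i. \<phi> i \<circ> \<psi> i)"
    using net unfolding nuclear_net_def by auto
  have FF: "cstar_algebra (F i)" "finite_dimensional (F i)" if "i \<in> \<Lambda>" for i
    using ap[OF that] unfolding nuclear_approximant_def by auto
  define h where "h i = (SOME h :: 'b \<Rightarrow> nat \<Rightarrow> complex. inj_on h (carrier (F i)))" for i
  have h: "inj_on (h i) (carrier (F i))" if "i \<in> \<Lambda>" for i
    unfolding h_def using finite_dimensional_embeds[OF FF[OF that]] by (rule someI_ex)
  define \<Lambda>' where "\<Lambda>' = {(S, k :: nat). finite S \<and> S \<subseteq> carrier A}"
  define rel' where "rel' = (\<lambda>(S, k :: nat) (S' :: 'a set, k'). S \<subseteq> S' \<and> k \<le> k')"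
  define \<iota> where "\<iota> p = (SOME i. i \<in> \<Lambda> \<and> (\<forall>a\<in>fst p. cnorm A ((\<phi> i \<circ> \<psi> i) a \<ominus>\<^bsub>A\<^esub> a) < 1 / (real (snd p) + 1)))"
    for p :: "'a set \<times> nat"
  have \<iota>: "\<iota> p \<in> \<Lambda> \<and> (\<forall>a\<in>fst p. cnorm A ((\<phi> (\<iota> p) \<circ> \<psi> (\<iota> p)) a \<ominus>\<^bsub>A\<^esub> a) < 1 / (real (snd p) + 1))"
    if "p \<in> \<Lambda>'" for p
  proof -
    have "finite (fst p) \<and> fst p \<subseteq> carrier A \<and> 0 < 1 / (real (snd p) + 1)"
      using that by (auto simp: \<Lambda>'_def)
    then obtain i0 where "i0 \<in> \<Lambda>" "\<forall>i\<in>\<Lambda>. rel i0 i \<longrightarrow>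
        (\<forall>a\<in>fst p. cnorm A ((\<phi> i \<circ> \<psi> i) a \<ominus>\<^bsub>A\<^esub> a) < 1 / (real (snd p) + 1))"
      using tend unfolding tends_to_identity_def by meson
    moreover have "rel i0 i0" using dir \<open>i0 \<in> \<Lambda>\<close> by (auto simp: directed_set_def)
    ultimately have "\<exists>i. i \<in> \<Lambda> \<and> (\<forall>a\<in>fst p. cnorm A ((\<phi> i \<circ> \<psi> i) a \<ominus>\<^bsub>A\<^esub> a) < 1 / (real (snd p) + 1))"
      by blast
    from someI_ex[OF this] show ?thesis unfolding \<iota>_def .
  qed
  let ?F = "\<lambda>p. transport (h (\<iota> p)) (F (\<iota> p))"
  let ?\<psi> = "\<lambda>p. h (\<iota> p) \<circ> \<psi> (\<iota> p)"
  let ?\<phi> = "\<lambda>p. \<phi> (\<iota> p) \<circ> inv_into (carrier (F (\<iota> p))) (h (\<iota> p))"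
  have dir': "directed_set \<Lambda>' rel'"
    unfolding directed_set_def
  proof (intro conjI ballI)
    fix p q assume "p \<in> \<Lambda>'" "q \<in> \<Lambda>'"
    then show "\<exists>r\<in>\<Lambda>'. rel' p r \<and> rel' q r"
      by (intro bexI[of _ "(fst p \<union> fst q, max (snd p) (snd q))"]) (auto simp: \<Lambda>'_def rel'_def)
  qed (auto simp: \<Lambda>'_def rel'_def)
  have "nuclear_net n A \<Lambda>' rel' ?F ?\<psi> ?\<phi>"
    unfolding nuclear_net_def
  proof (intro conjI ballI dir')
    fix p assume "p \<in> \<Lambda>'"
    then show "nuclear_approximant n A (?F p) (?\<psi> p) (?\<phi> p)"
      using \<iota> FF h ap by (intro transport_approximant) auto
  next
    show "tends_to_identity A \<Lambda>' rel' (\<lambda>p. ?\<phi> p \<circ> ?\<psi> p)"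
      unfolding tends_to_identity_def
    proof (intro allI impI, elim conjE)
      fix S and e :: real assume S: "finite S" "S \<subseteq> carrier A" and e: "0 < e"
      obtain k where k: "1 / (real k + 1) < e"
        using e by (metis add.commute nat_approx_posE of_nat_Suc)
      show "\<exists>p0\<in>\<Lambda>'. \<forall>p\<in>\<Lambda>'. rel' p0 p \<longrightarrow> (\<forall>a\<in>S. cnorm A ((?\<phi> p \<circ> ?\<psi> p) a \<ominus>\<^bsub>A\<^esub> a) < e)"
      proof (intro bexI[of _ "(S, k)"] ballI impI)
        show "(S, k) \<in> \<Lambda>'" using S by (simp add: \<Lambda>'_def)
        fix p a assume p: "p \<in> \<Lambda>'" "rel' (S, k) p" and a: "a \<in> S"
        have i: "\<iota> p \<in> \<Lambda>" using \<iota> p by blast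
        have "\<psi> (\<iota> p) a \<in> carrier (F (\<iota> p))"
          using ap[OF i] a S unfolding nuclear_approximant_def cp_map_def linear_map_def by blast
        then have "(?\<phi> p \<circ> ?\<psi> p) a = (\<phi> (\<iota> p) \<circ> \<psi> (\<iota> p)) a"
          using h[OF i] by simp
        moreover have "cnorm A ((\<phi> (\<iota> p) \<circ> \<psi> (\<iota> p)) a \<ominus>\<^bsub>A\<^esub> a) < 1 / (real (snd p) + 1)"
          using \<iota>[OF p(1)] p(2) a by (auto simp: rel'_def)
        moreover have "1 / (real (snd p) + 1) \<le> 1 / (real k + 1)"
          using p(2) by (auto simp: rel'_def intro!: divide_left_mono)
        ultimately show "cnorm A ((?\<phi> p \<circ> ?\<psi> p) a \<ominus>\<^bsub>A\<^esub> a) < e" using k by simp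
      qed
    qed
  qed
  moreover have "contractive (?F p) A (?\<phi> p)"
    if "\<And>i. i \<in> \<Lambda> \<Longrightarrow> contractive (F i) A (\<phi> i)" "p \<in> \<Lambda>'" for p
    using \<iota> FF h that by (intro transport_contractive) auto
  ultimately show ?thesis using that by blast
qed

lemma nuclear_dim_leI:
  fixes F :: "'i \<Rightarrow> 'b cstar_algebra"
  assumes "nuclear_net n A \<Lambda> rel F \<psi> \<phi>"
  shows "nuclear_dim_le A n"
  unfolding nuclear_dim_le_def using net_reindex[OF assms] by metis

lemma decomp_rank_leI:
  fixes F :: "'i \<Rightarrow> 'b cstar_algebra"
  assumes "nuclear_net n A \<Lambda> rel F \<psi> \<phi>" and "\<And>i. i \<in> \<Lambda> \<Longrightarrow> contractive (F i) A (\<phi> i)"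
  shows "decomp_rank_le A n"
  unfolding decomp_rank_le_def using net_reindex[OF assms(1)] assms(2) by metis

end

theory Submission
  imports Defs "HOL-Computational_Algebra.Fundamental_Theorem_Algebra"
begin

text \<open>
  In an approximation \<open>C\<^sub>0(X) \<rightarrow> F \<rightarrow> C\<^sub>0(X)\<close> let \<open>p\<close> range over a maximal orthogonal family of
  minimal projections of \<open>F\<close>. The second map \<open>\<phi>\<close> has order zero on each ideal and commutative
  values, so it only sees the diagonal corners \<open>p F p = \<complex> p\<close>, and the composite becomes
  \<open>f \<mapsto> \<Sum>\<^sub>p \<mu>\<^sub>p(f) g\<^sub>p\<close> with positive contractive functionals \<open>\<mu>\<^sub>p\<close> and \<open>0 \<le> g\<^sub>p = \<phi>(p) \<le> 1\<close>
  in \<open>n + 1\<close> colours, the \<open>g\<^sub>p\<close> of one colour having disjoint supports. For a cut-off function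
  \<open>e\<close> the functions \<open>\<mu>\<^sub>p(e) g\<^sub>p\<close> add up to approximately \<open>e \<le> 1\<close>, so that \<open>\<mu>\<^sub>p(e \<cdot>) / \<mu>\<^sub>p(e)\<close> and
  \<open>\<mu>\<^sub>p(e) g\<^sub>p\<close> form an approximation with contractive second map: this is dr \<open>\<le>\<close> nuclear dimension.
  The sets \<open>{\<mu>\<^sub>p(e) g\<^sub>p > \<delta>}\<close> form coloured covers of compact sets, and by a variance estimate
  finitely many given functions vary little on each of them. Such covers of the members of an
  exhaustion are glued to bound the covering dimension. Conversely, a partition of unity on the nerve
  of a cover, subordinate to the stars of its barycentric subdivision, yields approximations.
\<close>

subsection \<open>Positive semidefinite matrices of functions\<close>

text \<open>\<open>cp_map\<close> is stated through products of adjoint and element in matrix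
  algebras. To check that a map into \<open>C0 X\<close> is completely positive, a pointwise
  positive semidefinite matrix must therefore be factorised with entries that are continuous and
  vanish at infinity; hence the square root for matrices of functions. Every finite-dimensional
  algebra constructed here is \<open>C0\<close> of a finite discrete space, so the same square root
  serves at both ends. For an arbitrary \<open>F\<close> structure theory is replaced by counting:
  orthogonal families of nonzero self-adjoint elements have bounded size, and the members of a
  largest one are multiples of minimal projections, since splitting one of them would give a larger
  family. The cut-off stands in for a unit of \<open>C0 X\<close>. A nuclear approximation bounds
  each \<open>g k\<close> by 1 but not their sum; it is the approximation of the cut-off that bounds
  a weighted sum. All comparisons are made for a fixed \<open>n\<close>, so the infima agree, also
  when they are \<infinity>. Second countability enters through an exhaustion by compact sets, along
  which local refinements are glued.\<close>

text \<open>For \<open>q > 0\<close> the quadratic expression is evaluated at its minimiser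
  \<open>t = - cnj z / q\<close>. For \<open>q = 0\<close> a nonzero \<open>z\<close> would let the
  linear term outweigh \<open>p\<close>.\<close>

lemma cauchy_schwarz_scalar:
  fixes p q :: real and z :: complex
  assumes "0 \<le> q" and nn: "\<And>t. 0 \<le> p + 2 * Re (t * z) + (cmod t)\<^sup>2 * q"
  shows "(cmod z)\<^sup>2 \<le> p * q"
proof (cases "q = 0")
  case True
  have "z = 0"
  proof (rule ccontr)
    assume z: "z \<noteq> 0"
    let ?s = "(\<bar>p\<bar> + 1) / (cmod z)\<^sup>2"
    have "Re (of_real (- ?s) * cnj z * z) = - ?s * (cmod z)\<^sup>2"
      by (simp add: mult.assoc mult.commute[of "cnj z"] complex_norm_square[symmetric] del: of_real_power flip: of_real_mult)
    also have "\<dots> = - (\<bar>p\<bar> + 1)" using z by simp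
    finally show False using nn[of "of_real (- ?s) * cnj z"] True by simp
  qed
  then show ?thesis using True by simp
next
  case False
  then have q: "q > 0" using assms by simp
  have "Re (of_real (- 1 / q) * cnj z * z) = - (cmod z)\<^sup>2 / q"
    by (simp add: mult.assoc mult.commute[of "cnj z"] complex_norm_square[symmetric] del: of_real_power flip: of_real_mult)
  moreover have "(cmod (of_real (- 1 / q) * cnj z))\<^sup>2 * q = (cmod z)\<^sup>2 / q"
    using q by (simp add: norm_mult norm_divide power2_eq_square field_simps)
  ultimately have "0 \<le> p - (cmod z)\<^sup>2 / q"
    using nn[of "of_real (- 1 / q) * cnj z"] by linarith
  then show ?thesis using q by (simp add: field_simps)
qed

text \<open>Membership in the nonnegative reals includes being real, so Hermitian symmetry is
  derived: \<open>t = 1\<close> and \<open>t = \<i>\<close> compare the imaginary and the real parts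
  of \<open>a\<close> and \<open>b\<close>. The lemma serves both for matrices and for the form
  given by a positive map.\<close>

lemma sesquilinear_cauchy_schwarz:
  fixes p q a b :: complex
  assumes nn: "\<And>t. p + t * a + cnj t * b + of_real ((cmod t)\<^sup>2) * q \<in> \<real>\<^sub>\<ge>\<^sub>0" and q: "q \<in> \<real>\<^sub>\<ge>\<^sub>0"
  shows "b = cnj a" "(cmod a)\<^sup>2 \<le> Re p * Re q"
proof -
  have "Im (t * a + cnj t * b) = 0" for t
    using nn[of t] nn[of 0] q by (simp add: complex_nonneg_Reals_iff)
  from this[of 1] this[of \<i>] show b: "b = cnj a" by (simp add: complex_eq_iff)
  show "(cmod a)\<^sup>2 \<le> Re p * Re q"
  proof (rule cauchy_schwarz_scalar)
    show "0 \<le> Re p + 2 * Re (t * a) + (cmod t)\<^sup>2 * Re q" for t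
      using nn[of t] unfolding b by (simp add: complex_nonneg_Reals_iff algebra_simps del: of_real_power)
  qed (use q in \<open>simp add: complex_nonneg_Reals_iff\<close>)
qed

section \<open>Matrices acting on finite vectors: quadratic forms and operator bounds\<close>

definition mat_vec :: "nat \<Rightarrow> (nat \<Rightarrow> nat \<Rightarrow> complex) \<Rightarrow> (nat \<Rightarrow> complex) \<Rightarrow> nat \<Rightarrow> complex" where
  "mat_vec k M v = (\<lambda>i. \<Sum>j<k. M i j * v j)"

definition vec_norm :: "nat \<Rightarrow> (nat \<Rightarrow> complex) \<Rightarrow> real" where
  "vec_norm k v = L2_set (\<lambda>i. cmod (v i)) {..<k}"

definition mat_form :: "nat \<Rightarrow> (nat \<Rightarrow> nat \<Rightarrow> complex) \<Rightarrow> (nat \<Rightarrow> complex) \<Rightarrow> (nat \<Rightarrow> complex) \<Rightarrow> complex" where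
  "mat_form k P u v = (\<Sum>i<k. cnj (u i) * mat_vec k P v i)"

text \<open>The values are required to be real, so Hermitian symmetry is a consequence; see
  \<open>psd_hermitian\<close>.\<close>

definition psd :: "nat \<Rightarrow> (nat \<Rightarrow> nat \<Rightarrow> complex) \<Rightarrow> bool" where
  "psd k P \<longleftrightarrow> (\<forall>v. mat_form k P v v \<in> \<real>\<^sub>\<ge>\<^sub>0)"

text \<open>An upper bound for the operator norm instead of the norm itself: the iterates below only
  have to be dominated.\<close>

definition op_bound :: "nat \<Rightarrow> (nat \<Rightarrow> nat \<Rightarrow> complex) \<Rightarrow> real \<Rightarrow> bool" where
  "op_bound k M w \<longleftrightarrow> 0 \<le> w \<and> (\<forall>v. vec_norm k (mat_vec k M v) \<le> w * vec_norm k v)"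

lemma vec_norm_nonneg: "0 \<le> vec_norm k v"
  by (simp add: vec_norm_def)

lemma vec_norm_sq: "(vec_norm k v)\<^sup>2 = (\<Sum>i<k. (cmod (v i))\<^sup>2)"
  by (simp add: vec_norm_def L2_set_def sum_nonneg)

lemma vec_norm_triangle: "vec_norm k (\<lambda>i. u i + v i) \<le> vec_norm k u + vec_norm k v"
proof -
  have "vec_norm k (\<lambda>i. u i + v i) \<le> L2_set (\<lambda>i. cmod (u i) + cmod (v i)) {..<k}"
    unfolding vec_norm_def by (intro L2_set_mono norm_triangle_ineq) auto
  also have "\<dots> \<le> vec_norm k u + vec_norm k v"
    unfolding vec_norm_def by (rule L2_set_triangle_ineq)
  finally show ?thesis .
qed

lemma vec_norm_scale: "vec_norm k (\<lambda>i. c * v i) = cmod c * vec_norm k v"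
  unfolding vec_norm_def by (simp add: norm_mult L2_set_right_distrib)

lemma mat_vec_comb: "mat_vec k P (\<lambda>i. u i + t * v i) = (\<lambda>i. mat_vec k P u i + t * mat_vec k P v i)"
  by (simp add: mat_vec_def fun_eq_iff sum.distrib sum_distrib_left algebra_simps)

lemma mat_vec_mult: "mat_vec k (\<lambda>i j. \<Sum>l<k. A i l * B l j) v = mat_vec k A (mat_vec k B v)"
  unfolding mat_vec_def fun_eq_iff
  by (auto simp: sum_distrib_left sum_distrib_right mult.assoc intro: sum.swap)

lemma op_bound_mult:
  assumes "op_bound k A a" "op_bound k B b"
  shows "op_bound k (\<lambda>i j. \<Sum>l<k. A i l * B l j) (a * b)"
  unfolding op_bound_def mat_vec_mult
proof (intro conjI allI)
  show "0 \<le> a * b" using assms by (simp add: op_bound_def)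
  fix v
  have "vec_norm k (mat_vec k A (mat_vec k B v)) \<le> a * vec_norm k (mat_vec k B v)"
    using assms by (simp add: op_bound_def)
  also have "\<dots> \<le> a * (b * vec_norm k v)"
    using assms by (intro mult_left_mono) (auto simp: op_bound_def)
  finally show "vec_norm k (mat_vec k A (mat_vec k B v)) \<le> a * b * vec_norm k v"
    by (simp add: mult.assoc)
qed

lemma op_bound_add:
  assumes "op_bound k A a" "op_bound k B b"
  shows "op_bound k (\<lambda>i j. A i j + B i j) (a + b)"
  unfolding op_bound_def
proof (intro conjI allI)
  show "0 \<le> a + b" using assms by (simp add: op_bound_def)
  fix v
  have "vec_norm k (mat_vec k (\<lambda>i j. A i j + B i j) v)
     = vec_norm k (\<lambda>i. mat_vec k A v i + mat_vec k B v i)"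
    by (simp add: mat_vec_def sum.distrib algebra_simps)
  also have "\<dots> \<le> vec_norm k (mat_vec k A v) + vec_norm k (mat_vec k B v)"
    by (rule vec_norm_triangle)
  also have "\<dots> \<le> (a + b) * vec_norm k v"
    using assms by (simp add: op_bound_def distrib_right add_mono)
  finally show "vec_norm k (mat_vec k (\<lambda>i j. A i j + B i j) v) \<le> (a + b) * vec_norm k v" .
qed

lemma op_bound_scale:
  assumes "op_bound k A a"
  shows "op_bound k (\<lambda>i j. c * A i j) (cmod c * a)"
  unfolding op_bound_def
proof (intro conjI allI)
  show "0 \<le> cmod c * a" using assms by (simp add: op_bound_def)
  fix v
  have "mat_vec k (\<lambda>i j. c * A i j) v = (\<lambda>i. c * mat_vec k A v i)"
    by (simp add: mat_vec_def sum_distrib_left mult.assoc)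
  then show "vec_norm k (mat_vec k (\<lambda>i j. c * A i j) v) \<le> cmod c * a * vec_norm k v"
    using assms by (simp add: vec_norm_scale op_bound_def mult.assoc mult_left_mono)
qed

lemma op_bound_zero: "op_bound k (\<lambda>i j. 0) 0"
  by (simp add: op_bound_def mat_vec_def vec_norm_def L2_set_def)

lemma op_bound_entry:
  assumes "op_bound k A a" "i < k" "j < k"
  shows "cmod (A i j) \<le> a"
proof -
  let ?v = "\<lambda>l. if l = j then 1 else (0::complex)"
  have "mat_vec k A ?v i = A i j"
    using assms(3) unfolding mat_vec_def by (simp add: if_distrib[of "\<lambda>z. _ * z"] cong: if_cong)
  then have "cmod (A i j) \<le> vec_norm k (mat_vec k A ?v)"
    unfolding vec_norm_def using assms(2) member_le_L2_set[of "{..<k}" i "\<lambda>i. cmod (mat_vec k A ?v i)"]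
    by simp
  also have "\<dots> \<le> a * vec_norm k ?v" using assms by (simp add: op_bound_def)
  also have "vec_norm k ?v = 1"
    using assms(3) by (simp add: vec_norm_def L2_set_def if_distrib[of "\<lambda>z. (cmod z)\<^sup>2"] cong: if_cong)
  finally show ?thesis by simp
qed

lemma mat_form_comb:
  "mat_form k P (\<lambda>i. u i + t * v i) (\<lambda>i. u i + t * v i)
     = mat_form k P u u + t * mat_form k P u v + cnj t * mat_form k P v u
       + of_real ((cmod t)\<^sup>2) * mat_form k P v v"
proof -
  have "of_real ((cmod t)\<^sup>2) = cnj t * t"
    by (simp only: complex_norm_square mult.commute)
  then show ?thesis
    by (simp add: mat_form_def mat_vec_comb sum.distrib sum_distrib_left algebra_simps del: of_real_power)
qed

lemma psd_cauchy_schwarz: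
  assumes "psd k P"
  shows "mat_form k P v u = cnj (mat_form k P u v)"
    "(cmod (mat_form k P u v))\<^sup>2 \<le> Re (mat_form k P u u) * Re (mat_form k P v v)"
proof -
  have "mat_form k P u u + t * mat_form k P u v + cnj t * mat_form k P v u
      + of_real ((cmod t)\<^sup>2) * mat_form k P v v \<in> \<real>\<^sub>\<ge>\<^sub>0" for t
    using assms unfolding psd_def mat_form_comb[symmetric] by blast
  moreover have "mat_form k P v v \<in> \<real>\<^sub>\<ge>\<^sub>0" using assms unfolding psd_def by blast
  ultimately show "mat_form k P v u = cnj (mat_form k P u v)"
    "(cmod (mat_form k P u v))\<^sup>2 \<le> Re (mat_form k P u u) * Re (mat_form k P v v)"
    by (rule sesquilinear_cauchy_schwarz)+
qed

lemma psd_hermitian: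
  assumes "psd k P" "i < k" "j < k"
  shows "P i j = cnj (P j i)"
proof -
  have "mat_form k P (\<lambda>l. if l = i then 1 else 0) (\<lambda>l. if l = j then 1 else 0) = P i j"
    if "i < k" "j < k" for i j
    using that unfolding mat_form_def mat_vec_def
    by (simp add: if_distrib[of "\<lambda>z. _ * z"] if_distrib[of cnj] if_distrib[of "\<lambda>z. z * _"] cong: if_cong)
  then show ?thesis using psd_cauchy_schwarz(1)[OF assms(1)] assms by metis
qed

lemma vec_norm_sum_le: "(\<Sum>i<k. cmod (v i))\<^sup>2 \<le> of_nat k * (vec_norm k v)\<^sup>2"
  unfolding vec_norm_sq
  using Cauchy_Schwarz_ineq_sum[of "\<lambda>_. 1" "\<lambda>i. cmod (v i)" "{..<k}"] by simp

text \<open>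
  For a positive matrix \<open>P \<le> 1\<close>, Cauchy--Schwarz for the form of \<open>P\<close> gives
  \<open>\<parallel>P v\<parallel>\<^sup>2 \<le> \<langle>v, P v\<rangle>\<close>, and then \<open>\<parallel>v - P v\<parallel>\<^sup>2 \<le> \<parallel>v\<parallel>\<^sup>2 - \<langle>v, P v\<rangle>\<close>.
\<close>

lemma psd_complement_bound:
  assumes psd: "psd k P" and small: "\<And>i j. \<lbrakk>i < k; j < k\<rbrakk> \<Longrightarrow> of_nat k * cmod (P i j) \<le> 1"
  shows "op_bound k (\<lambda>i j. (if i = j then 1 else 0) - P i j) 1"
  unfolding op_bound_def
proof (intro conjI allI)
  fix v
  let ?w = "mat_vec k P v"
  \<comment> \<open>Entries of size at most \<open>1/k\<close> force \<open>P \<le> 1\<close>, by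
    the Cauchy--Schwarz inequality for the sum of the \<open>cmod (u i)\<close>.\<close>
  have up: "Re (mat_form k P u u) \<le> (vec_norm k u)\<^sup>2" for u
  proof (cases "k = 0")
    case False
    have "Re (mat_form k P u u) \<le> cmod (\<Sum>i<k. \<Sum>j<k. cnj (u i) * (P i j * u j))"
      unfolding mat_form_def mat_vec_def sum_distrib_left by (rule complex_Re_le_cmod)
    also have "\<dots> \<le> (\<Sum>i<k. \<Sum>j<k. cmod (u i) * (cmod (P i j) * cmod (u j)))"
      by (intro order_trans[OF norm_sum] sum_mono) (simp add: norm_mult)
    also have "\<dots> \<le> (\<Sum>i<k. \<Sum>j<k. cmod (u i) * (1 / of_nat k * cmod (u j)))"
      using small False by (intro sum_mono mult_left_mono mult_right_mono) (auto simp: field_simps)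
    also have "\<dots> = 1 / of_nat k * (\<Sum>i<k. cmod (u i))\<^sup>2"
      by (simp add: power2_eq_square sum_product sum_distrib_left sum_divide_distrib mult.commute mult.left_commute)
    also have "\<dots> \<le> 1 / of_nat k * (of_nat k * (vec_norm k u)\<^sup>2)"
      by (intro mult_left_mono vec_norm_sum_le) auto
    finally show ?thesis using False by simp
  qed (simp add: mat_form_def)
  have nn: "0 \<le> Re (mat_form k P v v)" using psd by (simp add: psd_def complex_nonneg_Reals_iff)
  have "mat_form k P ?w v = of_real ((vec_norm k ?w)\<^sup>2)"
    unfolding vec_norm_sq mat_form_def by (simp add: complex_norm_square mult.commute del: of_real_power)
  then have "((vec_norm k ?w)\<^sup>2)\<^sup>2 \<le> Re (mat_form k P ?w ?w) * Re (mat_form k P v v)"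
    using psd_cauchy_schwarz(2)[OF psd, of ?w v] by (simp del: of_real_power)
  also have "\<dots> \<le> (vec_norm k ?w)\<^sup>2 * Re (mat_form k P v v)"
    by (intro mult_right_mono up nn)
  finally have "((vec_norm k ?w)\<^sup>2)\<^sup>2 \<le> (vec_norm k ?w)\<^sup>2 * Re (mat_form k P v v)" .
  then have Pv: "(vec_norm k ?w)\<^sup>2 \<le> Re (mat_form k P v v)"
    using nn mult_le_cancel_left_pos[of "(vec_norm k ?w)\<^sup>2" "(vec_norm k ?w)\<^sup>2"]
    unfolding power2_eq_square[of "(vec_norm k ?w)\<^sup>2"]
    by (metis order_le_less zero_le_power2)
  have "mat_vec k (\<lambda>i j. (if i = j then 1 else 0) - P i j) v i = v i - ?w i" if "i < k" for i
    using that unfolding mat_vec_def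
    by (simp add: left_diff_distrib sum_subtractf if_distrib[of "\<lambda>z. z * _"] cong: if_cong)
  then have "(vec_norm k (mat_vec k (\<lambda>i j. (if i = j then 1 else 0) - P i j) v))\<^sup>2
      = (\<Sum>i<k. (cmod (v i - ?w i))\<^sup>2)"
    unfolding vec_norm_sq by (intro sum.cong) auto
  also have "\<dots> = (\<Sum>i<k. (cmod (v i))\<^sup>2 + (cmod (?w i))\<^sup>2 - 2 * Re (cnj (v i) * ?w i))"
    by (intro sum.cong) (simp_all add: cmod_power2[unfolded power2_eq_square] power2_eq_square algebra_simps)
  also have "\<dots> = (vec_norm k v)\<^sup>2 + (vec_norm k ?w)\<^sup>2 - 2 * Re (mat_form k P v v)"
    by (simp add: vec_norm_sq mat_form_def sum.distrib sum_subtractf sum_distrib_left Re_sum)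
  also have "\<dots> \<le> (vec_norm k v)\<^sup>2" using Pv nn by simp
  finally show "vec_norm k (mat_vec k (\<lambda>i j. (if i = j then 1 else 0) - P i j) v) \<le> 1 * vec_norm k v"
    using power2_le_imp_le[OF _ vec_norm_nonneg] by simp
qed simp


section \<open>The square root iteration and its scalar majorant\<close>

primrec sqrt_iter :: "nat \<Rightarrow> (nat \<Rightarrow> nat \<Rightarrow> complex) \<Rightarrow> nat \<Rightarrow> nat \<Rightarrow> nat \<Rightarrow> complex" where
  "sqrt_iter k T 0 = (\<lambda>i j. 0)"
| "sqrt_iter k T (Suc m) = (\<lambda>i j. 1/2 * (T i j + (\<Sum>l<k. sqrt_iter k T m i l * sqrt_iter k T m l j)))"

primrec sqrt_bound :: "nat \<Rightarrow> real" where
  "sqrt_bound 0 = 0"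
| "sqrt_bound (Suc m) = (1 + (sqrt_bound m)\<^sup>2) / 2"

lemma sqrt_bound_range: "0 \<le> sqrt_bound m \<and> sqrt_bound m \<le> 1"
  by (induction m) (auto simp: power_le_one)

lemma sqrt_bound_step: "sqrt_bound (Suc m) - sqrt_bound m = (1 - sqrt_bound m)\<^sup>2 / 2"
  by (simp add: power2_eq_square field_simps)

lemma sqrt_bound_incseq: "incseq sqrt_bound"
  using sqrt_bound_step by (intro incseq_SucI) (metis diff_ge_0_iff_ge zero_le_power2 divide_nonneg_pos zero_less_numeral)

lemma sqrt_bound_Cauchy:
  assumes "0 < e"
  shows "\<exists>N. \<forall>m\<ge>N. \<forall>p. sqrt_bound (m + p) - sqrt_bound m < e"
proof -
  have "convergent sqrt_bound"
    using sqrt_bound_incseq sqrt_bound_range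
    by (intro Bseq_mono_convergent BseqI'[where K = 1]) (auto simp: incseq_def)
  then have "Cauchy sqrt_bound" by (rule convergent_Cauchy)
  then obtain N where "\<forall>m\<ge>N. \<forall>n\<ge>N. norm (sqrt_bound m - sqrt_bound n) < e"
    using assms unfolding Cauchy_iff by blast
  then have "sqrt_bound (m + p) - sqrt_bound m < e" if "m \<ge> N" for m p
    using that by (metis abs_ge_self le_less_trans real_norm_def trans_le_add1)
  then show ?thesis by blast
qed

lemma sqrt_iter_bound:
  assumes "op_bound k T 1"
  shows "op_bound k (sqrt_iter k T m) (sqrt_bound m)"
proof (induction m)
  case (Suc m)
  have "op_bound k (sqrt_iter k T (Suc m)) (cmod (1/2) * (1 + sqrt_bound m * sqrt_bound m))"
    unfolding sqrt_iter.simps by (intro op_bound_scale op_bound_add op_bound_mult Suc.IH assms)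
  then show ?case by (simp add: power2_eq_square)
qed (use op_bound_zero in simp)

text \<open>The identity \<open>Z Z - Y Y = (Z - Y) Z + Y (Z - Y)\<close> needs no commutativity,
  and the scalar iteration satisfies it too, so the majorant passes to the next increment without
  loss.\<close>

lemma sqrt_iter_step:
  assumes T: "op_bound k T 1"
  shows "op_bound k (\<lambda>i j. sqrt_iter k T (Suc m) i j - sqrt_iter k T m i j)
     (sqrt_bound (Suc m) - sqrt_bound m)"
proof (induction m)
  case 0
  show ?case using op_bound_scale[OF T, of "1/2"] by simp
next
  case (Suc m)
  let ?Y = "sqrt_iter k T m" and ?Z = "sqrt_iter k T (Suc m)"
  let ?D = "\<lambda>i j. ?Z i j - ?Y i j" and ?d = "sqrt_bound (Suc m) - sqrt_bound m"
  have "sqrt_iter k T (Suc (Suc m)) i j - ?Z i j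
     = 1/2 * ((\<Sum>l<k. ?Z i l * ?Z l j) - (\<Sum>l<k. ?Y i l * ?Y l j))" for i j
    unfolding sqrt_iter.simps(2)[of k T "Suc m"] unfolding sqrt_iter.simps(2)[of k T m]
    by (simp add: algebra_simps)
  also have "1/2 * ((\<Sum>l<k. ?Z i l * ?Z l j) - (\<Sum>l<k. ?Y i l * ?Y l j))
     = 1/2 * ((\<Sum>l<k. ?D i l * ?Z l j) + (\<Sum>l<k. ?Y i l * ?D l j))" for i j
    by (simp only: sum.distrib[symmetric] sum_subtractf[symmetric])
       (simp add: algebra_simps del: sqrt_iter.simps)
  finally have eq: "(\<lambda>i j. sqrt_iter k T (Suc (Suc m)) i j - ?Z i j)
     = (\<lambda>i j. 1/2 * ((\<Sum>l<k. ?D i l * ?Z l j) + (\<Sum>l<k. ?Y i l * ?D l j)))"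
    by blast
  have "op_bound k (\<lambda>i j. 1/2 * ((\<Sum>l<k. ?D i l * ?Z l j) + (\<Sum>l<k. ?Y i l * ?D l j)))
    (cmod (1/2) * (?d * sqrt_bound (Suc m) + sqrt_bound m * ?d))"
    by (intro op_bound_scale op_bound_add op_bound_mult Suc.IH sqrt_iter_bound T)
  moreover have "cmod (1/2) * (?d * sqrt_bound (Suc m) + sqrt_bound m * ?d)
     = sqrt_bound (Suc (Suc m)) - sqrt_bound (Suc m)"
    unfolding sqrt_bound.simps(2)[of "Suc m"] unfolding sqrt_bound.simps(2)[of m]
    by (simp add: power2_eq_square field_simps)
  ultimately show ?case by (simp only: eq)
qed

text \<open>Telescoping. The bound does not depend on \<open>T\<close>, hence for matrices of
  functions not on the point: this gives uniform convergence.\<close>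

lemma sqrt_iter_close:
  assumes "op_bound k T 1" "i < k" "j < k"
  shows "cmod (sqrt_iter k T (m + p) i j - sqrt_iter k T m i j) \<le> sqrt_bound (m + p) - sqrt_bound m"
proof (induction p)
  case (Suc p)
  have "cmod (sqrt_iter k T (Suc (m + p)) i j - sqrt_iter k T (m + p) i j)
     \<le> sqrt_bound (Suc (m + p)) - sqrt_bound (m + p)"
    using op_bound_entry[OF sqrt_iter_step[OF assms(1)] assms(2,3)] .
  then show ?case
    using Suc norm_triangle_ineq[of "sqrt_iter k T (Suc (m + p)) i j - sqrt_iter k T (m + p) i j"
        "sqrt_iter k T (m + p) i j - sqrt_iter k T m i j"]
    by (simp del: sqrt_iter.simps sqrt_bound.simps)
qed simp

lemma sqrt_iter_hermitian:
  assumes "\<And>i j. \<lbrakk>i < k; j < k\<rbrakk> \<Longrightarrow> T i j = cnj (T j i)" "i < k" "j < k"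
  shows "sqrt_iter k T m i j = cnj (sqrt_iter k T m j i)"
  using assms(2,3)
proof (induction m arbitrary: i j)
  case (Suc m)
  have "sqrt_iter k T m i l * sqrt_iter k T m l j = cnj (sqrt_iter k T m j l * sqrt_iter k T m l i)"
    if "l < k" for l
    unfolding Suc.IH[OF Suc.prems(1) that] Suc.IH[OF that Suc.prems(2)] by simp
  then have "(\<Sum>l<k. sqrt_iter k T m i l * sqrt_iter k T m l j)
     = (\<Sum>l<k. cnj (sqrt_iter k T m j l * sqrt_iter k T m l i))"
    by simp
  then show ?case unfolding sqrt_iter.simps assms(1)[OF Suc.prems] by simp
qed simp

lemma psd_scale:
  assumes "psd k P" "0 \<le> s"
  shows "psd k (\<lambda>i j. of_real s * P i j)"
proof -
  have "mat_form k (\<lambda>i j. of_real s * P i j) v v = of_real s * mat_form k P v v" for v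
    by (simp add: mat_form_def mat_vec_def sum_distrib_left mult.assoc mult.left_commute)
  then show ?thesis using assms by (simp add: psd_def complex_nonneg_Reals_iff)
qed

lemma continuous_map_mult_complex:
  fixes f g :: "'x \<Rightarrow> complex"
  assumes "continuous_map X euclidean f" "continuous_map X euclidean g"
  shows "continuous_map X euclidean (\<lambda>x. f x * g x)"
proof -
  have "continuous_map X (prod_topology euclidean euclidean) (\<lambda>x. (f x, g x))"
    using assms by (intro continuous_map_pairedI)
  then have "continuous_map X euclidean (\<lambda>x. (f x, g x))"
    by (simp only: prod_topology_euclidean)
  then have "continuous_map X euclidean ((\<lambda>(a, b). a * b) \<circ> (\<lambda>x. (f x, g x)))"
    by (rule continuous_map_compose) (auto simp: split_def intro!: continuous_intros)
  then show ?thesis by (simp add: o_def)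
qed

text \<open>
  The square root is \<open>1 - R\<close>, where \<open>R\<close> is the fixed point of \<open>Y \<mapsto> (T + Y\<^sup>2) / 2\<close> for
  \<open>T = 1 - P\<close>. The increments of the iteration are dominated by those of the scalar iteration for
  \<open>T = 1\<close>, so it converges uniformly on the space and no continuity of the spectrum is needed.
\<close>

lemma psd_sqrt:
  fixes P :: "nat \<Rightarrow> nat \<Rightarrow> 'x \<Rightarrow> complex"
  assumes C: "\<And>i j. \<lbrakk>i < k; j < k\<rbrakk> \<Longrightarrow> P i j \<in> C0_functions X"
    and psd: "\<And>x. psd k (\<lambda>i j. P i j x)"
  obtains Q where "\<And>i j. \<lbrakk>i < k; j < k\<rbrakk> \<Longrightarrow> Q i j \<in> C0_functions X"
    and "\<And>i j x. \<lbrakk>i < k; j < k\<rbrakk> \<Longrightarrow> P i j x = (\<Sum>l<k. cnj (Q l i x) * Q l j x)"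
proof -
  define M where "M = (\<Sum>i<k. \<Sum>j<k. SUP x. cmod (P i j x))"
  have S0: "0 \<le> (SUP x. cmod (P i j x))" if "i < k" "j < k" for i j
    using C0_cmod_le[OF C[OF that]] norm_ge_zero order_trans by blast
  have M: "cmod (P i j x) \<le> M" if ij: "i < k" "j < k" for i j x
  proof -
    have "cmod (P i j x) \<le> (SUP x. cmod (P i j x))" by (rule C0_cmod_le[OF C[OF ij]])
    also have "\<dots> \<le> (\<Sum>j<k. SUP x. cmod (P i j x))"
      using ij S0 by (intro member_le_sum) auto
    also have "\<dots> \<le> M"
      unfolding M_def using ij S0
      by (intro member_le_sum[of i "{..<k}" "\<lambda>i. \<Sum>j<k. SUP x. cmod (P i j x)"]) (auto intro: sum_nonneg)
    finally show ?thesis .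
  qed
  have M0: "0 \<le> M" unfolding M_def using S0 by (auto intro!: sum_nonneg)
  \<comment> \<open>With this scaling \<open>k\<close> times each entry of \<open>s P\<close> is at
    most 1, as \<open>psd_complement_bound\<close> demands; the summand 1 covers
    \<open>M = 0\<close>.\<close>
  define s where "s = 1 / (of_nat k * M + 1)"
  have s: "0 < s" using M0 by (simp add: s_def add_nonneg_pos)
  have small: "of_nat k * cmod (of_real s * P i j x) \<le> 1" if ij: "i < k" "j < k" for i j x
  proof -
    have "of_nat k * cmod (of_real s * P i j x) \<le> of_nat k * (s * M)"
      using M[OF ij] s by (intro mult_left_mono) (auto simp: norm_mult)
    also have "\<dots> \<le> 1" using mult_nonneg_nonneg[OF M0, of "real k"]
      by (simp add: s_def divide_le_eq_1 ac_simps)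
    finally show ?thesis .
  qed
  define T where "T x i j = (if i = j then 1 else 0) - of_real s * P i j x" for x and i j :: nat
  have T: "op_bound k (T x) 1" for x
    unfolding T_def using s small by (intro psd_complement_bound psd_scale psd) auto
  have Th: "T x i j = cnj (T x j i)" if "i < k" "j < k" for x i j
    using psd_hermitian[OF psd that] by (simp add: T_def)
  define Y where "Y m x = sqrt_iter k (T x) m" for m x
  have Yc: "continuous_map X euclidean (\<lambda>x. Y m x i j)" if "i < k" "j < k" for m i j
    using that
  proof (induction m arbitrary: i j)
    case (Suc m)
    have "continuous_map X euclidean (P i j)" using C Suc.prems by (simp add: C0_functions_def)
    then show ?case
      unfolding Y_def sqrt_iter.simps T_def using Suc[unfolded Y_def T_def]
      by (intro continuous_map_mult_complex continuous_map_add continuous_map_diff continuous_map_sum)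
        auto
  qed (simp add: Y_def)
  have close: "cmod (Y (m + p) x i j - Y m x i j) \<le> sqrt_bound (m + p) - sqrt_bound m"
    if "i < k" "j < k" for m p x i j
    unfolding Y_def by (rule sqrt_iter_close[OF T that])
  have "Cauchy (\<lambda>m. Y m x i j)" if ij: "i < k" "j < k" for x i j
  proof (rule CauchyI')
    fix e :: real assume "0 < e"
    then obtain N where N: "\<And>m p. m \<ge> N \<Longrightarrow> sqrt_bound (m + p) - sqrt_bound m < e"
      using sqrt_bound_Cauchy by meson
    have "cmod (Y m x i j - Y n x i j) < e" if "m \<ge> N" "n > m" for m n
      using close[OF ij, of m "n - m" x] N[OF that(1), of "n - m"] that(2)
      by (simp add: norm_minus_commute)
    then show "\<exists>N. \<forall>m\<ge>N. \<forall>n>m. dist (Y m x i j) (Y n x i j) < e" unfolding dist_norm by blast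
  qed
  then have lim: "(\<lambda>m. Y m x i j) \<longlonglongrightarrow> lim (\<lambda>m. Y m x i j)" if "i < k" "j < k" for x i j
    using that by (simp add: Cauchy_convergent convergent_LIMSEQ_iff[symmetric])
  define R where "R x i j = lim (\<lambda>m. Y m x i j)" for x i j
  have R: "(\<lambda>m. Y m x i j) \<longlonglongrightarrow> R x i j" if "i < k" "j < k" for x i j
    using lim[OF that] by (simp add: R_def)
  have unif: "\<exists>N. \<forall>m\<ge>N. \<forall>x. cmod (Y m x i j - R x i j) \<le> e" if ij: "i < k" "j < k" and e: "e > 0" for i j e
  proof -
    obtain N where N: "\<And>m p. m \<ge> N \<Longrightarrow> sqrt_bound (m + p) - sqrt_bound m < e"
      using sqrt_bound_Cauchy[OF e] by meson
    have "cmod (Y m x i j - R x i j) \<le> e" if m: "m \<ge> N" for m x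
    proof (rule LIMSEQ_le_const2)
      show "(\<lambda>p. cmod (Y m x i j - Y (p + m) x i j)) \<longlonglongrightarrow> cmod (Y m x i j - R x i j)"
        by (intro tendsto_intros LIMSEQ_ignore_initial_segment R ij)
      have "cmod (Y m x i j - Y (p + m) x i j) \<le> e" for p
        using close[OF ij, of m p x] N[OF m, of p] by (simp add: norm_minus_commute add.commute)
      then show "\<exists>N. \<forall>p\<ge>N. cmod (Y m x i j - Y (p + m) x i j) \<le> e" by blast
    qed
    then show ?thesis by blast
  qed
  have Rc: "continuous_map X euclidean (\<lambda>x. R x i j)" if ij: "i < k" "j < k" for i j
  proof -
    have "continuous_map X Met_TC.mtopology (\<lambda>x. R x i j)"
    proof (rule Met_TC.continuous_map_uniform_limit[where F = sequentially])
      show "\<forall>\<^sub>F m in sequentially. continuous_map X Met_TC.mtopology (\<lambda>x. Y m x i j)"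
        using Yc[OF ij] by simp
      fix e :: real assume "e > 0"
      then obtain N where N: "\<And>m x. m \<ge> N \<Longrightarrow> cmod (Y m x i j - R x i j) \<le> e/2"
        using unif[OF ij, of "e/2"] by auto
      have "cmod (Y m x i j - R x i j) < e" if "m \<ge> N" for m x
        using N[OF that, of x] \<open>e > 0\<close> by linarith
      then show "\<forall>\<^sub>F m in sequentially. \<forall>x\<in>topspace X. R x i j \<in> UNIV \<and> dist (Y m x i j) (R x i j) < e"
        by (auto simp: eventually_sequentially dist_norm)
    qed auto
    then show ?thesis by simp
  qed
  have Rh: "R x i j = cnj (R x j i)" if ij: "i < k" "j < k" for x i j
  proof (rule LIMSEQ_unique[OF R[OF ij]])
    have "Y m x i j = cnj (Y m x j i)" for m
      unfolding Y_def by (rule sqrt_iter_hermitian[OF Th ij])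
    then show "(\<lambda>m. Y m x i j) \<longlonglongrightarrow> cnj (R x j i)"
      using tendsto_cnj[OF R[OF ij(2,1)]] by simp
  qed
  have Rfix: "R x i j = 1/2 * (T x i j + (\<Sum>l<k. R x i l * R x l j))" if ij: "i < k" "j < k" for x i j
  proof (rule LIMSEQ_unique)
    show "(\<lambda>m. Y (Suc m) x i j) \<longlonglongrightarrow> R x i j" using R[OF ij] by (rule LIMSEQ_Suc)
    have "(\<lambda>m. 1/2 * (T x i j + (\<Sum>l<k. Y m x i l * Y m x l j)))
       \<longlonglongrightarrow> 1/2 * (T x i j + (\<Sum>l<k. R x i l * R x l j))"
      using ij by (intro tendsto_intros R) auto
    then show "(\<lambda>m. Y (Suc m) x i j) \<longlonglongrightarrow> 1/2 * (T x i j + (\<Sum>l<k. R x i l * R x l j))"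
      by (simp add: Y_def)
  qed
  \<comment> \<open>The fixed point equation \<open>2 R = T + R R\<close> with
    \<open>T = 1 - s P\<close> says that \<open>(1 - R)\<close> squares to \<open>s P\<close>;
    dividing by \<open>sqrt s\<close> undoes the scaling.\<close>
  define Q where "Q i j x = of_real (1 / sqrt s) * ((if i = j then 1 else 0) - R x i j)" for i j :: nat and x
  have QQ: "P i j x = (\<Sum>l<k. cnj (Q l i x) * Q l j x)" if ij: "i < k" "j < k" for i j x
  proof -
    have *: "of_real (1 / sqrt s) * of_real (1 / sqrt s) = (of_real (1 / s) :: complex)"
      using s by (simp flip: of_real_mult)
    have "cnj (Q l i x) * Q l j x = of_real (1 / s) *
        (((if l = i then 1 else 0) - R x i l) * ((if l = j then 1 else 0) - R x l j))" if "l < k" for l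
    proof -
      have "cnj (Q l i x) = of_real (1 / sqrt s) * ((if l = i then 1 else 0) - R x i l)"
        unfolding Q_def Rh[OF ij(1) that, of x] by simp
      moreover have "a * p * (a * q) = (a * a) * (p * q)" for a p q :: complex
        by (simp add: mult.assoc mult.left_commute)
      ultimately show ?thesis unfolding Q_def by (simp only: *)
    qed
    then have "(\<Sum>l<k. cnj (Q l i x) * Q l j x) = of_real (1 / s) *
        (\<Sum>l<k. ((if l = i then 1 else 0) - R x i l) * ((if l = j then 1 else 0) - R x l j))"
      by (simp add: sum_distrib_left)
    also have "(\<Sum>l<k. ((if l = i then 1 else 0) - R x i l) * ((if l = j then 1 else 0) - R x l j))
      = (if i = j then 1 else 0) - 2 * R x i j + (\<Sum>l<k. R x i l * R x l j)"
      using ij by (simp add: algebra_simps sum.distrib sum_subtractf if_distrib[of "\<lambda>z. z * _"]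
          if_distrib[of "\<lambda>z. _ * z"] cong: if_cong)
    also have "\<dots> = of_real s * P i j x"
    proof -
      have "2 * R x i j = (if i = j then 1 else 0) - of_real s * P i j x + (\<Sum>l<k. R x i l * R x l j)"
        using Rfix[OF ij, of x] unfolding T_def by (simp only: mult.assoc[symmetric]) simp
      then show ?thesis by (simp only:) simp
    qed
    finally show ?thesis using s by simp
  qed
  \<comment> \<open>The diagonal of \<open>P\<close> dominates the entries of \<open>Q\<close>. This
    makes \<open>Q\<close> vanish at infinity and off the space, which uniform convergence of the
    iteration alone does not give because of the unit matrix in \<open>1 - R\<close>.\<close>
  have Qb: "(cmod (Q l i x))\<^sup>2 \<le> cmod (P i i x)" if "l < k" "i < k" for l i x
  proof -
    have "P i i x = of_real (\<Sum>l<k. (cmod (Q l i x))\<^sup>2)"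
      using QQ[OF that(2,2)] by (simp add: complex_norm_square mult.commute del: of_real_power)
    then have "cmod (P i i x) = (\<Sum>l<k. (cmod (Q l i x))\<^sup>2)"
      by (simp add: sum_nonneg del: of_real_sum of_real_power)
    then show ?thesis using that by (auto intro: member_le_sum)
  qed
  have "Q l i \<in> C0_functions X" if li: "l < k" "i < k" for l i
  proof (rule C0_functions_if_bounded)
    show "continuous_map X euclidean (Q l i)"
      unfolding Q_def by (intro continuous_map_mult_complex continuous_map_diff Rc li) auto
    show "Q l i x = 0" if "x \<notin> topspace X" for x
      using Qb[OF li, of x] C[OF li(2,2)] that by (auto simp: C0_functions_def)
    fix e :: real assume e: "e > 0"
    have "e\<^sup>2 \<le> cmod (P i i x)" if "e \<le> cmod (Q l i x)" for x
      using Qb[OF li, of x] power_mono[OF that less_imp_le[OF e], of 2] by linarith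
    then show "\<exists>K. compactin X K \<and> (\<forall>x. e \<le> cmod (Q l i x) \<longrightarrow> x \<in> K)"
      using C0_compact[OF C[OF li(2,2)] zero_less_power[OF e], of 2] by blast
  qed
  then show ?thesis using that QQ by blast
qed

subsection \<open>Approximations through commutative algebras\<close>

lemma C0_sel:
  "carrier (C0 X) = C0_functions X" "f \<otimes>\<^bsub>C0 X\<^esub> g = (\<lambda>x. f x * g x)" "\<zero>\<^bsub>C0 X\<^esub> = (\<lambda>x. 0)"
  "f \<oplus>\<^bsub>C0 X\<^esub> g = (\<lambda>x. f x + g x)" "c \<odot>\<^bsub>C0 X\<^esub> f = (\<lambda>x. c * f x)" "adj (C0 X) f = (\<lambda>x. cnj (f x))"
  "cnorm (C0 X) f = (SUP x. cmod (f x))"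
  by (simp_all add: C0_def)

lemma abelian_group_C0: "abelian_group (C0 X)"
proof -
  interpret cstar_algebra "C0 X" by (rule cstar_algebra_C0)
  show ?thesis by (rule M.abelian_group_axioms)
qed

lemma abelian_monoid_C0: "abelian_monoid (C0 X)"
  using abelian_group_C0[of X] by (simp add: abelian_group_def)

lemma C0_diff: 
  assumes "f \<in> C0_functions X" "g \<in> C0_functions X"
  shows "f \<ominus>\<^bsub>C0 X\<^esub> g = (\<lambda>x. f x - g x)"
proof -
  have "(\<lambda>x. - g x) \<in> C0_functions X" using C0_smult[OF assms(2), of "-1"] by simp
  then have "\<ominus>\<^bsub>C0 X\<^esub> g = (\<lambda>x. - g x)"
    using assms by (intro abelian_group.minus_equality[OF abelian_group_C0]) (auto simp: C0_sel)
  then show ?thesis by (simp add: a_minus_def C0_sel)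
qed

lemma C0_sum:
  assumes "\<And>s. s \<in> S \<Longrightarrow> f s \<in> C0_functions X"
  shows "(\<lambda>x. \<Sum>s\<in>S. f s x) \<in> C0_functions X"
  using assms by (induction S rule: infinite_finite_induct) (auto intro: C0_zero C0_add)

lemma finsum_C0:
  assumes "finite S" "\<And>s. s \<in> S \<Longrightarrow> f s \<in> C0_functions X"
  shows "(\<Oplus>\<^bsub>C0 X\<^esub>s\<in>S. f s) = (\<lambda>x. \<Sum>s\<in>S. f s x)"
  using assms
proof (induction S rule: finite_induct)
  case empty
  then show ?case by (simp add: abelian_monoid.finsum_empty[OF abelian_monoid_C0] C0_sel)
next
  case (insert s S)
  then show ?case
    by (subst abelian_monoid.finsum_insert[OF abelian_monoid_C0]) (auto simp: C0_sel Pi_iff)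
qed

lemma C0_norm_le: "(\<And>x. cmod (f x) \<le> B) \<Longrightarrow> cnorm (C0 X) f \<le> B"
  by (auto simp: C0_sel intro: cSUP_least)

lemma C0_le_norm: "f \<in> C0_functions X \<Longrightarrow> cmod (f x) \<le> cnorm (C0 X) f"
  by (simp add: C0_sel C0_cmod_le)

lemma psd_cong:
  assumes "\<And>i j. \<lbrakk>i < k; j < k\<rbrakk> \<Longrightarrow> P i j = Q i j"
  shows "psd k P \<longleftrightarrow> psd k Q"
proof -
  have "mat_form k P v v = mat_form k Q v v" for v
    unfolding mat_form_def mat_vec_def using assms by (intro sum.cong) auto
  then show ?thesis by (simp add: psd_def)
qed

lemma sum_nonneg_Reals: "(\<And>i. i \<in> S \<Longrightarrow> f i \<in> \<real>\<^sub>\<ge>\<^sub>0) \<Longrightarrow> (\<Sum>i\<in>S. f i) \<in> (\<real>\<^sub>\<ge>\<^sub>0 :: complex set)"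
  by (auto simp: complex_nonneg_Reals_iff intro: sum_nonneg)

lemma cnj_mult_self_nonneg: "cnj z * z \<in> \<real>\<^sub>\<ge>\<^sub>0"
  by (simp add: complex_nonneg_Reals_iff)

lemma mat_form_eq: "mat_form k P u v = (\<Sum>i<k. \<Sum>j<k. cnj (u i) * v j * P i j)"
  by (simp add: mat_form_def mat_vec_def sum_distrib_left mult_ac)

lemma mat_form_gram:
  "mat_form k (\<lambda>i j. \<Sum>l\<in>L. cnj (Y l i) * Y l j) v v = (\<Sum>l\<in>L. cnj (\<Sum>j<k. Y l j * v j) * (\<Sum>j<k. Y l j * v j))"
proof -
  have "mat_form k (\<lambda>i j. \<Sum>l\<in>L. cnj (Y l i) * Y l j) v v
     = (\<Sum>i<k. \<Sum>j<k. \<Sum>l\<in>L. cnj (Y l i * v i) * (Y l j * v j))"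
    by (simp add: mat_form_eq sum_distrib_left mult_ac)
  also have "\<dots> = (\<Sum>i<k. \<Sum>l\<in>L. \<Sum>j<k. cnj (Y l i * v i) * (Y l j * v j))"
    by (intro sum.cong sum.swap refl)
  also have "\<dots> = (\<Sum>l\<in>L. \<Sum>i<k. \<Sum>j<k. cnj (Y l i * v i) * (Y l j * v j))"
    by (rule sum.swap)
  finally show ?thesis by (simp only: sum_product cnj_sum)
qed

lemma psd_gram: "psd k (\<lambda>i j. \<Sum>l\<in>L. cnj (Y l i) * Y l j)"
  unfolding psd_def mat_form_gram by (intro allI sum_nonneg_Reals cnj_mult_self_nonneg)

lemma psd_sum:
  assumes "\<And>s. s \<in> S \<Longrightarrow> psd k (P s)" "\<And>s. s \<in> S \<Longrightarrow> w s \<in> \<real>\<^sub>\<ge>\<^sub>0"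
  shows "psd k (\<lambda>i j. \<Sum>s\<in>S. P s i j * w s)"
proof -
  have "mat_form k (\<lambda>i j. \<Sum>s\<in>S. P s i j * w s) v v = (\<Sum>s\<in>S. mat_form k (P s) v v * w s)" for v
  proof -
    have "mat_form k (\<lambda>i j. \<Sum>s\<in>S. P s i j * w s) v v
       = (\<Sum>i<k. \<Sum>j<k. \<Sum>s\<in>S. cnj (v i) * v j * P s i j * w s)"
      by (simp add: mat_form_eq sum_distrib_left mult.assoc)
    also have "\<dots> = (\<Sum>i<k. \<Sum>s\<in>S. \<Sum>j<k. cnj (v i) * v j * P s i j * w s)"
      by (intro sum.cong sum.swap refl)
    also have "\<dots> = (\<Sum>s\<in>S. \<Sum>i<k. \<Sum>j<k. cnj (v i) * v j * P s i j * w s)"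
      by (rule sum.swap)
    finally show ?thesis by (simp add: mat_form_eq sum_distrib_right)
  qed
  then show ?thesis using assms unfolding psd_def
    by (auto intro!: sum_nonneg_Reals nonneg_Reals_mult_I)
qed

lemma matrix_algebra_sel:
  "carrier (matrix_algebra k A) = {..<k} \<rightarrow>\<^sub>E {..<k} \<rightarrow>\<^sub>E carrier A"
  by (simp add: matrix_algebra_def)

lemma adj_mult_matrix_C0:
  assumes y: "y \<in> carrier (matrix_algebra k (C0 X))"
  shows "adj (matrix_algebra k (C0 X)) y \<otimes>\<^bsub>matrix_algebra k (C0 X)\<^esub> y
    = (\<lambda>i\<in>{..<k}. \<lambda>j\<in>{..<k}. \<lambda>x. \<Sum>l<k. cnj (y l i x) * y l j x)"
proof -
  have y': "y i j \<in> C0_functions X" if "i < k" "j < k" for i j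
    using y that by (auto simp: matrix_algebra_sel PiE_iff C0_sel)
  have "(\<Oplus>\<^bsub>C0 X\<^esub>l\<in>{..<k}. (\<lambda>i\<in>{..<k}. \<lambda>j\<in>{..<k}. (\<lambda>x. cnj (y j i x))) i l \<otimes>\<^bsub>C0 X\<^esub> y l j)
     = (\<lambda>x. \<Sum>l<k. cnj (y l i x) * y l j x)" if "i < k" "j < k" for i j
    using that y' by (subst finsum_C0) (auto simp: C0_sel intro!: C0_mult C0_cnj)
  then show ?thesis
    by (auto simp: matrix_algebra_def C0_sel fun_eq_iff restrict_def)
qed

text \<open>Complete positivity becomes a pointwise condition. The direction from right to left is
  where \<open>psd_sqrt\<close> is needed.\<close>

lemma positive_matrix_C0_iff:
  "a \<in> positive_elements (matrix_algebra k (C0 X)) \<longleftrightarrow>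
     a \<in> carrier (matrix_algebra k (C0 X)) \<and> (\<forall>x. psd k (\<lambda>i j. a i j x))"
proof
  assume "a \<in> positive_elements (matrix_algebra k (C0 X))"
  then obtain y where y: "y \<in> carrier (matrix_algebra k (C0 X))"
    and a: "a = (\<lambda>i\<in>{..<k}. \<lambda>j\<in>{..<k}. \<lambda>x. \<Sum>l<k. cnj (y l i x) * y l j x)"
    unfolding positive_elements_def using adj_mult_matrix_C0 by blast
  have y': "y i j \<in> C0_functions X" if "i < k" "j < k" for i j
    using y that by (auto simp: matrix_algebra_sel PiE_iff C0_sel)
  have "psd k (\<lambda>i j. a i j x)" for x
    using psd_gram[where L = "{..<k}" and Y = "\<lambda>l i. y l i x"] by (subst psd_cong) (auto simp: a)
  moreover have "a \<in> carrier (matrix_algebra k (C0 X))"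
    unfolding a using y' by (auto simp: matrix_algebra_sel C0_sel intro!: C0_sum C0_mult C0_cnj)
  ultimately show "a \<in> carrier (matrix_algebra k (C0 X)) \<and> (\<forall>x. psd k (\<lambda>i j. a i j x))" by blast
next
  assume a: "a \<in> carrier (matrix_algebra k (C0 X)) \<and> (\<forall>x. psd k (\<lambda>i j. a i j x))"
  then have a': "a i j \<in> C0_functions X" if "i < k" "j < k" for i j
    using that by (auto simp: matrix_algebra_sel PiE_iff C0_sel)
  obtain Q where Q: "\<And>i j. \<lbrakk>i < k; j < k\<rbrakk> \<Longrightarrow> Q i j \<in> C0_functions X"
    and aQ: "\<And>i j x. \<lbrakk>i < k; j < k\<rbrakk> \<Longrightarrow> a i j x = (\<Sum>l<k. cnj (Q l i x) * Q l j x)"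
    using psd_sqrt[of k a X] a' a by blast
  define y where "y = (\<lambda>i\<in>{..<k}. \<lambda>j\<in>{..<k}. Q i j)"
  have y: "y \<in> carrier (matrix_algebra k (C0 X))"
    using Q by (auto simp: y_def matrix_algebra_sel C0_sel)
  have "a i j x = (\<Sum>l<k. cnj (y l i x) * y l j x)" if "i < k" "j < k" for i j x
    using aQ[OF that] that by (simp add: y_def)
  then have "a = (\<lambda>i\<in>{..<k}. \<lambda>j\<in>{..<k}. \<lambda>x. \<Sum>l<k. cnj (y l i x) * y l j x)"
    using a by (auto simp: fun_eq_iff matrix_algebra_sel PiE_iff extensional_def restrict_def)
  then show "a \<in> positive_elements (matrix_algebra k (C0 X))"
    unfolding positive_elements_def using y adj_mult_matrix_C0[OF y] by (intro CollectI exI[of _ y]) simp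
qed

text \<open>Finite powers of the complex numbers are realised as \<open>C0\<close> of a finite
  discrete space, so that \<open>positive_matrix_C0_iff\<close> also describes positivity in the
  finite-dimensional algebra.\<close>

lemma C0_functions_finite_discrete:
  assumes "finite K"
  shows "C0_functions (discrete_topology K) = {v. \<forall>k. k \<notin> K \<longrightarrow> v k = 0}"
  using assms unfolding C0_functions_def by (auto simp: compactin_discrete_topology)

definition positive_functional :: "'x topology \<Rightarrow> (('x \<Rightarrow> complex) \<Rightarrow> complex) \<Rightarrow> bool" where
  "positive_functional X \<nu> \<longleftrightarrow>
     (\<forall>f\<in>C0_functions X. \<forall>g\<in>C0_functions X. \<nu> (\<lambda>x. f x + g x) = \<nu> f + \<nu> g) \<and>
     (\<forall>c. \<forall>f\<in>C0_functions X. \<nu> (\<lambda>x. c * f x) = c * \<nu> f) \<and>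
     (\<forall>f\<in>C0_functions X. (\<forall>x. f x \<in> \<real>\<^sub>\<ge>\<^sub>0) \<longrightarrow> \<nu> f \<in> \<real>\<^sub>\<ge>\<^sub>0)"

lemma positive_functionalD:
  assumes "positive_functional X \<nu>"
  shows "\<lbrakk>f \<in> C0_functions X; g \<in> C0_functions X\<rbrakk> \<Longrightarrow> \<nu> (\<lambda>x. f x + g x) = \<nu> f + \<nu> g"
    and "f \<in> C0_functions X \<Longrightarrow> \<nu> (\<lambda>x. c * f x) = c * \<nu> f"
    and "\<lbrakk>f \<in> C0_functions X; \<And>x. f x \<in> \<real>\<^sub>\<ge>\<^sub>0\<rbrakk> \<Longrightarrow> \<nu> f \<in> \<real>\<^sub>\<ge>\<^sub>0"
  using assms unfolding positive_functional_def by blast+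

lemma positive_functional_zero: "positive_functional X \<nu> \<Longrightarrow> \<nu> (\<lambda>x. 0) = 0"
  using positive_functionalD(2)[of X \<nu> "\<lambda>x. 0" 0] C0_zero[of X] by simp

lemma positive_functional_sum:
  assumes "positive_functional X \<nu>" "\<And>s. s \<in> S \<Longrightarrow> f s \<in> C0_functions X"
  shows "\<nu> (\<lambda>x. \<Sum>s\<in>S. f s x) = (\<Sum>s\<in>S. \<nu> (f s))"
  using assms(2)
  by (induction S rule: infinite_finite_induct)
     (auto simp: positive_functional_zero[OF assms(1)] positive_functionalD(1)[OF assms(1)] C0_sum)

text \<open>The functional, applied to the quadratic form taken pointwise, gives the quadratic form
  of the matrix of its values; so a positive functional is completely positive.\<close>

lemma positive_functional_psd:
  assumes \<nu>: "positive_functional X \<nu>" and a: "\<And>i j. \<lbrakk>i < k; j < k\<rbrakk> \<Longrightarrow> a i j \<in> C0_functions X"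
    and psd: "\<And>x. psd k (\<lambda>i j. a i j x)"
  shows "psd k (\<lambda>i j. \<nu> (a i j))"
  unfolding psd_def
proof
  fix v
  let ?q = "\<lambda>i j x. cnj (v i) * v j * a i j x"
  have q: "?q i j \<in> C0_functions X" if "i < k" "j < k" for i j
    using a that by (intro C0_smult)
  have "\<nu> (\<lambda>x. mat_form k (\<lambda>i j. a i j x) v v) = \<nu> (\<lambda>x. \<Sum>i<k. \<Sum>j<k. ?q i j x)"
    by (simp add: mat_form_eq)
  also have "\<dots> = (\<Sum>i<k. \<nu> (\<lambda>x. \<Sum>j<k. ?q i j x))"
    using q by (intro positive_functional_sum[OF \<nu>] C0_sum) auto
  also have "\<dots> = (\<Sum>i<k. \<Sum>j<k. \<nu> (?q i j))"
    using q by (intro sum.cong positive_functional_sum[OF \<nu>] refl) auto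
  also have "\<dots> = mat_form k (\<lambda>i j. \<nu> (a i j)) v v"
    unfolding mat_form_eq using a by (intro sum.cong positive_functionalD(2)[OF \<nu>] refl) auto
  finally have eq: "mat_form k (\<lambda>i j. \<nu> (a i j)) v v = \<nu> (\<lambda>x. mat_form k (\<lambda>i j. a i j x) v v)" by simp
  have "(\<lambda>x. mat_form k (\<lambda>i j. a i j x) v v) \<in> C0_functions X"
    unfolding mat_form_eq using q by (intro C0_sum) auto
  then show "mat_form k (\<lambda>i j. \<nu> (a i j)) v v \<in> \<real>\<^sub>\<ge>\<^sub>0"
    unfolding eq using psd by (intro positive_functionalD(3)[OF \<nu>]) (auto simp: psd_def)
qed

section \<open>The approximant defined by positive functionals and coloured functions\<close>

context
  fixes X :: "'x topology" and K :: "'k set" and c :: "'k \<Rightarrow> nat" and w :: "'k \<Rightarrow> 'x \<Rightarrow> complex"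
    and \<nu> :: "'k \<Rightarrow> ('x \<Rightarrow> complex) \<Rightarrow> complex" and n :: nat
  assumes K: "finite K" and c: "\<And>k. k \<in> K \<Longrightarrow> c k \<le> n"
    and w: "\<And>k. k \<in> K \<Longrightarrow> w k \<in> C0_functions X" "\<And>k x. k \<in> K \<Longrightarrow> w k x \<in> \<real>\<^sub>\<ge>\<^sub>0"
      "\<And>x. (\<Sum>k\<in>K. Re (w k x)) \<le> 1"
    and disj: "\<And>k l x. \<lbrakk>k \<in> K; l \<in> K; k \<noteq> l; c k = c l\<rbrakk> \<Longrightarrow> w k x * w l x = 0"
    and \<nu>: "\<And>k. k \<in> K \<Longrightarrow> positive_functional X (\<nu> k)"
      "\<And>k f. \<lbrakk>k \<in> K; f \<in> C0_functions X\<rbrakk> \<Longrightarrow> cmod (\<nu> k f) \<le> cnorm (C0 X) f"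
begin

abbreviation (input) "comm_alg \<equiv> C0 (discrete_topology K)"
abbreviation (input) "comm_down \<equiv> (\<lambda>f k. if k \<in> K then \<nu> k f else 0)"
abbreviation (input) "comm_up \<equiv> (\<lambda>v x. \<Sum>k\<in>K. v k * w k x)"
abbreviation (input) "comm_ideal i \<equiv> {v. \<forall>k. v k \<noteq> 0 \<longrightarrow> k \<in> K \<and> c k = i}"

lemmas comm_carrier = C0_functions_finite_discrete[OF K]

lemma comm_down_cp: "cp_map (C0 X) comm_alg comm_down"
  unfolding cp_map_def
proof (intro conjI allI ballI)
  show "linear_map (C0 X) comm_alg comm_down"
    unfolding linear_map_def
    using positive_functionalD(1,2)[OF \<nu>(1)] by (auto simp: C0_sel comm_carrier)
  fix m a assume "a \<in> positive_elements (matrix_algebra m (C0 X))"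
  then have a: "a \<in> carrier (matrix_algebra m (C0 X))" "\<And>x. psd m (\<lambda>i j. a i j x)"
    by (auto simp: positive_matrix_C0_iff)
  then have a': "a i j \<in> C0_functions X" if "i < m" "j < m" for i j
    using that by (auto simp: matrix_algebra_sel PiE_iff C0_sel)
  have "psd m (\<lambda>i j. amplification m comm_down a i j k)" for k
  proof (cases "k \<in> K")
    case True
    have "psd m (\<lambda>i j. \<nu> k (a i j))"
      using a' a(2) by (rule positive_functional_psd[OF \<nu>(1)[OF True]])
    then show ?thesis by (subst psd_cong) (auto simp: amplification_def True)
  next
    case False
    have "psd m (\<lambda>i j. 0)" using psd_gram[of m _ "{}"] by simp
    then show ?thesis by (subst psd_cong) (auto simp: amplification_def False)
  qed
  then show "amplification m comm_down a \<in> positive_elements (matrix_algebra m comm_alg)"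
    unfolding positive_matrix_C0_iff
    by (auto simp: amplification_def matrix_algebra_sel C0_sel comm_carrier)
qed

lemma comm_up_cp: "cp_map comm_alg (C0 X) comm_up"
  unfolding cp_map_def
proof (intro conjI allI ballI)
  have C: "comm_up v \<in> C0_functions X" for v
    using w by (intro C0_sum C0_smult)
  show "linear_map comm_alg (C0 X) comm_up"
    unfolding linear_map_def
    using C by (auto simp: C0_sel distrib_right sum.distrib sum_distrib_left mult.assoc)
  fix m a assume "a \<in> positive_elements (matrix_algebra m comm_alg)"
  then have a: "a \<in> carrier (matrix_algebra m comm_alg)" "\<And>k. psd m (\<lambda>i j. a i j k)"
    by (auto simp: positive_matrix_C0_iff)
  have "psd m (\<lambda>i j. amplification m comm_up a i j x)" for x
    using psd_sum[of K m "\<lambda>k i j. a i j k" "\<lambda>k. w k x"] a(2) w(2)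
    by (subst psd_cong) (auto simp: amplification_def)
  then show "amplification m comm_up a \<in> positive_elements (matrix_algebra m (C0 X))"
    unfolding positive_matrix_C0_iff
    using C by (auto simp: amplification_def matrix_algebra_sel C0_sel)
qed

lemma comm_down_contractive: "contractive (C0 X) comm_alg comm_down"
  unfolding contractive_def
proof
  fix f assume f: "f \<in> carrier (C0 X)"
  \<comment> \<open>For an index outside \<open>K\<close> the claim is that the norm is nonnegative;
    the value at the arbitrary point \<open>undefined\<close> shows this, even on an empty
    space.\<close>
  have "cmod (comm_down f k) \<le> cnorm (C0 X) f" for k
    using \<nu>(2) f C0_le_norm[of f X undefined] norm_ge_zero[of "f undefined"]
    by (cases "k \<in> K") (auto simp: C0_sel(1) simp del: norm_ge_zero intro: order_trans)
  then show "cnorm comm_alg (comm_down f) \<le> cnorm (C0 X) f" by (rule C0_norm_le)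
qed

text \<open>At each point the value is a combination of the \<open>v k\<close> with nonnegative
  weights of sum at most 1. This is the property that distinguishes decomposition rank from nuclear
  dimension.\<close>

lemma comm_up_contractive: "contractive comm_alg (C0 X) comm_up"
  unfolding contractive_def
proof
  fix v assume v: "v \<in> carrier comm_alg"
  have "cmod (comm_up v x) \<le> cnorm comm_alg v" for x
  proof -
    have le: "cmod (v k) \<le> cnorm comm_alg v" for k
      using v by (intro C0_le_norm) (simp add: C0_sel)
    then have nn: "0 \<le> cnorm comm_alg v" using norm_ge_zero order_trans by blast
    have wn: "cmod (w k x) = Re (w k x)" if "k \<in> K" for k
      using w(2)[OF that, of x] by (auto elim: nonneg_Reals_cases)
    have "cmod (comm_up v x) \<le> (\<Sum>k\<in>K. cnorm comm_alg v * Re (w k x))"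
      using w(2) le by (intro order_trans[OF norm_sum] sum_mono)
        (auto simp: norm_mult wn complex_nonneg_Reals_iff intro: mult_right_mono)
    also have "\<dots> \<le> cnorm comm_alg v * 1"
      unfolding sum_distrib_left[symmetric] by (intro mult_left_mono w nn)
    finally show ?thesis by simp
  qed
  then show "cnorm (C0 X) (comm_up v) \<le> cnorm comm_alg v" by (rule C0_norm_le)
qed

lemma comm_ideal_ideal: "two_sided_ideal (comm_ideal i) comm_alg"
  unfolding two_sided_ideal_def by (auto simp: C0_sel comm_carrier) (metis add_0)+

lemma comm_decomposition: "ideal_decomposition n comm_ideal comm_alg"
  unfolding ideal_decomposition_def
proof (intro conjI allI impI ballI comm_ideal_ideal)
  fix v assume "v \<in> carrier comm_alg"
  then have v: "v k = 0" if "k \<notin> K" for k using that by (auto simp: C0_sel comm_carrier)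
  have sum: "(\<Oplus>\<^bsub>comm_alg\<^esub>i\<in>{..n}. y i) = (\<lambda>k. \<Sum>i\<le>n. y i k)"
    if "y \<in> (\<Pi>\<^sub>E i\<in>{..n}. comm_ideal i)" for y
    using that by (intro finsum_C0) (auto simp: comm_carrier PiE_iff)
  have sum': "(\<Sum>i\<le>n. y i k) = y (c k) k" if "y \<in> (\<Pi>\<^sub>E i\<in>{..n}. comm_ideal i)" "k \<in> K" for y k
  proof -
    have "y i k = 0" if "i \<le> n" "i \<noteq> c k" for i
      using \<open>y \<in> _\<close> that by (auto simp: PiE_iff)
    then have "(\<Sum>i\<le>n. y i k) = (\<Sum>i\<in>{c k}. y i k)"
      using c[OF that(2)] by (intro sum.mono_neutral_right) auto
    then show ?thesis by simp
  qed
  show "\<exists>!y. y \<in> (\<Pi>\<^sub>E i\<in>{..n}. comm_ideal i) \<and> v = (\<Oplus>\<^bsub>comm_alg\<^esub>i\<in>{..n}. y i)"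
  proof (intro ex1I conjI; (elim conjE)?)
    let ?y = "\<lambda>i\<in>{..n}. \<lambda>k. if c k = i then v k else 0"
    show y: "?y \<in> (\<Pi>\<^sub>E i\<in>{..n}. comm_ideal i)" using v by (auto split: if_splits) blast
    have "v k = (\<Sum>i\<le>n. ?y i k)" for k
    proof (cases "k \<in> K")
      case True
      then show ?thesis using sum'[OF y True] c[OF True] by simp
    next
      case False
      then show ?thesis using v by simp
    qed
    then show "v = (\<Oplus>\<^bsub>comm_alg\<^esub>i\<in>{..n}. ?y i)" unfolding sum[OF y] by blast
    fix z assume z: "z \<in> (\<Pi>\<^sub>E i\<in>{..n}. comm_ideal i)" "v = (\<Oplus>\<^bsub>comm_alg\<^esub>i\<in>{..n}. z i)"
    have zk: "v k = z (c k) k" if "k \<in> K" for k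
      using z(2) sum'[OF z(1) that] unfolding sum[OF z(1)] by simp
    have "z i k = (if c k = i then v k else 0)" if "i \<le> n" for i k
    proof (cases "k \<in> K \<and> c k = i")
      case False
      then have "z i k = 0" using z(1) that by (auto simp: PiE_iff)
      then show ?thesis using False v by auto
    qed (use zk in auto)
    then have "z i = ?y i" for i
      using PiE_arb[OF z(1), of i] by (cases "i \<le> n") auto
    then show "z = ?y" by blast
  qed
qed

text \<open>Expand the product into terms indexed by \<open>k\<close> and \<open>l\<close>: both
  indices have colour \<open>i\<close>, so terms with \<open>k \<noteq> l\<close> vanish by
  \<open>disj\<close>, and those with \<open>k = l\<close> because
  \<open>a k * b k = 0\<close>.\<close>

lemma comm_order_zero: "order_zero (comm_alg\<lparr>carrier := comm_ideal i\<rparr>) (C0 X) comm_up"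
  unfolding order_zero_def
proof (intro ballI impI)
  fix a b assume a: "a \<in> positive_elements (comm_alg\<lparr>carrier := comm_ideal i\<rparr>)"
    and b: "b \<in> positive_elements (comm_alg\<lparr>carrier := comm_ideal i\<rparr>)"
    and "a \<otimes>\<^bsub>comm_alg\<lparr>carrier := comm_ideal i\<rparr>\<^esub> b = \<zero>\<^bsub>comm_alg\<lparr>carrier := comm_ideal i\<rparr>\<^esub>"
  then have ab: "a k * b k = 0" for k by (simp add: C0_sel fun_eq_iff)
  have ci: "a k = 0" "b k = 0" if "c k \<noteq> i" for k
    using a b that by (auto simp: positive_elements_def C0_sel)
  have "(a k * w k x) * (b l * w l x) = 0" if "k \<in> K" "l \<in> K" for k l x
    using ab[of k] ci[of k] ci[of l] disj[OF that, of x]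
    by (cases "c k = i"; cases "c l = i"; cases "k = l") auto
  then have "comm_up a x * comm_up b x = 0" for x
    unfolding sum_product by (intro sum.neutral ballI) blast
  then show "comm_up a \<otimes>\<^bsub>C0 X\<^esub> comm_up b = \<zero>\<^bsub>C0 X\<^esub>" unfolding C0_sel by (rule ext)
qed

lemma commutative_approximant:
  "nuclear_approximant n (C0 X) comm_alg comm_down comm_up"
proof -
  have "finite_dimensional comm_alg"
  proof -
    let ?e = "\<lambda>k j. if j = k then 1 else (0::complex)"
    have e: "finite (?e ` K)" "?e ` K \<subseteq> carrier comm_alg"
      using K by (auto simp: C0_sel comm_carrier)
    have inj: "inj_on ?e K" by (auto simp: inj_on_def fun_eq_iff split: if_splits)
    have span: "\<exists>d. v = (\<Oplus>\<^bsub>comm_alg\<^esub>s\<in>?e ` K. d s \<odot>\<^bsub>comm_alg\<^esub> s)"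
      if v: "v \<in> carrier comm_alg" for v
    proof -
      \<comment> \<open>\<open>finite_dimensional\<close> indexes coefficients by the spanning
        vectors themselves, so the index \<open>k\<close> has to be recovered from its indicator
        function.\<close>
      let ?d = "\<lambda>s. v (the_inv_into K ?e s)"
      have "(\<Oplus>\<^bsub>comm_alg\<^esub>s\<in>?e ` K. ?d s \<odot>\<^bsub>comm_alg\<^esub> s) = (\<lambda>j. \<Sum>s\<in>?e ` K. ?d s * s j)"
        using K by (subst finsum_C0) (auto simp: C0_sel comm_carrier split: if_splits)
      also have "\<dots> = (\<lambda>j. \<Sum>k\<in>K. ?d (?e k) * ?e k j)"
        by (simp only: sum.reindex[OF inj] o_def)
      also have "\<dots> = (\<lambda>j. \<Sum>k\<in>K. v k * ?e k j)"
        by (intro ext sum.cong refl) (simp only: the_inv_into_f_f[OF inj])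
      also have "\<dots> = v"
        using v K by (auto simp: fun_eq_iff C0_sel comm_carrier if_distrib[of "\<lambda>z. _ * z"] cong: if_cong)
      finally have "v = (\<Oplus>\<^bsub>comm_alg\<^esub>s\<in>?e ` K. ?d s \<odot>\<^bsub>comm_alg\<^esub> s)" by (rule sym)
      then show "\<exists>d. v = (\<Oplus>\<^bsub>comm_alg\<^esub>s\<in>?e ` K. d s \<odot>\<^bsub>comm_alg\<^esub> s)" by (rule exI[of _ ?d])
    qed
    show ?thesis
      unfolding finite_dimensional_def by (intro exI[of _ "?e ` K"] conjI e ballI span)
  qed
  moreover have "cp_map (comm_alg\<lparr>carrier := comm_ideal i\<rparr>) (C0 X) comm_up" for i
  proof -
    have "cp_map (comm_alg\<lparr>carrier := comm_ideal i\<rparr>) comm_alg id"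
      by (rule cp_map_hom[OF ideal_abelian_monoid[OF cstar_algebra_C0 inj_on_id comm_ideal_ideal] abelian_monoid_C0])
         (auto simp: C0_sel comm_carrier)
    from cp_map_comp[OF this comm_up_cp] show ?thesis by simp
  qed
  moreover have "contractive (comm_alg\<lparr>carrier := comm_ideal i\<rparr>) (C0 X) comm_up" for i
    using comm_up_contractive unfolding contractive_def by (auto simp: C0_sel comm_carrier)
  ultimately show ?thesis
    unfolding nuclear_approximant_def Let_def
    using cstar_algebra_C0 comm_down_cp comm_up_cp comm_down_contractive comm_decomposition
      comm_order_zero by blast
qed

end

section \<open>From nets to single approximants, and coloured systems\<close>

lemma nuclear_dim_leD:
  assumes "nuclear_dim_le A n" "finite S" "S \<subseteq> carrier A" "0 < e"
  obtains F :: "(nat \<Rightarrow> complex) cstar_algebra" and \<psi> \<phi>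
  where "nuclear_approximant n A F \<psi> \<phi>" "\<And>a. a \<in> S \<Longrightarrow> cnorm A (\<phi> (\<psi> a) \<ominus>\<^bsub>A\<^esub> a) < e"
proof -
  obtain \<Lambda> :: "('a set \<times> nat) set" and rel and F :: "_ \<Rightarrow> (nat \<Rightarrow> complex) cstar_algebra" and \<psi> \<phi>
    where "nuclear_net n A \<Lambda> rel F \<psi> \<phi>"
    using assms(1) unfolding nuclear_dim_le_def by blast
  then have dir: "directed_set \<Lambda> rel"
    and app: "\<And>i. i \<in> \<Lambda> \<Longrightarrow> nuclear_approximant n A (F i) (\<psi> i) (\<phi> i)"
    and tend: "tends_to_identity A \<Lambda> rel (\<lambda>i. \<phi> i \<circ> \<psi> i)"
    unfolding nuclear_net_def by auto
  obtain i where i: "i \<in> \<Lambda>" "\<And>j a. \<lbrakk>j \<in> \<Lambda>; rel i j; a \<in> S\<rbrakk> \<Longrightarrow> cnorm A ((\<phi> j \<circ> \<psi> j) a \<ominus>\<^bsub>A\<^esub> a) < e"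
    using tend assms(2-4) unfolding tends_to_identity_def by metis
  have "rel i i" using dir i(1) unfolding directed_set_def by blast
  then show ?thesis using that[OF app[OF i(1)]] i by auto
qed

text \<open>One approximant is chosen for each pair of a finite set and a tolerance
  \<open>1 / Suc k\<close>; the pairs are directed by inclusion and size.\<close>

lemma decomp_rank_leI_approximants:
  fixes A :: "'a cstar_algebra"
  assumes ex: "\<And>S e. \<lbrakk>finite S; S \<subseteq> carrier A; 0 < e\<rbrakk> \<Longrightarrow>
    \<exists>(F :: 'b cstar_algebra) \<psi> \<phi>. nuclear_approximant n A F \<psi> \<phi> \<and> contractive F A \<phi> \<and>
      (\<forall>a\<in>S. cnorm A (\<phi> (\<psi> a) \<ominus>\<^bsub>A\<^esub> a) < e)"
  shows "decomp_rank_le A n"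
proof -
  let ?\<Lambda> = "{(S, k :: nat). finite S \<and> S \<subseteq> carrier A}"
  let ?rel = "\<lambda>p q :: 'a set \<times> nat. fst p \<subseteq> fst q \<and> snd p \<le> snd q"
  let ?P = "\<lambda>p (F :: 'b cstar_algebra) \<psi> \<phi>. nuclear_approximant n A F \<psi> \<phi> \<and> contractive F A \<phi> \<and>
      (\<forall>a\<in>fst p. cnorm A (\<phi> (\<psi> a) \<ominus>\<^bsub>A\<^esub> a) < 1 / real (Suc (snd p)))"
  have "\<exists>F \<psi> \<phi>. ?P p F \<psi> \<phi>" if "p \<in> ?\<Lambda>" for p
    using that by (intro ex) auto
  then have "\<forall>p\<in>?\<Lambda>. \<exists>T. ?P p (fst T) (fst (snd T)) (snd (snd T))"
    by simp
  from bchoice[OF this] obtain T where T: "\<forall>p\<in>?\<Lambda>. ?P p (fst (T p)) (fst (snd (T p))) (snd (snd (T p)))"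
    by blast
  define F \<psi> \<phi> where "F p = fst (T p)" and "\<psi> p = fst (snd (T p))" and "\<phi> p = snd (snd (T p))" for p
  have F: "?P p (F p) (\<psi> p) (\<phi> p)" if "p \<in> ?\<Lambda>" for p
    unfolding F_def \<psi>_def \<phi>_def by (rule bspec[OF T that])
  have dir: "directed_set ?\<Lambda> ?rel"
    unfolding directed_set_def
  proof (intro conjI ballI)
    fix p q assume "p \<in> ?\<Lambda>" "q \<in> ?\<Lambda>"
    then show "\<exists>r\<in>?\<Lambda>. ?rel p r \<and> ?rel q r"
      by (intro bexI[of _ "(fst p \<union> fst q, max (snd p) (snd q))"]) auto
  qed auto
  have "tends_to_identity A ?\<Lambda> ?rel (\<lambda>p. \<phi> p \<circ> \<psi> p)"
    unfolding tends_to_identity_def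
  proof (intro allI impI, elim conjE)
    fix S and e :: real assume S: "finite S" "S \<subseteq> carrier A" and e: "0 < e"
    obtain k where k: "1 / real (Suc k) < e" using e by (metis nat_approx_posE)
    show "\<exists>p\<in>?\<Lambda>. \<forall>q\<in>?\<Lambda>. ?rel p q \<longrightarrow> (\<forall>a\<in>S. cnorm A ((\<phi> q \<circ> \<psi> q) a \<ominus>\<^bsub>A\<^esub> a) < e)"
    proof (intro bexI[of _ "(S, k)"] ballI impI)
      fix q a assume q: "q \<in> ?\<Lambda>" "?rel (S, k) q" and a: "a \<in> S"
      have "cnorm A ((\<phi> q \<circ> \<psi> q) a \<ominus>\<^bsub>A\<^esub> a) < 1 / real (Suc (snd q))"
        using F[OF q(1)] q(2) a by auto
      also have "\<dots> \<le> 1 / real (Suc k)" using q(2) by (auto intro!: divide_left_mono)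
      finally show "cnorm A ((\<phi> q \<circ> \<psi> q) a \<ominus>\<^bsub>A\<^esub> a) < e" using k by simp
    qed (use S in auto)
  qed
  then have "nuclear_net n A ?\<Lambda> ?rel F \<psi> \<phi>"
    unfolding nuclear_net_def using dir F by blast
  then show ?thesis by (rule decomp_rank_leI) (use F in blast)
qed

text \<open>What remains of a nuclear approximation after compression to minimal projections:
  \<open>K\<close> replaces the algebra, \<open>c k\<close> is the number of the ideal containing
  \<open>k\<close>, and \<open>g k\<close> is the image of \<open>k\<close>. Each \<open>g k\<close>
  is bounded by 1, their sum is not.\<close>

definition coloured_system ::
    "'x topology \<Rightarrow> nat \<Rightarrow> 'k set \<Rightarrow> ('k \<Rightarrow> nat) \<Rightarrow> ('k \<Rightarrow> 'x \<Rightarrow> complex) \<Rightarrow>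
     ('k \<Rightarrow> ('x \<Rightarrow> complex) \<Rightarrow> complex) \<Rightarrow> bool" where
  "coloured_system X n K c g \<mu> \<longleftrightarrow> finite K \<and>
     (\<forall>k\<in>K. c k \<le> n \<and> g k \<in> C0_functions X \<and> (\<forall>x. g k x \<in> \<real>\<^sub>\<ge>\<^sub>0 \<and> cmod (g k x) \<le> 1) \<and>
        positive_functional X (\<mu> k) \<and> (\<forall>f\<in>C0_functions X. cmod (\<mu> k f) \<le> cnorm (C0 X) f)) \<and>
     (\<forall>k\<in>K. \<forall>l\<in>K. k \<noteq> l \<longrightarrow> c k = c l \<longrightarrow> (\<forall>x. g k x * g l x = 0))"

lemma coloured_systemD:
  assumes "coloured_system X n K c g \<mu>"
  shows "finite K" "k \<in> K \<Longrightarrow> c k \<le> n" "k \<in> K \<Longrightarrow> g k \<in> C0_functions X"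
    "k \<in> K \<Longrightarrow> g k x \<in> \<real>\<^sub>\<ge>\<^sub>0" "k \<in> K \<Longrightarrow> cmod (g k x) \<le> 1"
    "k \<in> K \<Longrightarrow> positive_functional X (\<mu> k)"
    "\<lbrakk>k \<in> K; f \<in> C0_functions X\<rbrakk> \<Longrightarrow> cmod (\<mu> k f) \<le> cnorm (C0 X) f"
    "\<lbrakk>k \<in> K; l \<in> K; k \<noteq> l; c k = c l\<rbrakk> \<Longrightarrow> g k x * g l x = 0"
  using assms unfolding coloured_system_def by blast+

abbreviation approximates ::
    "'k set \<Rightarrow> ('k \<Rightarrow> 'x \<Rightarrow> complex) \<Rightarrow> ('k \<Rightarrow> ('x \<Rightarrow> complex) \<Rightarrow> complex) \<Rightarrow> ('x \<Rightarrow> complex) \<Rightarrow> real \<Rightarrow> bool"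
  where "approximates K g \<mu> f e \<equiv> \<forall>x. cmod ((\<Sum>k\<in>K. \<mu> k f * g k x) - f x) \<le> e"

lemma decomp_rank_le_C0I:
  fixes X :: "'x topology"
  assumes ex: "\<And>S e. \<lbrakk>finite S; S \<subseteq> C0_functions X; 0 < e\<rbrakk> \<Longrightarrow>
    \<exists>(K :: 'k set) c g \<mu>. coloured_system X n K c g \<mu> \<and> (\<forall>x. (\<Sum>k\<in>K. Re (g k x)) \<le> 1) \<and>
      (\<forall>f\<in>S. approximates K g \<mu> f e)"
  shows "decomp_rank_le (C0 X) n"
proof (rule decomp_rank_leI_approximants)
  fix S and e :: real assume "finite S" "S \<subseteq> carrier (C0 X)" and e: "0 < e"
  then have S: "finite S" "S \<subseteq> C0_functions X" by (auto simp: C0_sel)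
  \<comment> \<open>A pointwise bound passes to the supremum only as a weak inequality; halving the
    tolerance restores the strict one.\<close>
  have "0 < e / 2" using e by simp
  from ex[OF S this] obtain K :: "'k set" and c g \<mu> where
    all: "coloured_system X n K c g \<mu> \<and> (\<forall>x. (\<Sum>k\<in>K. Re (g k x)) \<le> 1) \<and>
      (\<forall>f\<in>S. approximates K g \<mu> f (e / 2))"
    by (elim exE) (rule that)
  then have sys: "coloured_system X n K c g \<mu>"
    and sum: "\<And>x. (\<Sum>k\<in>K. Re (g k x)) \<le> 1"
    and app: "\<And>f x. f \<in> S \<Longrightarrow> cmod ((\<Sum>k\<in>K. \<mu> k f * g k x) - f x) \<le> e / 2"
    by simp_all
  note D = coloured_systemD[OF sys]
  let ?F = "C0 (discrete_topology K)" and ?\<psi> = "\<lambda>f k. if k \<in> K then \<mu> k f else 0"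
    and ?\<phi> = "\<lambda>v x. \<Sum>k\<in>K. v k * g k x"
  have "nuclear_approximant n (C0 X) ?F ?\<psi> ?\<phi>"
    by (rule commutative_approximant[where c = c]) (rule D sum; assumption)+
  moreover have "contractive ?F (C0 X) ?\<phi>"
    by (rule comm_up_contractive[where c = c and n = n and \<nu> = \<mu>]) (rule D sum; assumption)+
  moreover have "cnorm (C0 X) (?\<phi> (?\<psi> f) \<ominus>\<^bsub>C0 X\<^esub> f) < e" if f: "f \<in> S" for f
  proof -
    have "?\<phi> (?\<psi> f) \<in> C0_functions X" using D(3) by (intro C0_sum C0_smult)
    then have "?\<phi> (?\<psi> f) \<ominus>\<^bsub>C0 X\<^esub> f = (\<lambda>x. (\<Sum>k\<in>K. \<mu> k f * g k x) - f x)"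
      using f S by (subst C0_diff) auto
    then have "cnorm (C0 X) (?\<phi> (?\<psi> f) \<ominus>\<^bsub>C0 X\<^esub> f) \<le> e / 2"
      using app[OF f] by (simp only: C0_norm_le)
    then show ?thesis using e by simp
  qed
  ultimately show "\<exists>(F :: ('k \<Rightarrow> complex) cstar_algebra) \<psi> \<phi>. nuclear_approximant n (C0 X) F \<psi> \<phi> \<and>
      contractive F (C0 X) \<phi> \<and> (\<forall>a\<in>S. cnorm (C0 X) (\<phi> (\<psi> a) \<ominus>\<^bsub>C0 X\<^esub> a) < e)"
    by blast
qed

lemma continuous_map_complex_compose:
  fixes f :: "'x \<Rightarrow> 'a::topological_space"
  assumes "continuous_map X euclidean f" "continuous_on UNIV h"
  shows "continuous_map X euclidean (\<lambda>x. h (f x))"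
  using continuous_map_compose[OF assms(1), of euclidean h] assms(2) by (simp add: o_def)

lemma C0_compose:
  assumes f: "f \<in> C0_functions X" and h: "continuous_on UNIV h" "\<And>z. cmod (h z) \<le> B * cmod z"
  shows "(\<lambda>x. h (f x)) \<in> C0_functions X"
proof (rule C0_bounded_mult[OF f, of _ B])
  have "h 0 = 0" using h(2)[of 0] by simp
  then show "h (f x) = 0" if "x \<notin> topspace X" for x using f that by (simp add: C0_functions_def)
  show "continuous_map X euclidean (\<lambda>x. h (f x))"
    using f by (intro continuous_map_complex_compose[OF _ h(1)]) (simp add: C0_functions_def)
qed (rule h(2))

text \<open>Rotating \<open>f\<close> by the conjugate phase \<open>t\<close> of
  \<open>\<mu> f\<close> makes \<open>\<mu> (t f)\<close> equal to \<open>cmod (\<mu> f)\<close>,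
  which is then the value of \<open>\<mu>\<close> at the real part of \<open>t f\<close>, a real
  function below \<open>p\<close>. The hypothesis \<open>le\<close> also says that \<open>p\<close>
  is real.\<close>

lemma positive_functional_le:
  assumes \<mu>: "positive_functional X \<mu>" and f: "f \<in> C0_functions X" and p: "p \<in> C0_functions X"
    and le: "\<And>x. of_real (cmod (f x)) - p x \<in> \<real>\<^sub>\<le>\<^sub>0"
  shows "cmod (\<mu> f) \<le> Re (\<mu> p)"
proof -
  have le': "cmod (f x) \<le> Re (p x)" "Im (p x) = 0" for x
    using le[of x] by (auto simp: complex_nonpos_Reals_iff)
  have pn: "p x \<in> \<real>\<^sub>\<ge>\<^sub>0" for x
    using le'[of x] norm_ge_zero[of "f x"] by (simp add: complex_nonneg_Reals_iff del: norm_ge_zero)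
  have \<mu>p: "\<mu> p \<in> \<real>\<^sub>\<ge>\<^sub>0" by (rule positive_functionalD(3)[OF \<mu> p pn])
  have part: "Im (\<mu> (\<lambda>x. of_real (r x))) = 0 \<and> Re (\<mu> (\<lambda>x. of_real (r x))) \<le> Re (\<mu> p)"
    if "(\<lambda>x. of_real (r x)) \<in> C0_functions X" "\<And>x. r x \<le> cmod (f x)" for r
  proof -
    have "\<mu> (\<lambda>x. p x + (-1) * of_real (r x)) \<in> \<real>\<^sub>\<ge>\<^sub>0"
      using p that(1) that(2) le'
      by (intro positive_functionalD(3)[OF \<mu>] C0_add C0_smult) (auto simp: complex_nonneg_Reals_iff intro: order_trans)
    also have "\<mu> (\<lambda>x. p x + (-1) * of_real (r x)) = \<mu> p + (-1) * \<mu> (\<lambda>x. of_real (r x))"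
      unfolding positive_functionalD(1)[OF \<mu> p C0_smult[OF that(1), of "-1"]]
        positive_functionalD(2)[OF \<mu> that(1), of "-1"] by (rule refl)
    finally show ?thesis using \<mu>p by (simp add: complex_nonneg_Reals_iff)
  qed
  define t where "t = cnj (sgn (\<mu> f))"
  define h where "h x = t * f x" for x
  have t: "cmod t \<le> 1" by (simp add: t_def norm_sgn)
  have ht: "cmod (h x) \<le> cmod (f x)" for x
    using mult_right_mono[OF t, of "cmod (f x)"] by (simp add: h_def norm_mult)
  have hC: "h \<in> C0_functions X" unfolding h_def using f by (rule C0_smult)
  have Re: "(\<lambda>x. complex_of_real (Re (h x))) \<in> C0_functions X"
    and Im: "(\<lambda>x. complex_of_real (Im (h x))) \<in> C0_functions X"
    by (rule C0_compose[OF hC, where B = 1]; auto intro!: continuous_intros simp: abs_Re_le_cmod abs_Im_le_cmod)+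
  have "h = (\<lambda>x. of_real (Re (h x)) + \<i> * of_real (Im (h x)))"
    by (simp add: complex_eq_iff fun_eq_iff)
  then have "\<mu> h = \<mu> (\<lambda>x. of_real (Re (h x)) + \<i> * of_real (Im (h x)))" by simp
  also have "\<dots> = \<mu> (\<lambda>x. of_real (Re (h x))) + \<i> * \<mu> (\<lambda>x. of_real (Im (h x)))"
    using positive_functionalD(1)[OF \<mu> Re C0_smult[OF Im]] positive_functionalD(2)[OF \<mu> Im] by simp
  finally have "Re (\<mu> h) = Re (\<mu> (\<lambda>x. of_real (Re (h x))))"
    using part[OF Im] ht by (simp add: order_trans[OF abs_le_D1[OF abs_Im_le_cmod]])
  moreover have "Re (\<mu> h) = cmod (\<mu> f)"
  proof -
    have "\<mu> h = t * \<mu> f" unfolding h_def by (rule positive_functionalD(2)[OF \<mu> f])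
    also have "\<dots> = of_real (cmod (\<mu> f))"
    proof (cases "\<mu> f = 0")
      case False
      have "cnj (\<mu> f) * \<mu> f = of_real ((cmod (\<mu> f))\<^sup>2)"
        by (simp only: complex_norm_square mult.commute)
      then show ?thesis using False by (simp add: t_def sgn_eq power2_eq_square)
    qed simp
    finally show ?thesis by simp
  qed
  ultimately show ?thesis
    using part[OF Re] ht by (simp add: order_trans[OF complex_Re_le_cmod])
qed

text \<open>The minimum of 1 and the sum of the squares \<open>(cmod (f x) / \<eta>)^2\<close> over
  \<open>S\<close> works: where it differs from 1, the sum and hence each of its terms is below
  1.\<close>

lemma C0_cutoff:
  assumes "finite S" "S \<subseteq> C0_functions X" "0 < \<eta>"
  obtains e where "e \<in> C0_functions X" "\<And>x. e x \<in> \<real>\<^sub>\<ge>\<^sub>0" "\<And>x. cmod (e x) \<le> 1"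
    "\<And>f x. \<lbrakk>f \<in> S; e x \<noteq> 1\<rbrakk> \<Longrightarrow> cmod (f x) \<le> \<eta>"
proof
  let ?p = "\<lambda>x. \<Sum>f\<in>S. of_real (1 / \<eta>\<^sup>2) * (cnj (f x) * f x)"
  let ?e = "\<lambda>x. complex_of_real (min 1 (norm (?p x)))"
  have "?p \<in> C0_functions X" using assms by (intro C0_sum C0_smult C0_mult C0_cnj) auto
  then show "?e \<in> C0_functions X"
    by (rule C0_compose[where B = 1]) (auto intro!: continuous_intros)
  show "?e x \<in> \<real>\<^sub>\<ge>\<^sub>0" "cmod (?e x) \<le> 1" for x by (auto simp: complex_nonneg_Reals_iff)
  fix f x assume f: "f \<in> S" and "?e x \<noteq> 1"
  then have "norm (?p x) < 1" by (auto simp: min_def split: if_splits)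
  moreover have "?p x = of_real (\<Sum>f\<in>S. 1 / \<eta>\<^sup>2 * (cmod (f x))\<^sup>2)"
    by (simp only: of_real_sum of_real_mult complex_norm_square mult.commute[of _ "cnj _"])
  moreover have "1 / \<eta>\<^sup>2 * (cmod (f x))\<^sup>2 \<le> (\<Sum>f\<in>S. 1 / \<eta>\<^sup>2 * (cmod (f x))\<^sup>2)"
    using assms(1) f by (intro member_le_sum) auto
  ultimately have "1 / \<eta>\<^sup>2 * (cmod (f x))\<^sup>2 < 1"
    by (simp add: norm_of_real del: of_real_sum of_real_mult of_real_power)
  then have "(cmod (f x))\<^sup>2 < \<eta>\<^sup>2" using assms(3) by (simp add: field_simps)
  then show "cmod (f x) \<le> \<eta>"
    using power2_less_imp_less[of "cmod (f x)" \<eta>] assms(3) by simp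
qed

text \<open>
  A system with \<open>\<Sum> \<mu>\<^sub>k(e) g\<^sub>k \<approx> e\<close> becomes one with \<open>\<Sum> w\<^sub>k \<le> 1\<close> by moving the weight
  \<open>\<mu>\<^sub>k(e) \<le> 1\<close> from the functionals to the functions; functionals of weight \<open>0\<close> become \<open>0\<close>,
  since \<open>x / 0 = 0\<close>.
\<close>

lemma coloured_system_normalise:
  assumes sys: "coloured_system X n K c g \<mu>" and S: "finite S" "S \<subseteq> C0_functions X"
    and e: "e \<in> C0_functions X" "\<And>x. e x \<in> \<real>\<^sub>\<ge>\<^sub>0" "\<And>x. cmod (e x) \<le> 1" and \<epsilon>: "0 < \<epsilon>"
    and cut: "\<forall>f\<in>S. \<forall>x. cmod (e x * f x - f x) \<le> \<epsilon>"
    and app_e: "\<And>x. cmod ((\<Sum>k\<in>K. \<mu> k e * g k x) - e x) \<le> \<epsilon>"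
    and app: "\<forall>f\<in>S. \<forall>x. cmod ((\<Sum>k\<in>K. \<mu> k (\<lambda>x. e x * f x) * g k x) - e x * f x) \<le> \<epsilon>"
  defines "w \<equiv> \<lambda>k x. of_real (1 / (1 + \<epsilon>)) * (\<mu> k e * g k x)"
    and "\<nu> \<equiv> \<lambda>k f. \<mu> k (\<lambda>x. e x * f x) / \<mu> k e"
  shows "coloured_system X n K c w \<nu>" "(\<Sum>k\<in>K. Re (w k x)) \<le> 1"
    "f \<in> S \<Longrightarrow> cmod ((\<Sum>k\<in>K. \<nu> k f * w k x) - f x) \<le> (2 + cnorm (C0 X) f) * \<epsilon>"
proof -
  note D = coloured_systemD[OF sys]
  have \<mu>e: "\<mu> k e \<in> \<real>\<^sub>\<ge>\<^sub>0" if "k \<in> K" for k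
    using positive_functionalD(3)[OF D(6)[OF that] e(1,2)] .
  have \<mu>e1: "cmod (\<mu> k e) \<le> 1" if "k \<in> K" for k
    using D(7)[OF that e(1)] C0_norm_le[of e 1 X, OF e(3)] by linarith
  \<comment> \<open>Since \<open>cmod (e x * f x)\<close> is at most the norm of \<open>f\<close>
    times \<open>e x\<close>, dividing by \<open>\<mu> k e\<close> leaves a contractive functional,
    and \<open>\<mu> k e = 0\<close> forces \<open>\<mu> k (\<lambda>x. e x * f x) = 0\<close>, so
    that the default value of the quotient is harmless.\<close>
  have \<mu>ef: "cmod (\<mu> k (\<lambda>x. e x * f x)) \<le> cnorm (C0 X) f * cmod (\<mu> k e)"
    if k: "k \<in> K" and f: "f \<in> C0_functions X" for k f
  proof -
    have "cmod (\<mu> k (\<lambda>x. e x * f x)) \<le> Re (\<mu> k (\<lambda>x. of_real (cnorm (C0 X) f) * e x))"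
    proof (rule positive_functional_le[OF D(6)[OF k] C0_mult[OF e(1) f] C0_smult[OF e(1)]])
      fix x
      have "cmod (e x) = Re (e x)" "Im (e x) = 0"
        using e(2)[of x] by (auto elim: nonneg_Reals_cases)
      then show "of_real (cmod (e x * f x)) - of_real (cnorm (C0 X) f) * e x \<in> \<real>\<^sub>\<le>\<^sub>0"
        using C0_le_norm[OF f, of x] e(2)[of x]
        by (simp add: complex_nonpos_Reals_iff norm_mult mult.commute mult_left_mono complex_nonneg_Reals_iff)
    qed
    also have "\<mu> k (\<lambda>x. of_real (cnorm (C0 X) f) * e x) = of_real (cnorm (C0 X) f) * \<mu> k e"
      by (rule positive_functionalD(2)[OF D(6)[OF k] e(1)])
    finally show ?thesis using \<mu>e[OF k] by (auto elim!: nonneg_Reals_cases)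
  qed
  have \<nu>w: "\<nu> k f * w k x = of_real (1 / (1 + \<epsilon>)) * (\<mu> k (\<lambda>x. e x * f x) * g k x)"
    if "k \<in> K" "f \<in> C0_functions X" for k f x
    using \<mu>ef[OF that] by (cases "\<mu> k e = 0") (auto simp: \<nu>_def w_def)
  have \<nu>pf: "positive_functional X (\<nu> k)" if k: "k \<in> K" for k
    unfolding positive_functional_def
  proof (intro conjI ballI allI impI)
    fix f h assume fh: "f \<in> C0_functions X" "h \<in> C0_functions X"
    show "\<nu> k (\<lambda>x. f x + h x) = \<nu> k f + \<nu> k h"
      unfolding \<nu>_def
      using positive_functionalD(1)[OF D(6)[OF k] C0_mult[OF e(1) fh(1)] C0_mult[OF e(1) fh(2)]]
      by (simp add: distrib_left add_divide_distrib)
  next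
    fix a f assume f: "f \<in> C0_functions X"
    show "\<nu> k (\<lambda>x. a * f x) = a * \<nu> k f"
      unfolding \<nu>_def
      using positive_functionalD(2)[OF D(6)[OF k] C0_mult[OF e(1) f], of a]
      by (simp add: mult.left_commute)
  next
    fix f assume f: "f \<in> C0_functions X" "\<forall>x. f x \<in> \<real>\<^sub>\<ge>\<^sub>0"
    have "\<mu> k (\<lambda>x. e x * f x) \<in> \<real>\<^sub>\<ge>\<^sub>0"
      using f e by (intro positive_functionalD(3)[OF D(6)[OF k]] C0_mult nonneg_Reals_mult_I) auto
    then show "\<nu> k f \<in> \<real>\<^sub>\<ge>\<^sub>0" unfolding \<nu>_def using \<mu>e[OF k] by (rule nonneg_Reals_divide_I)
  qed
  have wn: "w k x \<in> \<real>\<^sub>\<ge>\<^sub>0" if "k \<in> K" for k x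
    unfolding w_def using \<epsilon> by (intro nonneg_Reals_mult_I \<mu>e D that) (auto simp: complex_nonneg_Reals_iff)
  have r: "cmod (complex_of_real (1 / (1 + \<epsilon>))) = 1 / (1 + \<epsilon>)" "1 / (1 + \<epsilon>) \<le> 1"
    using \<epsilon> unfolding norm_of_real by simp_all
  show "coloured_system X n K c w \<nu>"
    unfolding coloured_system_def
  proof (intro conjI ballI allI impI D wn \<nu>pf)
    fix k x assume k: "k \<in> K"
    show "w k \<in> C0_functions X" unfolding w_def by (intro C0_smult D k)
    have "cmod (w k x) = 1 / (1 + \<epsilon>) * (cmod (\<mu> k e) * cmod (g k x))"
      unfolding w_def norm_mult r(1) ..
    also have "\<dots> \<le> 1 * (1 * 1)"
      using \<epsilon> \<mu>e1[OF k] D(5)[OF k] by (intro mult_mono) auto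
    finally show "cmod (w k x) \<le> 1" by simp
  next
    fix k f assume k: "k \<in> K" and f: "f \<in> C0_functions X"
    have "0 \<le> cnorm (C0 X) f" using C0_le_norm[OF f] norm_ge_zero order_trans by blast
    then show "cmod (\<nu> k f) \<le> cnorm (C0 X) f"
      using \<mu>ef[OF k f] by (cases "\<mu> k e = 0") (auto simp: \<nu>_def norm_divide field_simps)
  next
    fix k l x assume "k \<in> K" "l \<in> K" "k \<noteq> l" "c k = c l"
    then have "g k x * g l x = 0" by (rule D)
    then show "w k x * w l x = 0" by (auto simp: w_def)
  qed
  \<comment> \<open>The weighted sum is within \<open>\<epsilon>\<close> of \<open>e x\<close>,
    hence at most \<open>1 + \<epsilon>\<close>: this is the origin of the factor
    \<open>1 / (1 + \<epsilon>)\<close> in \<open>w\<close>.\<close>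
  have "Re (\<Sum>k\<in>K. \<mu> k e * g k x) \<le> 1 + \<epsilon>"
    using app_e[of x] e(3)[of x] complex_Re_le_cmod[of "\<Sum>k\<in>K. \<mu> k e * g k x"]
      norm_triangle_ineq2[of "\<Sum>k\<in>K. \<mu> k e * g k x" "e x"] by linarith
  moreover have "(\<Sum>k\<in>K. Re (w k x)) = Re (\<Sum>k\<in>K. \<mu> k e * g k x) / (1 + \<epsilon>)"
    unfolding Re_sum[symmetric] w_def sum_distrib_left[symmetric] by simp
  ultimately show "(\<Sum>k\<in>K. Re (w k x)) \<le> 1" using \<epsilon> by simp
  assume fS: "f \<in> S"
  then have f: "f \<in> C0_functions X" using S by blast
  let ?A = "\<Sum>k\<in>K. \<mu> k (\<lambda>x. e x * f x) * g k x"
  have "(\<Sum>k\<in>K. \<nu> k f * w k x) - f x = of_real (1 / (1 + \<epsilon>)) * ?A - f x"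
    using \<nu>w[OF _ f] by (simp add: sum_distrib_left)
  also have "\<dots> = of_real (1 / (1 + \<epsilon>)) * ((?A - f x) - of_real \<epsilon> * f x)"
  proof -
    have "1 + complex_of_real \<epsilon> \<noteq> 0" using \<epsilon> by (simp add: complex_eq_iff)
    then show ?thesis by (simp add: field_simps)
  qed
  finally have "cmod ((\<Sum>k\<in>K. \<nu> k f * w k x) - f x) = 1 / (1 + \<epsilon>) * cmod ((?A - f x) - of_real \<epsilon> * f x)"
    by (simp only: norm_mult r(1))
  also have "\<dots> \<le> 1 * cmod ((?A - f x) - of_real \<epsilon> * f x)"
    using \<epsilon> by (intro mult_right_mono) auto
  also have "\<dots> \<le> cmod (?A - f x) + \<epsilon> * cmod (f x)"
    using norm_triangle_ineq4[of "?A - f x" "of_real \<epsilon> * f x"] \<epsilon> by (simp add: norm_mult)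
  also have "\<dots> \<le> 2 * \<epsilon> + \<epsilon> * cnorm (C0 X) f"
  proof (intro add_mono mult_left_mono C0_le_norm f)
    show "cmod (?A - f x) \<le> 2 * \<epsilon>"
      using bspec[OF app fS, THEN spec[of _ x]] bspec[OF cut fS, THEN spec[of _ x]] norm_triangle_ineq[of "?A - e x * f x" "e x * f x - f x"] by simp
  qed (use \<epsilon> in simp)
  finally show "cmod ((\<Sum>k\<in>K. \<nu> k f * w k x) - f x) \<le> (2 + cnorm (C0 X) f) * \<epsilon>"
    by (simp add: algebra_simps)
qed

text \<open>The index type is a parameter because a formula cannot quantify over types. It becomes
  \<open>nat \<Rightarrow> complex\<close> in the application, where the indices are projections in
  the algebras of the net.\<close>

definition coloured_approximable :: "'k itself \<Rightarrow> 'x topology \<Rightarrow> nat \<Rightarrow> bool" where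
  "coloured_approximable _ X n \<longleftrightarrow> (\<forall>S e. finite S \<and> S \<subseteq> C0_functions X \<and> 0 < e \<longrightarrow>
     (\<exists>(K :: 'k set) c g \<mu>. coloured_system X n K c g \<mu> \<and>
        (\<forall>f\<in>S. approximates K g \<mu> f e)))"

lemma decomp_rank_le_if_coloured_approximable:
  fixes X :: "'x topology"
  assumes Q: "coloured_approximable TYPE('k) X n"
  shows "decomp_rank_le (C0 X) n"
proof (rule decomp_rank_le_C0I)
  fix S and \<delta> :: real assume S: "finite S" "S \<subseteq> C0_functions X" and \<delta>: "0 < \<delta>"
  define M where "M = (\<Sum>f\<in>S. cnorm (C0 X) f)"
  have nn: "0 \<le> cnorm (C0 X) f" if "f \<in> S" for f
    using C0_le_norm[of f X] S that norm_ge_zero order_trans by blast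
  have M: "cnorm (C0 X) f \<le> M" if "f \<in> S" for f
    unfolding M_def using that S nn by (intro member_le_sum) auto
  have M0: "0 \<le> M" unfolding M_def using nn by (rule sum_nonneg)
  \<comment> \<open>Normalisation costs \<open>2 + cnorm (C0 X) f\<close> times
    \<open>\<epsilon>\<close>, and \<open>M\<close> bounds all norms that occur.\<close>
  define \<epsilon> where "\<epsilon> = \<delta> / (2 + M)"
  have \<epsilon>: "0 < \<epsilon>" using \<delta> M0 by (simp add: \<epsilon>_def)
  obtain e where e: "e \<in> C0_functions X" "\<And>x. e x \<in> \<real>\<^sub>\<ge>\<^sub>0" "\<And>x. cmod (e x) \<le> 1"
    and ce: "\<And>f x. \<lbrakk>f \<in> S; e x \<noteq> 1\<rbrakk> \<Longrightarrow> cmod (f x) \<le> \<epsilon>"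
    using C0_cutoff[OF S \<epsilon>] by blast
  have cut: "cmod (e x * f x - f x) \<le> \<epsilon>" if "f \<in> S" for f x
  proof (cases "e x = 1")
    case False
    have "cmod (e x - 1) \<le> 1"
    proof -
      obtain r where r: "e x = of_real r" "0 \<le> r" using e(2)[of x] by (auto elim: nonneg_Reals_cases)
      have "cmod (e x - 1) = \<bar>r - 1\<bar>" unfolding r norm_of_real[symmetric, where 'a = complex] by simp
      then show ?thesis using e(3)[of x] r by simp
    qed
    then have "cmod (e x - 1) * cmod (f x) \<le> 1 * \<epsilon>"
      using ce[OF that False] by (intro mult_mono) auto
    then show ?thesis by (simp add: norm_mult[symmetric] left_diff_distrib)
  qed (use \<epsilon> in simp)
  let ?S = "insert e ((\<lambda>f x. e x * f x) ` S)"
  have "finite ?S \<and> ?S \<subseteq> C0_functions X \<and> 0 < \<epsilon>" using S e(1) \<epsilon> C0_mult by auto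
  from Q[unfolded coloured_approximable_def, rule_format, OF this]
  obtain K :: "'k set" and c g \<mu> where
    "coloured_system X n K c g \<mu> \<and> (\<forall>f\<in>?S. approximates K g \<mu> f \<epsilon>)"
    by (elim exE) (rule that)
  then have sys: "coloured_system X n K c g \<mu>"
    and app: "\<And>f x. f \<in> ?S \<Longrightarrow> cmod ((\<Sum>k\<in>K. \<mu> k f * g k x) - f x) \<le> \<epsilon>"
    by blast+
  let ?w = "\<lambda>k x. of_real (1 / (1 + \<epsilon>)) * (\<mu> k e * g k x)"
  let ?\<nu> = "\<lambda>k f. \<mu> k (\<lambda>x. e x * f x) / \<mu> k e"
  have app_e: "\<And>x. cmod ((\<Sum>k\<in>K. \<mu> k e * g k x) - e x) \<le> \<epsilon>" using app by blast
  have app_f: "cmod ((\<Sum>k\<in>K. \<mu> k (\<lambda>x. e x * f x) * g k x) - e x * f x) \<le> \<epsilon>" if "f \<in> S" for f x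
    using app[of "\<lambda>x. e x * f x" x] that by blast
  have cut': "\<forall>f\<in>S. \<forall>x. cmod (e x * f x - f x) \<le> \<epsilon>"
    and app': "\<forall>f\<in>S. \<forall>x. cmod ((\<Sum>k\<in>K. \<mu> k (\<lambda>x. e x * f x) * g k x) - e x * f x) \<le> \<epsilon>"
    using cut app_f by blast+
  note norm = coloured_system_normalise[where X = X and n = n and K = K and c = c and g = g and \<mu> = \<mu>
      and S = S and e = e and \<epsilon> = \<epsilon>, OF sys S e \<epsilon> cut' app_e app']
  have le\<delta>: "(2 + cnorm (C0 X) f) * \<epsilon> \<le> \<delta>" if "f \<in> S" for f
  proof -
    have "(2 + cnorm (C0 X) f) * \<epsilon> \<le> (2 + M) * \<epsilon>"
      using M[OF that] \<epsilon> by (intro mult_right_mono) auto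
    then show ?thesis using M0 by (simp add: \<epsilon>_def)
  qed
  have "cmod ((\<Sum>k\<in>K. ?\<nu> k f * ?w k x) - f x) \<le> \<delta>" if "f \<in> S" for f x
    using norm(3)[OF that, of x] le\<delta>[OF that] by (rule order_trans)
  then show "\<exists>(K :: 'k set) c g \<mu>. coloured_system X n K c g \<mu> \<and> (\<forall>x. (\<Sum>k\<in>K. Re (g k x)) \<le> 1) \<and>
      (\<forall>f\<in>S. approximates K g \<mu> f \<delta>)"
    using norm(1,2) by (intro exI[of _ K] exI[of _ c] exI[of _ ?w] exI[of _ ?\<nu>] conjI allI ballI)
qed

subsection \<open>Minimal projections in finite-dimensional C*-algebras\<close>

text \<open>Gaussian elimination by induction on the equations \<open>S\<close>: if
  \<open>c j s\<close> is nonzero, equation \<open>s\<close> determines the unknown \<open>j\<close>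
  from the others, and the columns corrected by multiples of column \<open>j\<close> form a system
  with one equation and one unknown less.\<close>

lemma linear_dependence:
  fixes c :: "'i \<Rightarrow> 's \<Rightarrow> complex"
  assumes "finite S" "finite I" "card S < card I"
  shows "\<exists>a. (\<exists>i\<in>I. a i \<noteq> 0) \<and> (\<forall>s\<in>S. (\<Sum>i\<in>I. a i * c i s) = 0)"
  using assms
proof (induction S arbitrary: I c rule: finite_induct)
  case empty
  then obtain i where "i \<in> I" by fastforce
  then show ?case by (intro exI[of _ "\<lambda>_. 1"]) auto
next
  case (insert s S)
  show ?case
  proof (cases "\<forall>i\<in>I. c i s = 0")
    case True
    obtain a where "\<exists>i\<in>I. a i \<noteq> 0" "\<forall>t\<in>S. (\<Sum>i\<in>I. a i * c i t) = 0"
      using insert.IH[of I c] insert.prems insert.hyps by auto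
    then show ?thesis using True by auto
  next
    case False
    then obtain j where j: "j \<in> I" "c j s \<noteq> 0" by blast
    let ?I = "I - {j}" and ?c = "\<lambda>i t. c i t - c i s / c j s * c j t"
    have "finite ?I" "card S < card ?I" using insert.prems insert.hyps j by auto
    then obtain a where a: "\<exists>i\<in>?I. a i \<noteq> 0" "\<forall>t\<in>S. (\<Sum>i\<in>?I. a i * ?c i t) = 0"
      using insert.IH[of ?I ?c] by blast
    define b where "b = a(j := - (\<Sum>i\<in>?I. a i * c i s / c j s))"
    have split: "(\<Sum>i\<in>I. b i * c i t) = (\<Sum>i\<in>?I. a i * ?c i t)" for t
    proof -
      have "(\<Sum>i\<in>I. b i * c i t) = b j * c j t + (\<Sum>i\<in>?I. b i * c i t)"
        using insert.prems j by (intro sum.remove) auto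
      also have "(\<Sum>i\<in>?I. b i * c i t) = (\<Sum>i\<in>?I. a i * c i t)"
        by (intro sum.cong) (auto simp: b_def)
      finally show ?thesis
        by (simp add: b_def right_diff_distrib sum_subtractf sum_distrib_right mult.assoc)
    qed
    have "(\<Sum>i\<in>I. b i * c i t) = 0" if "t \<in> insert s S" for t
      using that a(2) j(2) unfolding split by auto
    moreover have "\<exists>i\<in>I. b i \<noteq> 0" using a(1) by (auto simp: b_def)
    ultimately show ?thesis by blast
  qed
qed

section \<open>Scalars, linear dependence and eigenvectors in a C*-algebra\<close>

context cstar_algebra
begin

lemmas smult_facts = smult_closed[unfolded complex_ring_def, simplified]
  smult_l_distr[unfolded complex_ring_def, simplified]
  smult_r_distr[unfolded complex_ring_def, simplified]
  smult_assoc1[unfolded complex_ring_def, simplified]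
  smult_one[unfolded complex_ring_def, simplified]
  smult_l_null[unfolded complex_ring_def, simplified]
  smult_r_null[unfolded complex_ring_def, simplified]

lemmas sm_closed [simp] = smult_facts(1)
lemmas sm_add_left = smult_facts(2)
lemmas sm_add_right = smult_facts(3)
lemmas sm_assoc = smult_facts(4)
lemmas sm_one [simp] = smult_facts(5)
lemmas sm_zero_left [simp] = smult_facts(6)
lemmas sm_zero_right [simp] = smult_facts(7)

declare m_closed [simp] adj_closed [simp] adj_adj [simp]

lemma mult_zero [simp]: "x \<in> carrier A \<Longrightarrow> x \<otimes> \<zero> = \<zero>" "x \<in> carrier A \<Longrightarrow> \<zero> \<otimes> x = \<zero>"
  using smult_m_right[of x \<zero> 0] smult_m_left[of \<zero> x 0] by simp_all

lemma adj_zero [simp]: "adj A \<zero> = \<zero>"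
  using adj_smult[of \<zero> 0] by simp

lemma minus_conv: "\<lbrakk>x \<in> carrier A; y \<in> carrier A\<rbrakk> \<Longrightarrow> x \<ominus> y = x \<oplus> (-1) \<odot> y"
proof -
  assume xy: "x \<in> carrier A" "y \<in> carrier A"
  have "(-1) \<odot> y \<oplus> y = (-1) \<odot> y \<oplus> 1 \<odot> y" using xy by simp
  also have "\<dots> = \<zero>" using sm_add_left[of y "-1" 1, symmetric] xy by simp
  finally have "\<ominus> y = (-1) \<odot> y" using xy by (intro M.minus_equality) auto
  then show ?thesis by (simp add: a_minus_def)
qed

lemma eq_if_diff_zero: "\<lbrakk>x \<in> carrier A; y \<in> carrier A; x \<oplus> (-1) \<odot> y = \<zero>\<rbrakk> \<Longrightarrow> x = y"
  by (metis M.add.m_closed M.minus_closed M.minus_equality M.minus_minus M.a_inv_closed a_minus_def minus_conv)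

text \<open>The C*-identity enters here. It excludes nonzero self-adjoint elements of square zero,
  on which the arguments with orthogonal families rest.\<close>

lemma adj_mult_self_eq_zero: "\<lbrakk>x \<in> carrier A; adj A x \<otimes> x = \<zero>\<rbrakk> \<Longrightarrow> x = \<zero>"
  using cstar_identity[of x] cnorm_eq_0[of x] cnorm_eq_0[of \<zero>] by simp

lemma mult_adj_self_eq_zero: "\<lbrakk>x \<in> carrier A; x \<otimes> adj A x = \<zero>\<rbrakk> \<Longrightarrow> x = \<zero>"
  using adj_mult_self_eq_zero[of "adj A x"] adj_zero adj_adj by (metis adj_closed)

lemma self_adj_sq_eq_zero: "\<lbrakk>x \<in> carrier A; adj A x = x; x \<otimes> x = \<zero>\<rbrakk> \<Longrightarrow> x = \<zero>"
  using adj_mult_self_eq_zero[of x] by simp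

lemma smult_eq_zero:
  assumes "c \<odot> v = \<zero>" "v \<in> carrier A" "v \<noteq> \<zero>"
  shows "c = 0"
proof (rule ccontr)
  assume "c \<noteq> 0"
  then have "inverse c \<odot> (c \<odot> v) = v" using assms(2) by (simp add: sm_assoc[symmetric])
  then show False using assms by simp
qed

lemma mult_finsum:
  assumes "finite S" "f \<in> S \<rightarrow> carrier A" "x \<in> carrier A"
  shows "x \<otimes> (\<Oplus>s\<in>S. f s) = (\<Oplus>s\<in>S. x \<otimes> f s)" "(\<Oplus>s\<in>S. f s) \<otimes> x = (\<Oplus>s\<in>S. f s \<otimes> x)"
  using assms
  by (intro finsum_additive[where h = "\<lambda>y. x \<otimes> y"] finsum_additive[where h = "\<lambda>y. y \<otimes> x"];
      auto simp: r_distr l_distr M.abelian_monoid_axioms)+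

lemma adj_finsum:
  assumes "finite S" "f \<in> S \<rightarrow> carrier A"
  shows "adj A (\<Oplus>s\<in>S. f s) = (\<Oplus>s\<in>S. adj A (f s))"
  using assms
  by (intro finsum_additive[where h = "adj A"]) (auto simp: adj_add M.abelian_monoid_axioms)

lemma finsum_single:
  assumes "finite S" "s \<in> S" "f \<in> S \<rightarrow> carrier A" "\<And>t. \<lbrakk>t \<in> S; t \<noteq> s\<rbrakk> \<Longrightarrow> f t = \<zero>"
  shows "(\<Oplus>t\<in>S. f t) = f s"
proof -
  have "(\<Oplus>t\<in>S. f t) = (\<Oplus>t\<in>insert s (S - {s}). f t)" using assms by (simp add: insert_absorb)
  also have "\<dots> = f s \<oplus> (\<Oplus>t\<in>S - {s}. f t)"
    using assms by (intro M.finsum_insert) auto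
  also have "(\<Oplus>t\<in>S - {s}. f t) = (\<Oplus>t\<in>S - {s}. \<zero>)"
    using assms by (intro M.finsum_cong') auto
  finally show ?thesis using assms by (auto simp: M.finsum_zero Pi_iff)
qed

text \<open>Stated for indexed families, not sets: among the powers of an element applied to a
  vector the same value may occur several times.\<close>

lemma dependent_family:
  assumes "finite_dimensional A"
  obtains d where "\<And>I (x :: 'i \<Rightarrow> 'a). \<lbrakk>finite I; d < card I; x \<in> I \<rightarrow> carrier A\<rbrakk>
    \<Longrightarrow> \<exists>a. (\<exists>i\<in>I. a i \<noteq> 0) \<and> (\<Oplus>i\<in>I. a i \<odot> x i) = \<zero>"
proof -
  obtain S where S: "finite S" "S \<subseteq> carrier A"
    and span: "\<And>x. x \<in> carrier A \<Longrightarrow> \<exists>c. x = (\<Oplus>s\<in>S. c s \<odot> s)"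
    using assms unfolding finite_dimensional_def by blast
  have "\<exists>a. (\<exists>i\<in>I. a i \<noteq> 0) \<and> (\<Oplus>i\<in>I. a i \<odot> x i) = \<zero>"
    if I: "finite I" "card S < card I" and x: "x \<in> I \<rightarrow> carrier A" for I and x :: "'i \<Rightarrow> 'a"
  proof -
    have "\<exists>c. i \<in> I \<longrightarrow> x i = (\<Oplus>s\<in>S. c s \<odot> s)" for i using span x by (cases "i \<in> I") auto
    then obtain c where c: "\<And>i. i \<in> I \<Longrightarrow> x i = (\<Oplus>s\<in>S. c i s \<odot> s)" by metis
    obtain a where a: "\<exists>i\<in>I. a i \<noteq> 0" "\<forall>s\<in>S. (\<Sum>i\<in>I. a i * c i s) = 0"
      using linear_dependence[OF S(1) I] by metis
    have "(\<Oplus>i\<in>J. a i \<odot> x i) = (\<Oplus>s\<in>S. (\<Sum>i\<in>J. a i * c i s) \<odot> s)" if "finite J" "J \<subseteq> I" for J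
      using that
    proof (induction J rule: finite_induct)
      case empty
      have "(\<Oplus>s\<in>S. (\<Sum>i\<in>{}. a i * c i s) \<odot> s) = (\<Oplus>s\<in>S. \<zero>)"
        using S by (intro M.finsum_cong') auto
      then show ?case by (simp add: M.finsum_zero)
    next
      case (insert j J)
      have "a j \<odot> x j = (\<Oplus>s\<in>S. a j \<odot> (c j s \<odot> s))"
        using insert.prems S c[of j]
        by (simp add: finsum_smult_ldistr complex_ring_def Pi_iff subset_iff)
      also have "\<dots> = (\<Oplus>s\<in>S. (a j * c j s) \<odot> s)"
        using S by (intro M.finsum_cong') (auto simp: sm_assoc subset_iff)
      finally have "(\<Oplus>i\<in>insert j J. a i \<odot> x i)
          = (\<Oplus>s\<in>S. (a j * c j s) \<odot> s) \<oplus> (\<Oplus>s\<in>S. (\<Sum>i\<in>J. a i * c i s) \<odot> s)"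
        using insert x S by (subst M.finsum_insert) (auto simp: Pi_iff subset_iff)
      also have "\<dots> = (\<Oplus>s\<in>S. (a j * c j s) \<odot> s \<oplus> (\<Sum>i\<in>J. a i * c i s) \<odot> s)"
        using S by (intro M.finsum_addf[symmetric]) auto
      also have "\<dots> = (\<Oplus>s\<in>S. (\<Sum>i\<in>insert j J. a i * c i s) \<odot> s)"
        using S insert.hyps by (intro M.finsum_cong') (auto simp: sm_add_left subset_iff)
      finally show ?case .
    qed
    then have "(\<Oplus>i\<in>I. a i \<odot> x i) = (\<Oplus>s\<in>S. (\<Sum>i\<in>I. a i * c i s) \<odot> s)" using I by blast
    also have "\<dots> = (\<Oplus>s\<in>S. \<zero>)"
      using S a(2) by (intro M.finsum_cong') auto
    finally show ?thesis using a(1) by (auto simp: M.finsum_zero)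
  qed
  then show ?thesis using that by blast
qed

text \<open>\<open>P p\<close> is \<open>p(h) x0\<close>, evaluated by Horner's scheme on the vector
  \<open>x0\<close>, so no unit of \<open>A\<close> is involved. Finite dimension gives
  \<open>p \<noteq> 0\<close> with \<open>P p = \<zero>\<close>. If \<open>r\<close> is a root of
  \<open>p\<close> and \<open>q\<close> the cofactor, then \<open>P q\<close> is an eigenvector for
  \<open>r\<close>, unless it vanishes and \<open>q\<close> continues the descent. The invariant
  subspace \<open>W\<close> carries side conditions on the eigenvector.\<close>

lemma eigenvector:
  assumes fd: "finite_dimensional A"
    and W: "W \<subseteq> carrier A" "\<zero> \<in> W" "\<And>x y. \<lbrakk>x \<in> W; y \<in> W\<rbrakk> \<Longrightarrow> x \<oplus> y \<in> W" "\<And>c x. x \<in> W \<Longrightarrow> c \<odot> x \<in> W"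
    and h: "h \<in> carrier A" "\<And>x. x \<in> W \<Longrightarrow> h \<otimes> x \<in> W"
    and x0: "x0 \<in> W" "x0 \<noteq> \<zero>"
  obtains x l where "x \<in> W" "x \<noteq> \<zero>" "h \<otimes> x = l \<odot> x"
proof -
  define P :: "complex poly \<Rightarrow> 'a" where "P = (\<lambda>p. fold_coeffs (\<lambda>a y. a \<odot> x0 \<oplus> h \<otimes> y) p \<zero>)"
  have x0A: "x0 \<in> carrier A" using x0 W by blast
  have P0: "P 0 = \<zero>" by (simp add: P_def)
  have PC: "P (pCons a p) = a \<odot> x0 \<oplus> h \<otimes> P p" for a p
  proof (cases "a = 0 \<and> p = 0")
    case True
    then show ?thesis using x0A h by (simp add: P0)
  next
    case False
    then show ?thesis by (cases "p = 0") (auto simp: P_def)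
  qed
  have PW: "P p \<in> W" for p
    by (induction p) (auto simp: P0 PC W h x0)
  then have PA: "P p \<in> carrier A" for p using W(1) by blast
  have Padd: "P (p + q) = P p \<oplus> P q" for p q
    by (induction p q rule: poly_induct2)
       (simp_all add: P0 PC PA x0A h r_distr sm_add_left M.a_ac)
  have Psm: "P (Polynomial.smult c p) = c \<odot> P p" for c p
    by (induction p) (simp_all add: P0 PC PA x0A h sm_add_right sm_assoc smult_m_right)
  have Psum: "P (\<Sum>i\<in>I. f i) = (\<Oplus>i\<in>I. P (f i))" if "finite I" for I and f :: "nat \<Rightarrow> complex poly"
    using that by (induction I rule: finite_induct) (simp_all add: P0 Padd PA)
  have ev: "\<exists>x\<in>W. x \<noteq> \<zero> \<and> (\<exists>l. h \<otimes> x = l \<odot> x)" if "p \<noteq> 0" "P p = \<zero>" for p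
    using that
  proof (induction "degree p" arbitrary: p rule: less_induct)
    case less
    show ?case
    proof (cases "degree p = 0")
      case True
      then obtain a where "p = [:a:]" by (metis degree_eq_zeroE)
      then have a: "a \<noteq> 0" "a \<odot> x0 = \<zero>" using less.prems h x0A by (auto simp: PC P0)
      have "x0 = inverse a \<odot> (a \<odot> x0)" using a(1) x0A by (simp add: sm_assoc[symmetric])
      then show ?thesis using a x0 by simp
    next
      case False
      then have "\<not> constant (poly p)" by (simp add: constant_degree)
      then obtain r where "poly p r = 0" using fundamental_theorem_of_algebra by blast
      then obtain q where q: "p = [:- r, 1:] * q" by (metis dvdE poly_eq_0_iff_dvd)
      have "q \<noteq> 0" using q less.prems(1) by auto
      then have "degree p = degree [:- r, 1:] + degree q"
        unfolding q by (intro degree_mult_eq) auto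
      then have q0: "q \<noteq> 0" "degree q < degree p"
        using \<open>q \<noteq> 0\<close> by auto
      have "p = pCons 0 q + Polynomial.smult (- r) q" using q by simp
      then have "P p = h \<otimes> P q \<oplus> (- r) \<odot> P q"
        using h x0A PA by (simp only: Padd Psm PC) simp
      then have "h \<otimes> P q \<oplus> (-1) \<odot> (r \<odot> P q) = \<zero>"
        using less.prems PA by (simp add: sm_assoc[symmetric])
      then have "h \<otimes> P q = r \<odot> P q" using PA h by - (rule eq_if_diff_zero, auto)
      then show ?thesis using less.hyps[OF q0(2,1)] PW by blast
    qed
  qed
  obtain d where d: "\<And>I (x :: nat \<Rightarrow> 'a). \<lbrakk>finite I; d < card I; x \<in> I \<rightarrow> carrier A\<rbrakk>
    \<Longrightarrow> \<exists>a. (\<exists>i\<in>I. a i \<noteq> 0) \<and> (\<Oplus>i\<in>I. a i \<odot> x i) = \<zero>"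
    using dependent_family[OF fd] by blast
  obtain a i where i: "i \<in> {..d}" "a i \<noteq> 0" and a: "(\<Oplus>i\<in>{..d}. a i \<odot> P (monom 1 i)) = \<zero>"
    using d[of "{..d}" "\<lambda>i. P (monom 1 i)"] PA by auto
  let ?p = "\<Sum>i\<in>{..d}. Polynomial.smult (a i) (monom 1 i)"
  have "coeff ?p i = a i" using i by (simp add: coeff_sum if_distrib[of "\<lambda>z. _ * z"] cong: if_cong)
  then have "?p \<noteq> 0" using i by auto
  moreover have "P ?p = \<zero>" using a PA by (simp only: Psum[OF finite_atMost] Psm)
  ultimately show ?thesis using ev that by blast
qed

section \<open>Largest orthogonal families and minimal projections\<close>

definition orth_family :: "'a set \<Rightarrow> bool" where
  "orth_family E \<longleftrightarrow> finite E \<and> E \<subseteq> carrier A \<and> (\<forall>v\<in>E. adj A v = v \<and> v \<noteq> \<zero>) \<and>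
     (\<forall>v\<in>E. \<forall>w\<in>E. v \<noteq> w \<longrightarrow> v \<otimes> w = \<zero>)"

text \<open>Largest in cardinality and not merely under inclusion, because one member will be
  exchanged for two new ones. Members are arbitrary self-adjoint elements, so that competitors need
  not be projections.\<close>

definition max_orth_family :: "'a set \<Rightarrow> bool" where
  "max_orth_family E \<longleftrightarrow> orth_family E \<and> (\<forall>E'. orth_family E' \<longrightarrow> card E' \<le> card E)"

lemma orth_familyD:
  assumes "orth_family E"
  shows "finite E" "v \<in> E \<Longrightarrow> v \<in> carrier A" "v \<in> E \<Longrightarrow> adj A v = v" "v \<in> E \<Longrightarrow> v \<noteq> \<zero>"
    "\<lbrakk>v \<in> E; w \<in> E; v \<noteq> w\<rbrakk> \<Longrightarrow> v \<otimes> w = \<zero>" "v \<in> E \<Longrightarrow> v \<otimes> v \<noteq> \<zero>"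
  using assms self_adj_sq_eq_zero unfolding orth_family_def by blast+

text \<open>Orthogonal families are linearly independent: multiplying a relation by \<open>v\<close>
  leaves the coefficient of \<open>v\<close> times \<open>v \<otimes> v\<close>, which is nonzero.
  So their size is bounded.\<close>

lemma max_orth_family_exists:
  assumes "finite_dimensional A"
  shows "\<exists>E. max_orth_family E"
proof -
  obtain d where d: "\<And>I (x :: 'a \<Rightarrow> 'a). \<lbrakk>finite I; d < card I; x \<in> I \<rightarrow> carrier A\<rbrakk>
    \<Longrightarrow> \<exists>a. (\<exists>i\<in>I. a i \<noteq> 0) \<and> (\<Oplus>i\<in>I. a i \<odot> x i) = \<zero>"
    using dependent_family[OF assms] by blast
  have "card E \<le> d" if E: "orth_family E" for E
  proof (rule ccontr)
    note D = orth_familyD[OF E]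
    assume "\<not> card E \<le> d"
    then obtain a v where v: "v \<in> E" "a v \<noteq> 0" and a: "(\<Oplus>w\<in>E. a w \<odot> w) = \<zero>"
      using d[of E "\<lambda>w. w"] D by auto
    have "v \<otimes> (\<Oplus>w\<in>E. a w \<odot> w) = (\<Oplus>w\<in>E. v \<otimes> (a w \<odot> w))"
      using D v by (intro mult_finsum) auto
    also have "\<dots> = v \<otimes> (a v \<odot> v)"
      using D v by (intro finsum_single) (auto simp: smult_m_right)
    finally have "a v \<odot> (v \<otimes> v) = \<zero>" using a v D by (simp add: smult_m_right)
    then show False using smult_eq_zero[of "a v" "v \<otimes> v"] v D by simp
  qed
  moreover have "orth_family {}" by (simp add: orth_family_def)
  ultimately show ?thesis
    unfolding max_orth_family_def
    using ex_has_greatest_nat[of orth_family "{}" card "Suc d"] by (auto simp: less_Suc_eq_le)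
qed

lemma adj_comm_zero:
  "\<lbrakk>x \<in> carrier A; y \<in> carrier A; adj A x = x; adj A y = y; x \<otimes> y = \<zero>\<rbrakk> \<Longrightarrow> y \<otimes> x = \<zero>"
  using adj_mult[of x y] adj_zero by simp

lemma max_orth_no_extension:
  assumes E: "max_orth_family E" and z: "z \<in> carrier A" "adj A z = z" "\<And>v. v \<in> E \<Longrightarrow> v \<otimes> z = \<zero>"
  shows "z = \<zero>"
proof (rule ccontr)
  assume z0: "z \<noteq> \<zero>"
  have o: "orth_family E" using E by (simp add: max_orth_family_def)
  note D = orth_familyD[OF o]
  have "z \<notin> E" using z D(6) by blast
  moreover have "orth_family (insert z E)"
    unfolding orth_family_def using D z z0 by (auto intro: adj_comm_zero)
  ultimately show False using E D(1) unfolding max_orth_family_def by fastforce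
qed

text \<open>Exchanging \<open>e\<close> for \<open>h\<close> and \<open>u\<close> would produce a
  larger orthogonal family. This is the form in which minimality is used: with \<open>u\<close>
  built from an eigenvector, any \<open>h\<close> annihilating \<open>u\<close> must vanish.\<close>

lemma max_orth_no_split:
  assumes E: "max_orth_family E" and e: "e \<in> E"
    and h: "h \<in> carrier A" "adj A h = h" "\<And>v. \<lbrakk>v \<in> E; v \<noteq> e\<rbrakk> \<Longrightarrow> v \<otimes> h = \<zero>"
    and u: "u \<in> carrier A" "adj A u = u" "u \<noteq> \<zero>" "\<And>v. \<lbrakk>v \<in> E; v \<noteq> e\<rbrakk> \<Longrightarrow> v \<otimes> u = \<zero>"
    and hu: "h \<otimes> u = \<zero>"
  shows "h = \<zero>"
proof (rule ccontr)
  assume h0: "h \<noteq> \<zero>"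
  have o: "orth_family E" using E by (simp add: max_orth_family_def)
  note D = orth_familyD[OF o]
  have "h \<otimes> h \<noteq> \<zero>" using h h0 self_adj_sq_eq_zero by blast
  then have "h \<noteq> u" using hu by blast
  moreover have "h \<notin> E - {e}" "u \<notin> E - {e}" using h(3) u(4) D(6) by blast+
  ultimately have "card (insert h (insert u (E - {e}))) = Suc (card E)"
    using D(1) e card_gt_0_iff[of E] by auto
  moreover have "orth_family (insert h (insert u (E - {e})))"
    unfolding orth_family_def
    using D h u h0 hu adj_comm_zero[OF _ _ _ _ hu] by (auto intro: adj_comm_zero)
  ultimately show False using E unfolding max_orth_family_def by fastforce
qed

text \<open>
  If \<open>h x = l x\<close> with \<open>x \<noteq> 0\<close> for a self-adjoint \<open>h\<close>, then \<open>u = x x\<^sup>*\<close> is a self-adjoint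
  element with \<open>h u = l u\<close>, and \<open>u h u = l u\<^sup>2\<close> shows that \<open>l\<close> is real.
\<close>

lemma eigenvector_self_adjoint:
  assumes h: "h \<in> carrier A" "adj A h = h" and x: "x \<in> carrier A" "x \<noteq> \<zero>" "h \<otimes> x = l \<odot> x"
  defines "u \<equiv> x \<otimes> adj A x"
  shows "u \<in> carrier A" "adj A u = u" "u \<noteq> \<zero>" "h \<otimes> u = l \<odot> u" "cnj l = l"
proof -
  show u: "u \<in> carrier A" "adj A u = u" using x by (auto simp: u_def adj_mult)
  show u0: "u \<noteq> \<zero>" using x(2) mult_adj_self_eq_zero[OF x(1)] unfolding u_def by blast
  show hu: "h \<otimes> u = l \<odot> u"
    using h x by (simp add: u_def m_assoc[symmetric] smult_m_left)
  have "u \<otimes> h = cnj l \<odot> u"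
    using adj_mult[of h u] h u hu by (simp add: adj_smult)
  then have "cnj l \<odot> (u \<otimes> u) = l \<odot> (u \<otimes> u)"
    using h u hu m_assoc[of u h u] by (simp add: smult_m_left smult_m_right)
  then have "(cnj l - l) \<odot> (u \<otimes> u) = \<zero>"
    using sm_add_left[of "u \<otimes> u" "cnj l" "- l"] sm_add_left[of "u \<otimes> u" l "- l"] u by simp
  moreover have "u \<otimes> u \<noteq> \<zero>" using u u0 self_adj_sq_eq_zero by blast
  ultimately show "cnj l = l" using u smult_eq_zero[of "cnj l - l" "u \<otimes> u"] by simp
qed

text \<open>Take an eigenvector \<open>x\<close> of left multiplication by \<open>e\<close> among
  the elements annihilated by the other members, with eigenvalue \<open>l\<close>. Then
  \<open>e \<otimes> e - l e\<close> annihilates \<open>x \<otimes> adj A x\<close>, so it is zero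
  by \<open>max_orth_no_split\<close>. Hence \<open>e / l\<close> is a projection.\<close>

lemma max_orth_square:
  assumes fd: "finite_dimensional A" and E: "max_orth_family E" and e: "e \<in> E"
  obtains l where "l \<noteq> 0" "cnj l = l" "e \<otimes> e = l \<odot> e"
proof -
  have o: "orth_family E" using E by (simp add: max_orth_family_def)
  note D = orth_familyD[OF o]
  let ?W = "{x \<in> carrier A. \<forall>v\<in>E. v \<noteq> e \<longrightarrow> v \<otimes> x = \<zero>}"
  have eA: "e \<in> carrier A" "adj A e = e" using D e by auto
  have mW: "e \<otimes> x \<in> ?W" if "x \<in> ?W" for x
    using that eA D(2,5) e by (auto simp: m_assoc[symmetric])
  obtain x l where x: "x \<in> ?W" "x \<noteq> \<zero>" "e \<otimes> x = l \<odot> x"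
    by (rule eigenvector[OF fd, of ?W e e]) (use D e mW in \<open>auto simp: r_distr smult_m_right\<close>)
  let ?u = "x \<otimes> adj A x"
  note u = eigenvector_self_adjoint[OF eA, of x l]
  have xA: "x \<in> carrier A" using x by simp
  have uu: "?u \<in> carrier A" "adj A ?u = ?u" "?u \<noteq> \<zero>" "e \<otimes> ?u = l \<odot> ?u" "cnj l = l"
    using u[OF xA x(2,3)] by auto
  let ?h = "e \<otimes> e \<oplus> (-1) \<odot> (l \<odot> e)"
  have "?h = \<zero>"
  proof (rule max_orth_no_split[OF E e])
    show "?h \<in> carrier A" using eA by simp
    show "adj A ?h = ?h" using eA uu(5) by (simp add: adj_add adj_smult adj_mult)
    show "v \<otimes> ?h = \<zero>" if "v \<in> E" "v \<noteq> e" for v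
      using that D(2,5) e eA by (simp add: r_distr smult_m_right m_assoc[symmetric])
    show "v \<otimes> ?u = \<zero>" if "v \<in> E" "v \<noteq> e" for v
      using that D(2) x by (simp add: m_assoc[symmetric])
    have "?h \<otimes> ?u = e \<otimes> (e \<otimes> ?u) \<oplus> (-1) \<odot> (l \<odot> (e \<otimes> ?u))"
      using eA uu(1) by (simp add: l_distr smult_m_left m_assoc)
    also have "\<dots> = l \<odot> (l \<odot> ?u) \<oplus> (-1) \<odot> (l \<odot> (l \<odot> ?u))"
      using eA uu(1,4) by (simp add: smult_m_right)
    also have "\<dots> = \<zero>"
      using sm_add_left[of "l \<odot> (l \<odot> ?u)" 1 "-1"] uu(1) by simp
    finally show "?h \<otimes> ?u = \<zero>" .
  qed (use uu in auto)
  then have ee: "e \<otimes> e = l \<odot> e" using eA by - (rule eq_if_diff_zero, auto)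
  moreover have "l \<noteq> 0" using ee D(6)[OF e] eA by auto
  ultimately show ?thesis using that uu(5) by blast
qed

lemma max_orth_projections:
  assumes fd: "finite_dimensional A"
  obtains P where "max_orth_family P" "\<And>p. p \<in> P \<Longrightarrow> p \<otimes> p = p"
proof -
  obtain E where E: "max_orth_family E" using max_orth_family_exists[OF fd] by blast
  have o: "orth_family E" using E by (simp add: max_orth_family_def)
  note D = orth_familyD[OF o]
  have "\<exists>l. e \<in> E \<longrightarrow> l \<noteq> 0 \<and> cnj l = l \<and> e \<otimes> e = l \<odot> e" for e
    using max_orth_square[OF fd E, of e] by metis
  then obtain l where l: "\<And>e. e \<in> E \<Longrightarrow> l e \<noteq> 0" "\<And>e. e \<in> E \<Longrightarrow> cnj (l e) = l e"
    "\<And>e. e \<in> E \<Longrightarrow> e \<otimes> e = l e \<odot> e"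
    by metis
  define p where "p e = inverse (l e) \<odot> e" for e
  have pA: "p e \<in> carrier A" "adj A (p e) = p e" if "e \<in> E" for e
    using that D l(2)[OF that] by (auto simp: p_def adj_smult)
  have pp: "p e \<otimes> p e = p e" if "e \<in> E" for e
    using that D(2) l by (simp add: p_def smult_m_left smult_m_right sm_assoc[symmetric])
  have p0: "p e \<noteq> \<zero>" if "e \<in> E" for e
    using smult_eq_zero[of "inverse (l e)" e] that l(1) D by (auto simp: p_def)
  have pq: "p e \<otimes> p f = \<zero>" if "e \<in> E" "f \<in> E" "e \<noteq> f" for e f
    using that D by (simp add: p_def smult_m_left smult_m_right)
  have inj: "inj_on p E" using pp p0 pq by (metis inj_onI)
  have "orth_family (p ` E)"
    unfolding orth_family_def using D(1) pA p0 by (auto intro: pq)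
  then have "max_orth_family (p ` E)"
    using E unfolding max_orth_family_def by (simp add: card_image[OF inj])
  then show ?thesis using that pp by blast
qed

text \<open>If \<open>h\<close> is self-adjoint with \<open>p \<otimes> h = h\<close> and
  \<open>l\<close> is an eigenvalue of \<open>h\<close> on the right ideal of \<open>p\<close>, then
  \<open>h - l p\<close> annihilates an element that could split \<open>p\<close>, so
  \<open>h = l p\<close>. A general corner element is a combination of its real and imaginary parts.
  That the projections add up to a unit is maximality once more.\<close>

lemma minimal_projections:
  assumes fd: "finite_dimensional A"
  obtains P where "orth_family P" "\<And>p. p \<in> P \<Longrightarrow> p \<otimes> p = p"
    "\<And>p a. \<lbrakk>p \<in> P; a \<in> carrier A\<rbrakk> \<Longrightarrow> \<exists>c. p \<otimes> a \<otimes> p = c \<odot> p"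
    "\<And>a. a \<in> carrier A \<Longrightarrow> (\<Oplus>p\<in>P. p) \<otimes> a = a" "\<And>a. a \<in> carrier A \<Longrightarrow> a \<otimes> (\<Oplus>p\<in>P. p) = a"
proof -
  obtain P where P: "max_orth_family P" and pp: "\<And>p. p \<in> P \<Longrightarrow> p \<otimes> p = p"
    using max_orth_projections[OF fd] by blast
  have o: "orth_family P" using P by (simp add: max_orth_family_def)
  note D = orth_familyD[OF o]
  have sa: "\<exists>c. h = c \<odot> p" if p: "p \<in> P" and h: "h \<in> carrier A" "adj A h = h" "p \<otimes> h = h" for p h
  proof -
    let ?W = "{x \<in> carrier A. p \<otimes> x = x}"
    have pA: "p \<in> carrier A" "adj A p = p" using D p by auto
    have hp: "h \<otimes> p = h" using adj_mult[of p h] h pA by simp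
    have mW: "h \<otimes> x \<in> ?W" if "x \<in> ?W" for x
      using that pA h by (simp add: m_assoc[symmetric])
    obtain x l where x: "x \<in> ?W" "x \<noteq> \<zero>" "h \<otimes> x = l \<odot> x"
      by (rule eigenvector[OF fd, of ?W h p])
         (use D p mW h pp in \<open>auto simp: r_distr smult_m_right\<close>)
    let ?u = "x \<otimes> adj A x"
    have xA: "x \<in> carrier A" using x by simp
    have uu: "?u \<in> carrier A" "adj A ?u = ?u" "?u \<noteq> \<zero>" "h \<otimes> ?u = l \<odot> ?u" "cnj l = l"
      using eigenvector_self_adjoint[OF h(1,2) xA x(2,3)] by auto
    have pu: "p \<otimes> ?u = ?u" using x pA by (simp add: m_assoc[symmetric])
    have ph: "v \<otimes> y = \<zero>" if "v \<in> P" "v \<noteq> p" "p \<otimes> y = y" "y \<in> carrier A" for v y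
    proof -
      have "v \<otimes> y = v \<otimes> p \<otimes> y" using that pA D(2) by (simp add: m_assoc)
      then show ?thesis using D(5)[OF that(1) p that(2)] that by simp
    qed
    let ?k = "h \<oplus> (-1) \<odot> (l \<odot> p)"
    have "?k = \<zero>"
    proof (rule max_orth_no_split[OF P p])
      show "?k \<in> carrier A" using h pA by simp
      show "adj A ?k = ?k" using h pA uu(5) by (simp add: adj_add adj_smult)
      show "v \<otimes> ?k = \<zero>" if "v \<in> P" "v \<noteq> p" for v
        using that h pA pp p by (intro ph) (auto simp: r_distr smult_m_right)
      show "v \<otimes> ?u = \<zero>" if "v \<in> P" "v \<noteq> p" for v
        using that uu(1) pu by (intro ph)
      have "?k \<otimes> ?u = l \<odot> ?u \<oplus> (-1) \<odot> (l \<odot> ?u)"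
        using h pA uu(1) by (simp add: l_distr smult_m_left pu uu(4))
      also have "\<dots> = \<zero>" using sm_add_left[of "l \<odot> ?u" 1 "-1"] uu(1) by simp
      finally show "?k \<otimes> ?u = \<zero>" .
    qed (use uu in auto)
    then have "h = l \<odot> p" using h pA by - (rule eq_if_diff_zero, auto)
    then show ?thesis by blast
  qed
  have corner: "\<exists>c. p \<otimes> a \<otimes> p = c \<odot> p" if p: "p \<in> P" and a: "a \<in> carrier A" for p a
  proof -
    have pA: "p \<in> carrier A" "adj A p = p" using D p by auto
    let ?b = "p \<otimes> a \<otimes> p"
    have b: "?b \<in> carrier A" "p \<otimes> ?b = ?b" "p \<otimes> adj A ?b = adj A ?b"
      using a pA pp p by (simp_all add: m_assoc[symmetric] adj_mult)
    let ?h = "(1/2) \<odot> (?b \<oplus> adj A ?b)" and ?k = "(- \<i>/2) \<odot> (?b \<oplus> (-1) \<odot> adj A ?b)"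
    obtain c where c: "?h = c \<odot> p"
      using sa[OF p, of ?h] b pA by (auto simp: adj_smult adj_add r_distr smult_m_right M.a_comm)
    have "adj A ?k = ?k"
    proof -
      have "adj A ?k = (\<i>/2) \<odot> (adj A ?b \<oplus> (-1) \<odot> ?b)"
        using b by (simp add: adj_smult adj_add)
      also have "\<dots> = (-\<i>/2) \<odot> ((-1) \<odot> (adj A ?b \<oplus> (-1) \<odot> ?b))"
        using b by (simp add: sm_assoc[symmetric])
      also have "(-1) \<odot> (adj A ?b \<oplus> (-1) \<odot> ?b) = ?b \<oplus> (-1) \<odot> adj A ?b"
        using b by (simp add: sm_add_right sm_assoc[symmetric] M.a_comm)
      finally show ?thesis .
    qed
    then obtain d where d: "?k = d \<odot> p"
      using sa[OF p, of ?k] b pA by (auto simp: r_distr smult_m_right)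
    have "?h \<oplus> \<i> \<odot> ?k = ?b"
    proof -
      have "\<i> \<odot> ?k = (1/2) \<odot> (?b \<oplus> (-1) \<odot> adj A ?b)"
        using b by (simp add: sm_assoc[symmetric])
      then have "?h \<oplus> \<i> \<odot> ?k = ((1/2) \<odot> ?b \<oplus> (1/2) \<odot> ?b) \<oplus> ((1/2) \<odot> adj A ?b \<oplus> (-1/2) \<odot> adj A ?b)"
        using b by (simp add: sm_add_right sm_assoc[symmetric] M.a_ac)
      also have "\<dots> = ?b"
        using b sm_add_left[of ?b "1/2" "1/2"] sm_add_left[of "adj A ?b" "1/2" "-1/2"] by simp
      finally show ?thesis .
    qed
    then have "?b = (c + \<i> * d) \<odot> p"
      unfolding c d using pA by (simp add: sm_add_left sm_assoc)
    then show ?thesis by blast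
  qed
  let ?u = "\<Oplus>p\<in>P. p"
  have uA: "?u \<in> carrier A" using D by (intro M.finsum_closed) auto
  have vu: "v \<otimes> ?u = v" if "v \<in> P" for v
  proof -
    have "v \<otimes> ?u = (\<Oplus>p\<in>P. v \<otimes> p)" using D that by (intro mult_finsum) auto
    also have "\<dots> = v \<otimes> v" using D that by (intro finsum_single) auto
    finally show ?thesis using pp that by simp
  qed
  have ua: "?u \<otimes> a = a" if a: "a \<in> carrier A" for a
  proof -
    let ?z = "a \<oplus> (-1) \<odot> (?u \<otimes> a)"
    have z: "?z \<in> carrier A" using a uA by simp
    have vz: "v \<otimes> ?z = \<zero>" if v: "v \<in> P" for v
    proof -
      have "v \<otimes> ?z = v \<otimes> a \<oplus> (-1) \<odot> (v \<otimes> ?u \<otimes> a)"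
        using D(2)[OF v] a uA by (simp add: r_distr smult_m_right m_assoc)
      also have "\<dots> = \<zero>"
        using vu[OF v] sm_add_left[of "v \<otimes> a" 1 "-1"] D(2)[OF v] a by simp
      finally show ?thesis .
    qed
    \<comment> \<open>\<open>?z\<close> is orthogonal to the family but need not be self-adjoint;
      its product with its adjoint is both.\<close>
    have "?z \<otimes> adj A ?z = \<zero>"
      using P
    proof (rule max_orth_no_extension)
      show "v \<otimes> (?z \<otimes> adj A ?z) = \<zero>" if "v \<in> P" for v
        using m_assoc[OF D(2)[OF that] z adj_closed[OF z]] vz[OF that] z by (metis adj_closed mult_zero(2))
    qed (use z in \<open>simp_all only: m_closed adj_closed adj_mult adj_adj\<close>)
    then have "?z = \<zero>" using z mult_adj_self_eq_zero by blast
    then show ?thesis using a uA by (metis eq_if_diff_zero m_closed)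
  qed
  have "adj A ?u = ?u"
  proof -
    have "adj A ?u = (\<Oplus>p\<in>P. adj A p)" using D by (intro adj_finsum) auto
    also have "\<dots> = ?u" using D by (intro M.finsum_cong') auto
    finally show ?thesis .
  qed
  then have "a \<otimes> ?u = a" if "a \<in> carrier A" for a
    using ua[of "adj A a"] adj_mult[of ?u "adj A a"] that uA by simp
  then show ?thesis using that[OF o pp corner ua] by blast
qed

end

subsection \<open>From nuclear approximations to coloured systems\<close>

lemma positive_elements_C0_iff:
  "f \<in> positive_elements (C0 X) \<longleftrightarrow> f \<in> C0_functions X \<and> (\<forall>x. f x \<in> \<real>\<^sub>\<ge>\<^sub>0)"
proof
  assume "f \<in> positive_elements (C0 X)"
  then show "f \<in> C0_functions X \<and> (\<forall>x. f x \<in> \<real>\<^sub>\<ge>\<^sub>0)"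
    by (auto simp: positive_elements_def C0_sel cnj_mult_self_nonneg intro: C0_mult C0_cnj)
next
  assume f: "f \<in> C0_functions X \<and> (\<forall>x. f x \<in> \<real>\<^sub>\<ge>\<^sub>0)"
  define s where "s x = complex_of_real (sqrt (cmod (f x)))" for x
  have "f x = cnj (s x) * s x" for x
  proof -
    obtain r where "f x = of_real r" "0 \<le> r" using f by (auto elim: nonneg_Reals_cases)
    then show ?thesis by (simp add: s_def flip: of_real_mult)
  qed
  then have fs: "f = (\<lambda>x. cnj (s x) * s x)" by blast
  have "s \<in> C0_functions X"
  proof (rule C0_functions_if_bounded)
    show "continuous_map X euclidean s"
      unfolding s_def using f
      by (intro continuous_map_complex_compose[of X f "\<lambda>z. of_real (sqrt (cmod z))"])
         (auto simp: C0_functions_def intro!: continuous_intros)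
    show "s x = 0" if "x \<notin> topspace X" for x using f that by (simp add: s_def C0_functions_def)
    fix e :: real assume e: "e > 0"
    have "e\<^sup>2 \<le> cmod (f x)" if "e \<le> cmod (s x)" for x
      using power_mono[OF that less_imp_le[OF e], of 2] by (simp add: s_def)
    then show "\<exists>K. compactin X K \<and> (\<forall>x. e \<le> cmod (s x) \<longrightarrow> x \<in> K)"
      using C0_compact[OF conjunct1[OF f] zero_less_power[OF e], of 2] by blast
  qed
  then show "f \<in> positive_elements (C0 X)"
    unfolding positive_elements_def using fs by (intro CollectI exI[of _ s]) (simp add: C0_sel)
qed

text \<open>\<open>cp_map\<close> speaks of matrices only; matrices of size 1 give back the
  positivity of the map itself.\<close>

lemma positive_matrix_one_iff:
  fixes A (structure)
  assumes "star_algebra A"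
  shows "(\<lambda>i\<in>{..<1}. \<lambda>j\<in>{..<1}. a) \<in> positive_elements (matrix_algebra 1 A) \<longleftrightarrow> a \<in> positive_elements A"
proof -
  interpret star_algebra A by (rule assms)
  have one: "{..<1::nat} = {0}" by auto
  have prod: "adj (matrix_algebra 1 A) y \<otimes>\<^bsub>matrix_algebra 1 A\<^esub> y
      = (\<lambda>i\<in>{..<1}. \<lambda>j\<in>{..<1}. adj A (y 0 0) \<otimes> y 0 0)"
    if "y 0 0 \<in> carrier A" for y
    unfolding matrix_algebra_def one using that
    by (auto simp: fun_eq_iff restrict_def adj_closed m_closed)
  show ?thesis
  proof
    assume "(\<lambda>i\<in>{..<1}. \<lambda>j\<in>{..<1}. a) \<in> positive_elements (matrix_algebra 1 A)"
    then obtain y where y: "y \<in> carrier (matrix_algebra 1 A)"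
      and eq: "(\<lambda>i\<in>{..<1}. \<lambda>j\<in>{..<1}. a) = adj (matrix_algebra 1 A) y \<otimes>\<^bsub>matrix_algebra 1 A\<^esub> y"
      unfolding positive_elements_def by blast
    have y0: "y 0 0 \<in> carrier A" using y by (auto simp: matrix_algebra_sel PiE_iff)
    have "a = adj A (y 0 0) \<otimes> y 0 0"
      using fun_cong[OF fun_cong[OF eq[unfolded prod[of y, OF y0]], of 0], of 0] by simp
    then show "a \<in> positive_elements A" unfolding positive_elements_def using y0 by blast
  next
    assume "a \<in> positive_elements A"
    then obtain y where y: "y \<in> carrier A" "a = adj A y \<otimes> y" unfolding positive_elements_def by blast
    let ?y = "\<lambda>i\<in>{..<1::nat}. \<lambda>j\<in>{..<1::nat}. y"
    have "?y \<in> carrier (matrix_algebra 1 A)" using y by (auto simp: matrix_algebra_sel)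
    moreover have "(\<lambda>i\<in>{..<1}. \<lambda>j\<in>{..<1}. a) = adj (matrix_algebra 1 A) ?y \<otimes>\<^bsub>matrix_algebra 1 A\<^esub> ?y"
      using prod[of ?y] y by simp
    ultimately show "(\<lambda>i\<in>{..<1}. \<lambda>j\<in>{..<1}. a) \<in> positive_elements (matrix_algebra 1 A)"
      unfolding positive_elements_def by blast
  qed
qed

lemma cp_map_positive:
  assumes "star_algebra A" "star_algebra B" "cp_map A B f" "a \<in> positive_elements A"
  shows "f a \<in> positive_elements B"
proof -
  have "amplification 1 f (\<lambda>i\<in>{..<1}. \<lambda>j\<in>{..<1}. a) \<in> positive_elements (matrix_algebra 1 B)"
    using assms(3,4) positive_matrix_one_iff[OF assms(1), of a] unfolding cp_map_def by blast
  moreover have "amplification 1 f (\<lambda>i\<in>{..<1}. \<lambda>j\<in>{..<1}. a) = (\<lambda>i\<in>{..<1}. \<lambda>j\<in>{..<1}. f a)"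
    by (auto simp: amplification_def fun_eq_iff restrict_def)
  ultimately show ?thesis using positive_matrix_one_iff[OF assms(2), of "f a"] by simp
qed

text \<open>The form sending \<open>y\<close> and \<open>z\<close> to the value at \<open>x\<close>
  of \<open>\<phi> (adj F y \<otimes> z)\<close> is positive semidefinite.\<close>

lemma positive_map_cauchy_schwarz:
  fixes F (structure)
  assumes F: "cstar_algebra F" and \<phi>: "cp_map F (C0 X) \<phi>"
    and y: "y \<in> carrier F" and z: "z \<in> carrier F"
  shows "(cmod (\<phi> (adj F y \<otimes> z) x))\<^sup>2 \<le> Re (\<phi> (adj F y \<otimes> y) x) * Re (\<phi> (adj F z \<otimes> z) x)"
proof -
  interpret F: cstar_algebra F by (rule F)
  have st: "star_algebra F" "star_algebra (C0 X)"
    using F cstar_algebra_C0[of X] by (simp_all add: cstar_algebra_def)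
  define B where "B u v = \<phi> (adj F u \<otimes> v) x" for u v
  have pos: "B u u \<in> \<real>\<^sub>\<ge>\<^sub>0" if "u \<in> carrier F" for u
    using cp_map_positive[OF st \<phi>, of "adj F u \<otimes> u"] that
    unfolding positive_elements_C0_iff by (auto simp: B_def positive_elements_def)
  have add: "\<phi> (u \<oplus> v) x = \<phi> u x + \<phi> v x" and sm: "\<phi> (c \<odot> u) x = c * \<phi> u x"
    if "u \<in> carrier F" "v \<in> carrier F" for u v c
    using \<phi> that by (auto simp: cp_map_def linear_map_def C0_sel)
  have exp: "B (y \<oplus> t \<odot> z) (y \<oplus> t \<odot> z)
      = B y y + t * B y z + cnj t * B z y + of_real ((cmod t)\<^sup>2) * B z z" for t
  proof -
    have n: "of_real ((cmod t)\<^sup>2) = cnj t * t"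
      by (simp only: complex_norm_square mult.commute)
    show ?thesis
      unfolding B_def n using y z
      by (simp add: F.adj_add F.adj_smult F.l_distr F.r_distr F.smult_m_left F.smult_m_right add sm
          algebra_simps)
  qed
  have "B y y + t * B y z + cnj t * B z y + of_real ((cmod t)\<^sup>2) * B z z \<in> \<real>\<^sub>\<ge>\<^sub>0" for t
    using pos[of "y \<oplus> t \<odot> z"] y z unfolding exp by simp
  then have "(cmod (B y z))\<^sup>2 \<le> Re (B y y) * Re (B z z)"
    using pos[OF z] by (rule sesquilinear_cauchy_schwarz)
  then show ?thesis by (simp add: B_def)
qed

text \<open>Placing \<open>z\<close> in component \<open>i\<close> or in component \<open>j\<close>
  gives two decompositions of \<open>z\<close>, which uniqueness identifies.\<close>

lemma ideal_decomposition_disjoint: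
  fixes F (structure)
  assumes F: "cstar_algebra F" and dec: "ideal_decomposition n I F"
    and ij: "i \<le> n" "j \<le> n" "i \<noteq> j" and z: "z \<in> I i" "z \<in> I j"
  shows "z = \<zero>"
proof -
  interpret F: cstar_algebra F by (rule F)
  have id: "\<And>i. i \<le> n \<Longrightarrow> two_sided_ideal (I i) F"
    and ex1: "\<And>x. x \<in> carrier F \<Longrightarrow> \<exists>!y. y \<in> (\<Pi>\<^sub>E i\<in>{..n}. I i) \<and> x = (\<Oplus>i\<in>{..n}. y i)"
    using dec unfolding ideal_decomposition_def by blast+
  have zF: "z \<in> carrier F" using z id ij unfolding two_sided_ideal_def by blast
  have I0: "\<zero> \<in> I k" if "k \<le> n" for k using id[OF that] unfolding two_sided_ideal_def by blast
  define e where "e k = (\<lambda>l\<in>{..n}. if l = k then z else \<zero>)" for k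
  have "e k \<in> (\<Pi>\<^sub>E i\<in>{..n}. I i) \<and> z = (\<Oplus>i\<in>{..n}. e k i)" if "k \<le> n" "z \<in> I k" for k
  proof
    show "e k \<in> (\<Pi>\<^sub>E i\<in>{..n}. I i)" using that I0 by (auto simp: e_def)
    have "(\<Oplus>i\<in>{..n}. e k i) = e k k"
      using that zF by (intro F.finsum_single) (auto simp: e_def)
    then show "z = (\<Oplus>i\<in>{..n}. e k i)" using that by (simp add: e_def)
  qed
  then have "e i = e j" using ex1[OF zF] ij z by blast
  then have "e i i = e j i" by simp
  then show ?thesis using ij by (simp add: e_def)
qed

text \<open>
  Every positive functional \<open>a \<mapsto> \<phi>(a)(x)\<close> of order zero lives on a single minimal projection,
  so on \<open>F\<close> the map \<open>\<phi>\<close> only sees the compressions \<open>p a p = \<kappa>\<^sub>p(a) p\<close> to the minimal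
  projections \<open>p\<close>: the off-diagonal parts \<open>p a q\<close> are killed by Cauchy--Schwarz if \<open>p\<close>, \<open>q\<close> lie
  in the same ideal, and vanish otherwise.
\<close>

lemma nuclear_approximant_coloured:
  fixes F :: "'b cstar_algebra" (structure)
  assumes app: "nuclear_approximant n (C0 X) F \<psi> \<phi>"
  obtains K :: "'b set" and c g \<mu> where "coloured_system X n K c g \<mu>"
    and "\<And>f x. f \<in> C0_functions X \<Longrightarrow> \<phi> (\<psi> f) x = (\<Sum>k\<in>K. \<mu> k f * g k x)"
proof -
  obtain I where F: "cstar_algebra F" and fd: "finite_dimensional F"
    and \<psi>: "cp_map (C0 X) F \<psi>" "contractive (C0 X) F \<psi>" and \<phi>: "cp_map F (C0 X) \<phi>"
    and dec: "ideal_decomposition n I F"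
    and Ii: "\<And>i. i \<le> n \<Longrightarrow> contractive (F\<lparr>carrier := I i\<rparr>) (C0 X) \<phi> \<and> order_zero (F\<lparr>carrier := I i\<rparr>) (C0 X) \<phi>"
    using app unfolding nuclear_approximant_def Let_def by blast
  interpret F: cstar_algebra F by (rule F)
  have st: "star_algebra F" "star_algebra (C0 X)"
    using F cstar_algebra_C0[of X] by (simp_all add: cstar_algebra_def)
  have id: "two_sided_ideal (I i) F" if "i \<le> n" for i
    using dec that unfolding ideal_decomposition_def by blast
  obtain P where o: "F.orth_family P" and pp: "\<And>p. p \<in> P \<Longrightarrow> p \<otimes> p = p"
    and corner: "\<And>p a. \<lbrakk>p \<in> P; a \<in> carrier F\<rbrakk> \<Longrightarrow> \<exists>c. p \<otimes> a \<otimes> p = c \<odot> p"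
    and ua: "\<And>a. a \<in> carrier F \<Longrightarrow> (\<Oplus>p\<in>P. p) \<otimes> a = a"
    and au: "\<And>a. a \<in> carrier F \<Longrightarrow> a \<otimes> (\<Oplus>p\<in>P. p) = a"
    using F.minimal_projections[OF fd] by blast
  note D = F.orth_familyD[OF o]
  have \<phi>C: "\<phi> a \<in> C0_functions X" if "a \<in> carrier F" for a
    using \<phi> that by (auto simp: cp_map_def linear_map_def C0_sel)
  have \<phi>add: "\<phi> (u \<oplus> v) = (\<lambda>x. \<phi> u x + \<phi> v x)" and \<phi>sm: "\<phi> (c \<odot> u) = (\<lambda>x. c * \<phi> u x)"
    if "u \<in> carrier F" "v \<in> carrier F" for u v c
    using \<phi> that by (auto simp: cp_map_def linear_map_def C0_sel)
  have \<phi>0: "\<phi> \<zero> = (\<lambda>x. 0)" using \<phi>sm[of "\<zero>" "\<zero>" 0] by simp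
  have \<phi>sum: "\<phi> (\<Oplus>p\<in>P. f p) = (\<lambda>x. \<Sum>p\<in>P. \<phi> (f p) x)" if "f \<in> P \<rightarrow> carrier F" for f
  proof -
    have "\<phi> (\<Oplus>p\<in>P. f p) = (\<Oplus>\<^bsub>C0 X\<^esub>p\<in>P. \<phi> (f p))"
      using that \<phi>C \<phi>add D(1) \<phi>0
      by (intro finsum_additive[OF F.M.abelian_monoid_axioms abelian_monoid_C0]) (auto simp: C0_sel)
    also have "\<dots> = (\<lambda>x. \<Sum>p\<in>P. \<phi> (f p) x)" using that \<phi>C D(1) by (intro finsum_C0) auto
    finally show ?thesis .
  qed
  have \<psi>F: "\<psi> f \<in> carrier F" if "f \<in> C0_functions X" for f
    using \<psi>(1) that by (auto simp: cp_map_def linear_map_def C0_sel)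
  have \<phi>pos: "\<phi> (adj F y \<otimes> y) x \<in> \<real>\<^sub>\<ge>\<^sub>0" if "y \<in> carrier F" for y x
    using cp_map_positive[OF st \<phi>, of "adj F y \<otimes> y"] that
    unfolding positive_elements_C0_iff by (auto simp: positive_elements_def)
  have pos_p: "\<phi> p x \<in> \<real>\<^sub>\<ge>\<^sub>0" if "p \<in> P" for p x
    using \<phi>pos[of p x] D(2,3)[OF that] pp[OF that] by simp
  have norm_p: "cnorm F p = 1" if "p \<in> P" for p
  proof -
    have "cnorm F p = (cnorm F p)\<^sup>2" using F.cstar_identity[of p] D(2,3)[OF that] pp[OF that] by simp
    moreover have "cnorm F p \<noteq> 0" using F.cnorm_eq_0[of p] D(2,4)[OF that] by simp
    ultimately show ?thesis by (simp add: power2_eq_square)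
  qed
  define \<kappa> where "\<kappa> p a = (SOME c. p \<otimes> a \<otimes> p = c \<odot> p)" for p a
  have \<kappa>: "p \<otimes> a \<otimes> p = \<kappa> p a \<odot> p" if "p \<in> P" "a \<in> carrier F" for p a
    unfolding \<kappa>_def using corner[OF that] by (rule someI_ex)
  have \<kappa>_unique: "\<kappa> p a = c" if "p \<in> P" "a \<in> carrier F" "p \<otimes> a \<otimes> p = c \<odot> p" for p a c
  proof -
    have "(\<kappa> p a - c) \<odot> p = \<zero>"
      using F.sm_add_left[of p "\<kappa> p a" "- c"] F.sm_add_left[of p c "- c"] \<kappa>[OF that(1,2)] that D by simp
    then show ?thesis using F.smult_eq_zero[of "\<kappa> p a - c" p] D that by simp
  qed
  have \<kappa>_add: "\<kappa> p (a \<oplus> b) = \<kappa> p a + \<kappa> p b" if "p \<in> P" "a \<in> carrier F" "b \<in> carrier F" for p a b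
    using that D(2) \<kappa> by (intro \<kappa>_unique) (auto simp: F.l_distr F.r_distr F.sm_add_left)
  have \<kappa>_sm: "\<kappa> p (c \<odot> a) = c * \<kappa> p a" if "p \<in> P" "a \<in> carrier F" for p a c
    using that D(2) \<kappa> by (intro \<kappa>_unique) (auto simp: F.smult_m_left F.smult_m_right F.sm_assoc)
  have \<kappa>_norm: "cmod (\<kappa> p a) \<le> cnorm F a" if p: "p \<in> P" and a: "a \<in> carrier F" for p a
  proof -
    have "cmod (\<kappa> p a) = cnorm F (p \<otimes> a \<otimes> p)"
      using \<kappa>[OF that] F.cnorm_smult[of p] D(2)[OF p] norm_p[OF p] by simp
    also have "\<dots> \<le> cnorm F (p \<otimes> a) * 1"
      using F.cnorm_mult[of "p \<otimes> a" p] D(2)[OF p] norm_p[OF p] a by simp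
    also have "\<dots> \<le> cnorm F a"
      using F.cnorm_mult[of p a] D(2)[OF p] norm_p[OF p] a by simp
    finally show ?thesis .
  qed
  \<comment> \<open>Write \<open>p\<close> as the sum of its components \<open>y i\<close>. Each
    \<open>p \<otimes> y i \<otimes> p\<close> is a multiple of \<open>p\<close> in
    \<open>I i\<close>; their sum is \<open>p\<close>, so one multiple is nonzero and puts
    \<open>p\<close> into that ideal.\<close>
  have "\<exists>i. i \<le> n \<and> p \<in> I i" if p: "p \<in> P" for p
  proof -
    have pF: "p \<in> carrier F" using D p by blast
    obtain y where y: "y \<in> (\<Pi>\<^sub>E i\<in>{..n}. I i)" "p = (\<Oplus>i\<in>{..n}. y i)"
      using dec pF unfolding ideal_decomposition_def by blast
    have yF: "y i \<in> carrier F" if "i \<le> n" for i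
      using y that id[OF that] by (auto simp: two_sided_ideal_def PiE_iff)
    have "p = p \<otimes> p \<otimes> p" using pp p by simp
    also have "\<dots> = (\<Oplus>i\<in>{..n}. p \<otimes> y i) \<otimes> p"
      using yF pF by (subst (2) y(2)) (simp add: F.mult_finsum Pi_iff)
    also have "\<dots> = (\<Oplus>i\<in>{..n}. p \<otimes> y i \<otimes> p)"
      using yF pF by (simp add: F.mult_finsum Pi_iff)
    finally have sum: "p = (\<Oplus>i\<in>{..n}. p \<otimes> y i \<otimes> p)" .
    have "\<exists>i\<le>n. \<kappa> p (y i) \<noteq> 0"
    proof (rule ccontr)
      assume "\<not> ?thesis"
      then have "(\<Oplus>i\<in>{..n}. p \<otimes> y i \<otimes> p) = (\<Oplus>i\<in>{..n}. \<zero>)"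
        using \<kappa>[OF p] yF pF by (intro F.M.finsum_cong') auto
      then show False using sum D(4)[OF p] by (simp add: F.M.finsum_zero)
    qed
    then obtain i where i: "i \<le> n" "\<kappa> p (y i) \<noteq> 0" by blast
    have "y i \<in> I i" using y i by (auto simp: PiE_iff)
    then have "p \<otimes> y i \<otimes> p \<in> I i" using id[OF i(1)] pF by (auto simp: two_sided_ideal_def)
    then have "inverse (\<kappa> p (y i)) \<odot> (\<kappa> p (y i) \<odot> p) \<in> I i"
      using \<kappa>[OF p yF[OF i(1)]] id[OF i(1)] by (auto simp: two_sided_ideal_def)
    then have "p \<in> I i" using i(2) pF by (simp add: F.sm_assoc[symmetric])
    then show ?thesis using i by blast
  qed
  then obtain c where c: "\<And>p. p \<in> P \<Longrightarrow> c p \<le> n" "\<And>p. p \<in> P \<Longrightarrow> p \<in> I (c p)" by metis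
  have pI: "p \<in> positive_elements (F\<lparr>carrier := I (c p)\<rparr>)" if "p \<in> P" for p
    using c(2)[OF that] D(3)[OF that] pp[OF that]
    by (auto simp: positive_elements_def intro!: exI[of _ p])
  have disj: "\<phi> p x * \<phi> q x = 0" if "p \<in> P" "q \<in> P" "p \<noteq> q" "c p = c q" for p q x
  proof -
    have "\<phi> p \<otimes>\<^bsub>C0 X\<^esub> \<phi> q = \<zero>\<^bsub>C0 X\<^esub>"
      using Ii[OF c(1)[OF that(1)]] pI[OF that(1)] pI[OF that(2)] D(5)[OF that(1-3)] that(4)
      unfolding order_zero_def by simp
    then show ?thesis by (simp add: C0_sel fun_eq_iff)
  qed
  \<comment> \<open>At \<open>x\<close> one of \<open>\<phi> p\<close> and \<open>\<phi> q\<close>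
    vanishes if the colours agree. The factorisation \<open>p (a q)\<close> bounds the value by
    \<open>\<phi> p x\<close>, and \<open>(p a) q\<close> bounds it by
    \<open>\<phi> q x\<close>.\<close>
  have off: "\<phi> (p \<otimes> a \<otimes> q) x = 0" if pq: "p \<in> P" "q \<in> P" "p \<noteq> q" and a: "a \<in> carrier F" for p q a x
  proof (cases "c p = c q")
    case True
    have pF: "p \<in> carrier F" "adj F p = p" "q \<in> carrier F" using D pq by auto
    have "(cmod (\<phi> (p \<otimes> a \<otimes> q) x))\<^sup>2 \<le> 0"
    proof (cases "\<phi> p x = 0")
      case True
      then show ?thesis
        using positive_map_cauchy_schwarz[OF F \<phi> pF(1), of "a \<otimes> q" x] pF a pp[OF pq(1)]
        by (simp add: F.m_assoc)
    next
      case False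
      then have "\<phi> q x = 0" using disj[OF pq True, of x] by simp
      then show ?thesis
        using positive_map_cauchy_schwarz[OF F \<phi>, of "adj F a \<otimes> p" q x] pF a pp[OF pq(2)] D(3)[OF pq(2)]
        by (simp add: F.adj_mult)
    qed
    then show ?thesis by simp
  next
    case False
    have "p \<otimes> a \<otimes> q \<in> I (c p)" "p \<otimes> a \<otimes> q \<in> I (c q)"
      using id[OF c(1)[OF pq(1)]] id[OF c(1)[OF pq(2)]] c(2)[OF pq(1)] c(2)[OF pq(2)] D(2) pq a
      by (auto simp: two_sided_ideal_def)
    then have "p \<otimes> a \<otimes> q = \<zero>"
      using ideal_decomposition_disjoint[OF F dec c(1)[OF pq(1)] c(1)[OF pq(2)] False] by blast
    then show ?thesis using \<phi>0 by simp
  qed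
  have formula: "\<phi> a x = (\<Sum>p\<in>P. \<kappa> p a * \<phi> p x)" if a: "a \<in> carrier F" for a x
  proof -
    have left: "\<phi> b x = (\<Sum>p\<in>P. \<phi> (p \<otimes> b) x)" if b: "b \<in> carrier F" for b
    proof -
      have "\<phi> b = \<phi> (\<Oplus>p\<in>P. p \<otimes> b)"
        using ua[OF b] F.mult_finsum(2)[of P "\<lambda>p. p" b] D b by simp
      then show ?thesis using \<phi>sum[of "\<lambda>p. p \<otimes> b"] D b by simp
    qed
    have right: "\<phi> b x = (\<Sum>q\<in>P. \<phi> (b \<otimes> q) x)" if b: "b \<in> carrier F" for b
    proof -
      have "\<phi> b = \<phi> (\<Oplus>q\<in>P. b \<otimes> q)"
        using au[OF b] F.mult_finsum(1)[of P "\<lambda>p. p" b] D b by simp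
      then show ?thesis using \<phi>sum[of "\<lambda>q. b \<otimes> q"] D b by simp
    qed
    have "\<phi> (p \<otimes> a) x = \<kappa> p a * \<phi> p x" if p: "p \<in> P" for p
    proof -
      have "\<phi> (p \<otimes> a) x = (\<Sum>q\<in>P. \<phi> (p \<otimes> a \<otimes> q) x)"
        using D p a by (intro right) simp
      also have "\<dots> = (\<Sum>q\<in>{p}. \<phi> (p \<otimes> a \<otimes> q) x)"
        using D(1) p off[OF p _ _ a] by (intro sum.mono_neutral_right) auto
      also have "\<dots> = \<kappa> p a * \<phi> p x" using \<kappa>[OF p a] \<phi>sm D(2)[OF p] by simp
      finally show ?thesis .
    qed
    then show ?thesis using left[OF a] by simp
  qed
  \<comment> \<open>Positivity of the functionals is read off from \<open>\<phi>\<close>: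
    \<open>\<kappa> p (\<psi> f) * \<phi> p x\<close> is nonnegative and may be divided by
    \<open>\<phi> p x\<close> only if that is nonzero somewhere. Indices with
    \<open>\<phi> p = 0\<close> contribute nothing to the sum.\<close>
  define K where "K = {p \<in> P. \<exists>x. \<phi> p x \<noteq> 0}"
  have KP: "p \<in> P" if "p \<in> K" for p using that by (simp add: K_def)
  have "coloured_system X n K c \<phi> (\<lambda>p f. \<kappa> p (\<psi> f))"
    unfolding coloured_system_def
  proof (intro conjI ballI allI impI)
    show "finite K" using D(1) by (simp add: K_def)
    show "\<phi> p x * \<phi> q x = 0" if "p \<in> K" "q \<in> K" "p \<noteq> q" "c p = c q" for p q x
      using disj that KP by blast
    fix p assume pK: "p \<in> K"
    note p = KP[OF pK]
    show "c p \<le> n" "\<phi> p \<in> C0_functions X" using c p \<phi>C D by blast+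
    show "\<phi> p x \<in> \<real>\<^sub>\<ge>\<^sub>0" for x using pos_p[OF p] .
    show "cmod (\<phi> p x) \<le> 1" for x
    proof -
      have "cnorm (C0 X) (\<phi> p) \<le> cnorm F p"
        using Ii[OF c(1)[OF p]] c(2)[OF p] unfolding contractive_def by simp
      then show ?thesis using C0_le_norm[OF \<phi>C[OF D(2)[OF p]], of x] norm_p[OF p] by simp
    qed
    show "cmod (\<kappa> p (\<psi> f)) \<le> cnorm (C0 X) f" if "f \<in> C0_functions X" for f
      using \<kappa>_norm[OF p \<psi>F[OF that]] \<psi>(2) that unfolding contractive_def
      by (auto simp: C0_sel(1) intro: order_trans)
    show "positive_functional X (\<lambda>f. \<kappa> p (\<psi> f))"
      unfolding positive_functional_def
    proof (intro conjI ballI allI impI)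
      fix f h assume fh: "f \<in> C0_functions X" "h \<in> C0_functions X"
      then have "\<psi> (\<lambda>x. f x + h x) = \<psi> f \<oplus> \<psi> h"
        using \<psi>(1) by (auto simp: cp_map_def linear_map_def C0_sel)
      then show "\<kappa> p (\<psi> (\<lambda>x. f x + h x)) = \<kappa> p (\<psi> f) + \<kappa> p (\<psi> h)"
        using \<kappa>_add[OF p \<psi>F \<psi>F] fh by simp
    next
      fix a f assume f: "f \<in> C0_functions X"
      then have "\<psi> (\<lambda>x. a * f x) = a \<odot> \<psi> f"
        using \<psi>(1) by (auto simp: cp_map_def linear_map_def C0_sel)
      then show "\<kappa> p (\<psi> (\<lambda>x. a * f x)) = a * \<kappa> p (\<psi> f)"
        using \<kappa>_sm[OF p \<psi>F] f by simp
    next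
      fix f assume f: "f \<in> C0_functions X" "\<forall>x. f x \<in> \<real>\<^sub>\<ge>\<^sub>0"
      then have "\<psi> f \<in> positive_elements F"
        using cp_map_positive[OF st(2,1) \<psi>(1), of f] by (simp add: positive_elements_C0_iff)
      then obtain y where y: "y \<in> carrier F" "\<psi> f = adj F y \<otimes> y" unfolding positive_elements_def by blast
      have pF: "p \<in> carrier F" "adj F p = p" using D p by auto
      obtain x where x: "\<phi> p x \<noteq> 0" using pK by (auto simp: K_def)
      have "\<kappa> p (\<psi> f) \<odot> p = adj F (y \<otimes> p) \<otimes> (y \<otimes> p)"
        using \<kappa>[OF p \<psi>F[OF f(1)]] y pF by (simp add: F.adj_mult F.m_assoc)
      then have "\<phi> (\<kappa> p (\<psi> f) \<odot> p) x \<in> \<real>\<^sub>\<ge>\<^sub>0" using \<phi>pos[of "y \<otimes> p" x] y pF by simp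
      then have "\<kappa> p (\<psi> f) * \<phi> p x \<in> \<real>\<^sub>\<ge>\<^sub>0" using \<phi>sm pF by simp
      then have "\<kappa> p (\<psi> f) * \<phi> p x / \<phi> p x \<in> \<real>\<^sub>\<ge>\<^sub>0" using pos_p[OF p] by (rule nonneg_Reals_divide_I)
      then show "\<kappa> p (\<psi> f) \<in> \<real>\<^sub>\<ge>\<^sub>0" using x by simp
    qed
  qed
  moreover have "\<phi> (\<psi> f) x = (\<Sum>p\<in>K. \<kappa> p (\<psi> f) * \<phi> p x)" if "f \<in> C0_functions X" for f x
    unfolding formula[OF \<psi>F[OF that]] K_def using D(1)
    by (intro sum.mono_neutral_right) auto
  ultimately show ?thesis using that by blast
qed

lemma coloured_approximable_if_nuclear_dim_le:
  fixes X :: "'x topology"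
  assumes "nuclear_dim_le (C0 X) n"
  shows "coloured_approximable TYPE(nat \<Rightarrow> complex) X n"
  unfolding coloured_approximable_def
proof (intro allI impI, elim conjE)
  fix S and e :: real assume S: "finite S" "S \<subseteq> C0_functions X" and e: "0 < e"
  obtain F :: "(nat \<Rightarrow> complex) cstar_algebra" and \<psi> \<phi>
    where app: "nuclear_approximant n (C0 X) F \<psi> \<phi>"
      and close: "\<And>f. f \<in> S \<Longrightarrow> cnorm (C0 X) (\<phi> (\<psi> f) \<ominus>\<^bsub>C0 X\<^esub> f) < e"
    using nuclear_dim_leD[OF assms S(1) _ e] S(2) by (metis C0_sel(1))
  obtain K :: "(nat \<Rightarrow> complex) set" and c g \<mu> where sys: "coloured_system X n K c g \<mu>"
    and eq: "\<And>f x. f \<in> C0_functions X \<Longrightarrow> \<phi> (\<psi> f) x = (\<Sum>k\<in>K. \<mu> k f * g k x)"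
    using nuclear_approximant_coloured[OF app] by metis
  have "cmod ((\<Sum>k\<in>K. \<mu> k f * g k x) - f x) \<le> e" if f: "f \<in> S" for f x
  proof -
    have fC: "f \<in> C0_functions X" using S f by blast
    have \<phi>C: "\<phi> (\<psi> f) \<in> C0_functions X"
      using app fC unfolding nuclear_approximant_def cp_map_def linear_map_def
      by (auto simp: C0_sel(1) Pi_iff)
    have "cmod (\<phi> (\<psi> f) x - f x) \<le> cnorm (C0 X) (\<phi> (\<psi> f) \<ominus>\<^bsub>C0 X\<^esub> f)"
      unfolding C0_diff[OF \<phi>C fC]
      using C0_add[OF \<phi>C C0_smult[OF fC, of "-1"]] by (intro C0_le_norm) simp
    then show ?thesis using close[OF f] eq[OF fC, of x] by simp
  qed
  then show "\<exists>(K :: (nat \<Rightarrow> complex) set) c g \<mu>. coloured_system X n K c g \<mu> \<and>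
      (\<forall>f\<in>S. approximates K g \<mu> f e)"
    using sys by (intro exI[of _ K] exI[of _ c] exI[of _ g] exI[of _ \<mu>]) blast
qed

lemma decomp_rank_le_imp_nuclear_dim_le: "decomp_rank_le A n \<Longrightarrow> nuclear_dim_le A n"
  unfolding decomp_rank_le_def nuclear_dim_le_def by blast

lemma nuclear_dim_le_iff_decomp_rank_le: "nuclear_dim_le (C0 X) n \<longleftrightarrow> decomp_rank_le (C0 X) n"
  using decomp_rank_le_imp_nuclear_dim_le decomp_rank_le_if_coloured_approximable
    coloured_approximable_if_nuclear_dim_le by blast

subsection \<open>Covering dimension bounds the decomposition rank\<close>

text \<open>Complete regularity yields \<open>u\<close> that is 0 at \<open>x\<close> and 1 off
  \<open>U \<inter> V\<close>, with \<open>V\<close> inside a compact set \<open>C\<close>; so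
  \<open>1 - u\<close> lives on \<open>C\<close> and vanishes at infinity.\<close>

lemma C0_bump:
  assumes lc: "locally_compact_space X" and H: "Hausdorff_space X" and U: "openin X U" "x \<in> U"
  obtains f where "f \<in> C0_functions X" "\<And>y. f y \<in> \<real>\<^sub>\<ge>\<^sub>0" "\<And>y. cmod (f y) \<le> 1" "f x = 1"
    "\<And>y. f y \<noteq> 0 \<Longrightarrow> y \<in> U"
proof -
  have cr: "completely_regular_space X"
    using locally_compact_regular_imp_completely_regular_space[OF lc] H by blast
  have xX: "x \<in> topspace X" using U openin_subset by blast
  obtain V C where V: "openin X V" "compactin X C" "x \<in> V" "V \<subseteq> C"
    using lc xX unfolding locally_compact_space_def by metis
  have "closedin X (topspace X - (U \<inter> V))" "x \<in> topspace X - (topspace X - (U \<inter> V))"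
    using U V xX by auto
  from cr[unfolded completely_regular_space_def, rule_format, OF conjI[OF this]]
  obtain u :: "_ \<Rightarrow> real" where u: "continuous_map X (top_of_set {0..1}) u" "u x = 0"
    "u ` (topspace X - (U \<inter> V)) \<subseteq> {1}"
    by (elim exE conjE) (rule that)
  have u1: "u y = 1" if "y \<in> topspace X - (U \<inter> V)" for y
    using u(3) that by blast
  have uc: "continuous_map X euclideanreal u" and u01: "\<And>y. y \<in> topspace X \<Longrightarrow> 0 \<le> u y \<and> u y \<le> 1"
    using u(1) unfolding continuous_map_in_subtopology by auto
  define f where "f y = (if y \<in> topspace X then complex_of_real (1 - u y) else 0)" for y
  have fU: "y \<in> U \<inter> V" if "f y \<noteq> 0" for y
    using that u1[of y] by (auto simp: f_def split: if_splits)
  have "f \<in> C0_functions X"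
  proof (rule C0_functions_if_bounded)
    have "continuous_map X euclidean (\<lambda>y. complex_of_real (1 - u y))"
      by (rule continuous_map_complex_compose[OF uc, of "\<lambda>t. complex_of_real (1 - t)"])
         (auto intro!: continuous_intros)
    then show "continuous_map X euclidean f"
      by (rule continuous_map_eq) (simp add: f_def)
    show "\<exists>K. compactin X K \<and> (\<forall>y. e \<le> cmod (f y) \<longrightarrow> y \<in> K)" if "e > 0" for e
    proof (intro exI[of _ C] conjI V(2) allI impI)
      fix y assume "e \<le> cmod (f y)"
      then have "f y \<noteq> 0" using that by auto
      then show "y \<in> C" using fU V(4) by blast
    qed
  qed (simp add: f_def)
  moreover have "f y \<in> \<real>\<^sub>\<ge>\<^sub>0 \<and> cmod (f y) \<le> 1" for y
  proof (cases "y \<in> topspace X")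
    case True
    have "cmod (f y) = \<bar>1 - u y\<bar>" using True unfolding f_def by (simp only: if_True norm_of_real)
    then show ?thesis using u01[OF True] True by (simp add: f_def complex_nonneg_Reals_iff)
  qed (simp add: f_def)
  moreover have "f x = 1" using xX u(2) by (simp add: f_def)
  ultimately show ?thesis using that fU by blast
qed

text \<open>The threshold 1/2 leaves a margin: a function that exceeds it at one point of a set and
  varies by at most 1/4 on the set has no zero there.\<close>

lemma compact_bump_cover:
  fixes X :: "'x topology"
  assumes lc: "locally_compact_space X" and H: "Hausdorff_space X"
    and C: "compactin X C" and \<U>: "\<forall>U\<in>\<U>. openin X U" "C \<subseteq> \<Union>\<U>"
  obtains S where "finite S" "S \<subseteq> C0_functions X" "\<And>f y. f \<in> S \<Longrightarrow> f y \<in> \<real>\<^sub>\<ge>\<^sub>0" "\<And>f y. f \<in> S \<Longrightarrow> cmod (f y) \<le> 1"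
    "\<forall>f\<in>S. \<exists>U. U \<in> \<U> \<and> (\<forall>y. f y \<noteq> 0 \<longrightarrow> y \<in> U)" "\<And>x. x \<in> C \<Longrightarrow> \<exists>f\<in>S. 1/2 < Re (f x)"
proof -
  define \<F> where "\<F> = {f \<in> C0_functions X. (\<forall>y. f y \<in> \<real>\<^sub>\<ge>\<^sub>0 \<and> cmod (f y) \<le> 1) \<and> (\<exists>U. U \<in> \<U> \<and> (\<forall>y. f y \<noteq> 0 \<longrightarrow> y \<in> U))}"
  define N where "N f = {y \<in> topspace X. 1/2 < Re (f y)}" for f :: "'x \<Rightarrow> complex"
  have No: "openin X (N f)" if f: "f \<in> \<F>" for f
  proof -
    have "continuous_map X euclideanreal (\<lambda>y. Re (f y))"
      using f by (intro continuous_map_complex_compose[of X f Re]) (auto simp: \<F>_def C0_functions_def intro!: continuous_intros)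
    from openin_continuous_map_preimage[OF this, of "{1/2<..}"] show ?thesis by (simp add: N_def)
  qed
  have "\<exists>f\<in>\<F>. x \<in> N f" if x: "x \<in> C" for x
  proof -
    obtain U where U: "U \<in> \<U>" "x \<in> U" using \<U>(2) x by blast
    obtain f where f: "f \<in> C0_functions X" "\<And>y. f y \<in> \<real>\<^sub>\<ge>\<^sub>0" "\<And>y. cmod (f y) \<le> 1" "f x = 1"
      "\<And>y. f y \<noteq> 0 \<Longrightarrow> y \<in> U"
      by (rule C0_bump[OF lc H bspec[OF \<U>(1) U(1)] U(2)]) (rule that)
    have "f \<in> \<F>" unfolding \<F>_def using f U(1) by blast
    moreover have "x \<in> N f" using f(4) C x compactin_subset_topspace by (fastforce simp: N_def)
    ultimately show ?thesis by blast
  qed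
  then have "C \<subseteq> \<Union>(N ` \<F>)" by blast
  moreover have "\<forall>W\<in>N ` \<F>. openin X W" using No by blast
  ultimately have "\<exists>\<G>. finite \<G> \<and> \<G> \<subseteq> N ` \<F> \<and> C \<subseteq> \<Union>\<G>" using C unfolding compactin_def by blast
  then obtain \<G> where \<G>: "finite \<G>" "\<G> \<subseteq> N ` \<F>" "C \<subseteq> \<Union>\<G>" by blast
  obtain S where S: "finite S" "S \<subseteq> \<F>" "\<G> = N ` S" using finite_subset_image[OF \<G>(1,2)] by blast
  have F: "f \<in> C0_functions X" "f y \<in> \<real>\<^sub>\<ge>\<^sub>0" "cmod (f y) \<le> 1" "\<exists>U. U \<in> \<U> \<and> (\<forall>y. f y \<noteq> 0 \<longrightarrow> y \<in> U)"
    if "f \<in> S" for f y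
    using subsetD[OF S(2) that] unfolding \<F>_def by blast+
  have big: "\<exists>f\<in>S. 1/2 < Re (f x)" if x: "x \<in> C" for x
    using \<G>(3) S(3) x by (auto simp: N_def)
  show ?thesis by (rule that[of S]) (use S(1) F big in blast)+
qed

text \<open>The functions are bounded, so finitely many balls of radius \<open>\<delta>/2\<close>
  cover each range, and the cover is finite although the space need not be compact.\<close>

lemma oscillation_cover:
  assumes "finite S" "S \<subseteq> C0_functions X" "0 < \<delta>"
  shows "\<exists>\<U>. finite \<U> \<and> (\<forall>U\<in>\<U>. openin X U) \<and> \<Union>\<U> = topspace X \<and>
    (\<forall>U\<in>\<U>. \<forall>f\<in>S. \<forall>x\<in>U. \<forall>y\<in>U. cmod (f x - f y) \<le> \<delta>)"
  using assms
proof (induction S rule: finite_induct)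
  case empty
  then show ?case by (intro exI[of _ "{topspace X}"]) auto
next
  case (insert f S)
  then obtain \<U> where \<U>: "finite \<U>" "\<forall>U\<in>\<U>. openin X U" "\<Union>\<U> = topspace X"
    "\<forall>U\<in>\<U>. \<forall>f\<in>S. \<forall>x\<in>U. \<forall>y\<in>U. cmod (f x - f y) \<le> \<delta>"
    by auto
  have f: "f \<in> C0_functions X" using insert by blast
  have "\<exists>C. finite C \<and> cball (0 :: complex) (cnorm (C0 X) f) \<subseteq> (\<Union>c\<in>C. ball c (\<delta>/2))"
    using insert.prems(2)
    by (intro compact_eq_totally_bounded[THEN iffD1, THEN conjunct2, rule_format]) auto
  then obtain C where C: "finite C" "cball (0 :: complex) (cnorm (C0 X) f) \<subseteq> (\<Union>c\<in>C. ball c (\<delta>/2))"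
    by blast
  define B where "B c = {x \<in> topspace X. f x \<in> ball c (\<delta>/2)}" for c
  have Bo: "openin X (B c)" for c
    unfolding B_def using f by (intro openin_continuous_map_preimage[of X euclidean f]) (auto simp: C0_functions_def)
  have cov: "\<exists>c\<in>C. x \<in> B c" if "x \<in> topspace X" for x
  proof -
    have "f x \<in> cball 0 (cnorm (C0 X) f)" using C0_le_norm[OF f] by simp
    from subsetD[OF C(2) this] show ?thesis using that unfolding B_def by blast
  qed
  have osc: "cmod (f x - f y) \<le> \<delta>" if "x \<in> B c" "y \<in> B c" for x y c
  proof -
    have "dist c (f x) < \<delta>/2" "dist c (f y) < \<delta>/2" using that unfolding B_def mem_ball by blast+
    then have "dist (f x) (f y) < \<delta>" by (rule dist_triangle_half_r)
    then show ?thesis by (simp add: dist_norm)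
  qed
  let ?W = "(\<lambda>(U, c). U \<inter> B c) ` (\<U> \<times> C)"
  have "\<Union>?W = topspace X"
  proof
    show "\<Union>?W \<subseteq> topspace X" using \<U> by auto
    show "topspace X \<subseteq> \<Union>?W"
    proof
      fix x assume x: "x \<in> topspace X"
      then obtain U c where "U \<in> \<U>" "x \<in> U" "c \<in> C" "x \<in> B c" using \<U>(3) cov by blast
      then show "x \<in> \<Union>?W" by (auto intro!: bexI[of _ "(U, c)"])
    qed
  qed
  moreover have "finite ?W" "\<forall>W\<in>?W. openin X W" using \<U> C Bo by auto
  moreover have "\<forall>W\<in>?W. \<forall>g\<in>insert f S. \<forall>x\<in>W. \<forall>y\<in>W. cmod (g x - g y) \<le> \<delta>"
    using \<U>(4) osc by auto
  ultimately show ?case by blast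
qed

text \<open>
  The support of \<open>nerve_weight h \<V> T\<close> corresponds to the open star of the barycentre of \<open>T\<close> in
  the barycentric subdivision of the nerve of the cover; the stars of distinct simplices of the same
  dimension are disjoint, so the cardinality of \<open>T\<close> can serve as its colour.
\<close>

definition nerve_weight :: "('v \<Rightarrow> 'x \<Rightarrow> real) \<Rightarrow> 'v set \<Rightarrow> 'v set \<Rightarrow> 'x \<Rightarrow> real" where
  "nerve_weight h \<V> T x = (\<Prod>V\<in>T. h V x) * (\<Prod>V\<in>T. \<Prod>W\<in>\<V> - T. max 0 (h V x - h W x))"

lemma nerve_weight_nonneg: "(\<And>V. 0 \<le> h V x) \<Longrightarrow> 0 \<le> nerve_weight h \<V> T x"
  by (simp add: nerve_weight_def prod_nonneg)

lemma nerve_weight_pos_iff: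
  assumes "finite \<V>" "T \<subseteq> \<V>" "\<And>V. 0 \<le> h V x"
  shows "nerve_weight h \<V> T x \<noteq> 0 \<longleftrightarrow> (\<forall>V\<in>T. 0 < h V x \<and> (\<forall>W\<in>\<V> - T. h W x < h V x))"
proof -
  have "finite T" using assms finite_subset by blast
  moreover have "h V x = 0 \<longleftrightarrow> \<not> 0 < h V x" for V using assms(3)[of V] by auto
  moreover have "max 0 (h V x - h W x) = 0 \<longleftrightarrow> \<not> h W x < h V x" for V W by auto
  ultimately show ?thesis
    unfolding nerve_weight_def using assms(1) by (simp add: Bex_def Ball_def) blast
qed

lemma nerve_weight_continuous:
  assumes "finite \<V>" "T \<subseteq> \<V>" "\<And>V. V \<in> \<V> \<Longrightarrow> continuous_map X euclideanreal (h V)"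
  shows "continuous_map X euclideanreal (nerve_weight h \<V> T)"
proof -
  have "finite T" using assms finite_subset by blast
  then show ?thesis
    unfolding nerve_weight_def using assms
    by (intro continuous_map_real_mult continuous_map_prod continuous_map_real_max continuous_map_diff) auto
qed

text \<open>Distinct sets of equal size each contain an element missing from the other; two nonzero
  weights would order the values of \<open>h\<close> at these elements both ways.\<close>

lemma nerve_weight_disjoint:
  assumes fin: "finite \<V>" and TT: "T \<subseteq> \<V>" "T' \<subseteq> \<V>" "T \<noteq> T'" "card T = card T'" and nn: "\<And>V. 0 \<le> h V x"
  shows "nerve_weight h \<V> T x * nerve_weight h \<V> T' x = 0"
proof (rule ccontr)
  assume "\<not> ?thesis"
  then have w: "nerve_weight h \<V> T x \<noteq> 0" "nerve_weight h \<V> T' x \<noteq> 0" by auto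
  have "finite T" "finite T'" using fin TT finite_subset by blast+
  then obtain V W where "V \<in> T - T'" "W \<in> T' - T"
    using TT(3,4) by (metis card_subset_eq Diff_eq_empty_iff ex_in_conv)
  then have "h W x < h V x" "h V x < h W x"
    using w TT unfolding nerve_weight_pos_iff[where h = h, OF fin TT(1) nn] nerve_weight_pos_iff[where h = h, OF fin TT(2) nn]
    by auto
  then show False by simp
qed

text \<open>The weight of the set of all members at which \<open>h\<close> attains its maximum at
  \<open>x\<close> is positive.\<close>

lemma nerve_weight_sum_pos:
  assumes fin: "finite \<V>" and nn: "\<And>V. 0 \<le> h V x" and pos: "\<exists>V\<in>\<V>. 0 < h V x"
  shows "0 < (\<Sum>T\<in>{T. T \<subseteq> \<V> \<and> T \<noteq> {}}. nerve_weight h \<V> T x)"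
proof -
  define m where "m = Max ((\<lambda>V. h V x) ` \<V>)"
  define T where "T = {V \<in> \<V>. h V x = m}"
  have ne: "\<V> \<noteq> {}" using pos by blast
  have le: "h V x \<le> m" if "V \<in> \<V>" for V using that fin by (simp add: m_def)
  have "m \<in> (\<lambda>V. h V x) ` \<V>" unfolding m_def using fin ne by (intro Max_in) auto
  then have T: "T \<subseteq> \<V>" "T \<noteq> {}" by (auto simp: T_def)
  have "0 < m" using pos le by fastforce
  have "nerve_weight h \<V> T x \<noteq> 0"
    unfolding nerve_weight_pos_iff[where h = h, OF fin T(1) nn]
    using \<open>0 < m\<close> le by (fastforce simp: T_def)
  then have "0 < nerve_weight h \<V> T x" using nerve_weight_nonneg[of h x \<V> T, OF nn] by simp
  then show ?thesis
    using T fin nerve_weight_nonneg[of h x \<V>, OF nn]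
    by (intro sum_pos2[where i = T]) auto
qed

lemma decomp_rank_le_if_covering_dim_le:
  fixes X :: "'x topology"
  assumes lc: "locally_compact_space X" and H: "Hausdorff_space X" and dim: "covering_dim_le X n"
  shows "decomp_rank_le (C0 X) n"
proof (rule decomp_rank_le_C0I)
  fix S and e :: real assume S: "finite S" "S \<subseteq> C0_functions X" and e: "0 < e"
  \<comment> \<open>One half is for the oscillation on the supports, the other for the part of
    \<open>f\<close> lost by the cut-off.\<close>
  define \<delta> where "\<delta> = e / 2"
  have \<delta>: "0 < \<delta>" using e by (simp add: \<delta>_def)
  obtain \<U> where \<U>: "finite \<U>" "\<forall>U\<in>\<U>. openin X U" "\<Union>\<U> = topspace X"
    and osc\<U>: "\<forall>U\<in>\<U>. \<forall>f\<in>S. \<forall>x\<in>U. \<forall>y\<in>U. cmod (f x - f y) \<le> \<delta>"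
    using oscillation_cover[OF S \<delta>] by blast
  have "finite \<U> \<and> (\<forall>U\<in>\<U>. openin X U) \<and> \<Union>\<U> = topspace X" using \<U> by blast
  then have "\<exists>\<V>. finite \<V> \<and> (\<forall>V\<in>\<V>. openin X V) \<and> \<Union>\<V> = topspace X \<and>
      (\<forall>V\<in>\<V>. \<exists>U\<in>\<U>. V \<subseteq> U) \<and> (\<forall>x\<in>topspace X. card {V \<in> \<V>. x \<in> V} \<le> n + 1)"
    by (rule dim[unfolded covering_dim_le_def, THEN spec, THEN mp])
  then obtain \<V> where \<V>: "finite \<V>" "\<forall>V\<in>\<V>. openin X V" "\<Union>\<V> = topspace X" "\<forall>V\<in>\<V>. \<exists>U\<in>\<U>. V \<subseteq> U"
    and ord: "\<forall>x\<in>topspace X. card {V \<in> \<V>. x \<in> V} \<le> n + 1"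
    by auto
  have osc: "cmod (f x - f y) \<le> \<delta>" if V: "V \<in> \<V>" and fxy: "f \<in> S" "x \<in> V" "y \<in> V" for V f x y
  proof -
    obtain U where U: "U \<in> \<U>" "V \<subseteq> U" using bspec[OF \<V>(4) V] by blast
    show ?thesis
      by (rule osc\<U>[rule_format, OF U(1) fxy(1) subsetD[OF U(2) fxy(2)] subsetD[OF U(2) fxy(3)]])
  qed
  obtain E where E: "E \<in> C0_functions X" "\<And>x. E x \<in> \<real>\<^sub>\<ge>\<^sub>0" "\<And>x. cmod (E x) \<le> 1"
    and cE: "\<And>f x. \<lbrakk>f \<in> S; E x \<noteq> 1\<rbrakk> \<Longrightarrow> cmod (f x) \<le> \<delta>"
    by (rule C0_cutoff[OF S \<delta>]) (rule that)
  have rE: "0 \<le> Re (E x)" "Re (E x) \<le> 1" "cmod (E x) = Re (E x)" for x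
    using E(2)[of x] E(3)[of x] by (auto elim!: nonneg_Reals_cases)
  define C where "C = {x \<in> topspace X. 1/2 \<le> cmod (E x)}"
  have C: "compactin X C" "C \<subseteq> \<Union>\<V>" using C0_compact(1)[OF E(1), of "1/2"] \<V>(3) by (auto simp: C_def)
  obtain B where B: "finite B" "B \<subseteq> C0_functions X" "\<And>f y. f \<in> B \<Longrightarrow> f y \<in> \<real>\<^sub>\<ge>\<^sub>0"
    "\<forall>f\<in>B. \<exists>V. V \<in> \<V> \<and> (\<forall>y. f y \<noteq> 0 \<longrightarrow> y \<in> V)" "\<And>x. x \<in> C \<Longrightarrow> \<exists>f\<in>B. 1/2 < Re (f x)"
    by (rule compact_bump_cover[OF lc H C(1) \<V>(2) C(2)]) (rule that)
  from bchoice[OF B(4)] obtain v where v: "\<forall>f\<in>B. v f \<in> \<V> \<and> (\<forall>y. f y \<noteq> 0 \<longrightarrow> y \<in> v f)" ..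
  \<comment> \<open>Bump functions are collected according to a chosen member \<open>v f\<close>
    containing their support; each \<open>h V\<close> then lives on \<open>V\<close>, and at every
    point of \<open>C\<close> some \<open>h V\<close> is positive.\<close>
  define h where "h V x = (\<Sum>f\<in>{f \<in> B. v f = V}. Re (f x))" for V x
  have Bnn: "0 \<le> Re (f x)" if "f \<in> B" for f x using B(3)[OF that, of x] by (simp add: complex_nonneg_Reals_iff)
  have hnn: "0 \<le> h V x" for V x unfolding h_def using Bnn by (intro sum_nonneg) auto
  have hc: "continuous_map X euclideanreal (h V)" for V
    unfolding h_def using B(1,2)
    by (intro continuous_map_sum continuous_map_complex_compose[of X _ Re]) (auto simp: C0_functions_def intro!: continuous_intros)
  have hV: "x \<in> V" if "0 < h V x" for V x
  proof -
    have "\<exists>f\<in>{f \<in> B. v f = V}. Re (f x) \<noteq> 0"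
      using that unfolding h_def by (metis (no_types, lifting) less_irrefl sum.neutral)
    then obtain f where f: "f \<in> B" "v f = V" "Re (f x) \<noteq> 0" by blast
    have "f x \<noteq> 0" using f(3) by auto
    then show ?thesis using bspec[OF v f(1)] f(2) by blast
  qed
  define \<T> where "\<T> = {T. T \<subseteq> \<V> \<and> T \<noteq> {}}"
  have fin\<T>: "finite \<T>" using \<V>(1) by (simp add: \<T>_def)
  define \<sigma> where "\<sigma> x = (\<Sum>T\<in>\<T>. nerve_weight h \<V> T x)" for x
  have wnn: "0 \<le> nerve_weight h \<V> T x" for T x by (rule nerve_weight_nonneg) (rule hnn)
  have \<sigma>nn: "0 \<le> \<sigma> x" for x unfolding \<sigma>_def by (intro sum_nonneg wnn)
  have \<sigma>pos: "0 < \<sigma> x" if x: "x \<in> C" for x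
  proof -
    obtain f where f: "f \<in> B" "1/2 < Re (f x)" using B(5)[OF x] by blast
    have "Re (f x) \<le> h (v f) x" unfolding h_def using B(1) f(1) Bnn by (intro member_le_sum) auto
    then have "0 < h (v f) x" using f(2) by linarith
    then show ?thesis unfolding \<sigma>_def \<T>_def using \<V>(1) hnn bspec[OF v f(1)] by (intro nerve_weight_sum_pos) auto
  qed
  \<comment> \<open>A denominator without zeros: on \<open>C\<close> the first summand is positive,
    off \<open>C\<close> the second exceeds 1/2. Where \<open>E x = 1\<close> it reduces to
    \<open>\<sigma> x\<close>, so that the quotients add up to 1 there. The factor \<open>E\<close>
    in \<open>G\<close> makes them vanish at infinity.\<close>
  define D where "D x = \<sigma> x + (1 - Re (E x))" for x
  have Dpos: "0 < D x" for x
  proof (cases "x \<in> C")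
    case True
    then show ?thesis using \<sigma>pos[OF True] rE(2)[of x] by (simp add: D_def)
  next
    case False
    then have "Re (E x) < 1/2" using E(1) rE(3)[of x] by (cases "x \<in> topspace X") (auto simp: C_def C0_functions_def)
    then show ?thesis using \<sigma>nn[of x] by (simp add: D_def)
  qed
  define G where "G T x = Re (E x) * (nerve_weight h \<V> T x / D x)" for T x
  have Gnn: "0 \<le> G T x" for T x
    unfolding G_def using Dpos[of x] by (intro mult_nonneg_nonneg divide_nonneg_nonneg wnn rE less_imp_le)
  have GV: "x \<in> V" if "G T x \<noteq> 0" "T \<in> \<T>" "V \<in> T" for T x V
  proof (rule hV)
    have "nerve_weight h \<V> T x \<noteq> 0" using that(1) by (auto simp: G_def)
    then show "0 < h V x"
      using nerve_weight_pos_iff[of \<V> T h x] \<V>(1) hnn that(2,3) by (auto simp: \<T>_def)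
  qed
  have Gsum: "(\<Sum>T\<in>\<T>. G T x) = Re (E x) * (\<sigma> x / D x)" for x
    unfolding G_def sum_distrib_left[symmetric] sum_divide_distrib[symmetric] \<sigma>_def[symmetric] ..
  have Gsum1: "(\<Sum>T\<in>\<T>. G T x) \<le> 1" for x
  proof -
    have "\<sigma> x / D x \<le> 1" using Dpos[of x] rE(2)[of x] by (simp add: D_def divide_le_eq_1)
    then have "Re (E x) * (\<sigma> x / D x) \<le> 1 * 1" using rE \<sigma>nn[of x] Dpos[of x] by (intro mult_mono) auto
    then show ?thesis by (simp add: Gsum)
  qed
  have Gsum_eq: "(\<Sum>T\<in>\<T>. G T x) = 1" if "E x = 1" for x
    using Dpos[of x] that by (simp add: Gsum D_def)
  have GX: "x \<in> topspace X" if "G T x \<noteq> 0" for T x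
    using that E(1) by (auto simp: G_def C0_functions_def)
  have Gcard: "card T \<le> n + 1" if "G T x \<noteq> 0" "T \<in> \<T>" for T x
  proof -
    have "T \<subseteq> {V \<in> \<V>. x \<in> V}" using GV[OF that] that(2) by (auto simp: \<T>_def)
    then have "card T \<le> card {V \<in> \<V>. x \<in> V}" using \<V>(1) by (intro card_mono) auto
    then show ?thesis using ord GX[OF that(1)] by fastforce
  qed
  have Ec: "continuous_map X euclideanreal (\<lambda>x. Re (E x))"
    using E(1) by (intro continuous_map_complex_compose[of X E Re]) (auto simp: C0_functions_def intro!: continuous_intros)
  have wc: "continuous_map X euclideanreal (nerve_weight h \<V> T)" if "T \<in> \<T>" for T
    using that hc \<V>(1) by (intro nerve_weight_continuous) (auto simp: \<T>_def)
  have Dc: "continuous_map X euclideanreal D"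
    unfolding D_def \<sigma>_def using fin\<T> wc
    by (intro continuous_map_add continuous_map_diff continuous_map_sum Ec) auto
  have Gc: "continuous_map X euclideanreal (G T)" if "T \<in> \<T>" for T
    unfolding G_def using Dpos
    by (intro continuous_map_real_mult continuous_map_real_divide Ec Dc wc that) (auto simp: less_imp_neq[symmetric])
  have Gosc: "cmod (f x - f y) \<le> \<delta>" if G0: "G T x \<noteq> 0" "G T y \<noteq> 0" and T: "T \<in> \<T>" and f: "f \<in> S" for T x y f
  proof -
    obtain V where V: "V \<in> T" "V \<in> \<V>" using T by (auto simp: \<T>_def)
    show ?thesis by (rule osc[OF V(2) f GV[OF G0(1) T V(1)] GV[OF G0(2) T V(1)]])
  qed
  have Gle: "G T x \<le> Re (E x)" if "T \<in> \<T>" for T x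
  proof -
    have "nerve_weight h \<V> T x \<le> D x"
      using member_le_sum[OF that, of "\<lambda>T. nerve_weight h \<V> T x"] wnn fin\<T> rE(2)[of x]
      by (simp add: D_def \<sigma>_def add_increasing2)
    then have "nerve_weight h \<V> T x / D x \<le> 1" using Dpos[of x] by simp
    then show ?thesis unfolding G_def using mult_left_mono[OF _ rE(1)[of x]] by fastforce
  qed
  \<comment> \<open>Only weights that do not vanish identically have a point \<open>pt T\<close> in
    their support at which to evaluate functions.\<close>
  define K where "K = {T \<in> \<T>. \<exists>x. G T x \<noteq> 0}"
  define pt where "pt T = (SOME x. G T x \<noteq> 0)" for T
  have pt: "G T (pt T) \<noteq> 0" if "T \<in> K" for T
  proof -
    have "\<exists>x. G T x \<noteq> 0" using that by (auto simp: K_def)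
    then show ?thesis unfolding pt_def by (rule someI_ex)
  qed
  have K\<T>: "T \<in> \<T>" if "T \<in> K" for T using that by (simp add: K_def)
  have finK: "finite K" using fin\<T> by (simp add: K_def)
  have GK: "(\<Sum>T\<in>K. G T x) = (\<Sum>T\<in>\<T>. G T x)" for x
    using fin\<T> by (intro sum.mono_neutral_left) (auto simp: K_def)
  \<comment> \<open>For \<open>T\<close> in \<open>K\<close> the set \<open>T\<close> has between 1
    and \<open>n + 1\<close> elements, so \<open>card T - 1\<close> takes the values 0 to
    \<open>n\<close> and distinguishes cardinalities.\<close>
  let ?g = "\<lambda>T x. complex_of_real (G T x)" and ?c = "\<lambda>T :: 'x set set. card T - 1"
  let ?\<mu> = "\<lambda>T (f :: 'x \<Rightarrow> complex). f (pt T)"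
  have sys: "coloured_system X n K ?c ?g ?\<mu>"
    unfolding coloured_system_def
  proof (intro conjI ballI allI impI finK)
    fix T assume T: "T \<in> K"
    note T' = K\<T>[OF T]
    show "card T - 1 \<le> n" using Gcard[OF pt[OF T] T'] by simp
    have le: "cmod (?g T x) \<le> cmod (E x)" for x using Gle[OF T'] Gnn by (simp add: rE(3) norm_of_real)
    show "?g T \<in> C0_functions X"
    proof (rule C0_bounded_mult[where f = E and B = 1, OF E(1)])
      show "continuous_map X euclidean (\<lambda>x. ?g T x)"
        by (rule continuous_map_complex_compose[OF Gc[OF T']]) (auto intro!: continuous_intros)
      show "?g T y = 0" if "y \<notin> topspace X" for y using GX[of T y] that by auto
    qed (use le in simp)
    show "?g T x \<in> \<real>\<^sub>\<ge>\<^sub>0" for x using Gnn by (simp add: complex_nonneg_Reals_iff)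
    show "cmod (?g T x) \<le> 1" for x using le E(3) order_trans by blast
    show "positive_functional X (?\<mu> T)" by (simp add: positive_functional_def)
    show "cmod (?\<mu> T f) \<le> cnorm (C0 X) f" if "f \<in> C0_functions X" for f
      using that by (rule C0_le_norm)
  next
    fix T T' x assume T: "T \<in> K" "T' \<in> K" "T \<noteq> T'" "card T - 1 = card T' - 1"
    have sub: "T \<subseteq> \<V>" "T' \<subseteq> \<V>" "T \<noteq> {}" "T' \<noteq> {}" using K\<T> T by (auto simp: \<T>_def)
    then have "0 < card T" "0 < card T'" using \<V>(1) finite_subset card_gt_0_iff by metis+
    then have "card T = card T'" using T(4) by simp
    then have "nerve_weight h \<V> T x * nerve_weight h \<V> T' x = 0"
      using \<V>(1) sub T(3) hnn by (intro nerve_weight_disjoint)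
    then show "?g T x * ?g T' x = 0" by (auto simp: G_def)
  qed
  have app: "cmod ((\<Sum>T\<in>K. ?\<mu> T f * ?g T x) - f x) \<le> e" if f: "f \<in> S" for f x
  proof -
    let ?s = "\<Sum>T\<in>K. G T x"
    have s: "0 \<le> ?s" "?s \<le> 1" using Gnn Gsum1[of x] by (auto simp: GK intro: sum_nonneg)
    have "(\<Sum>T\<in>K. ?\<mu> T f * ?g T x) - f x = (\<Sum>T\<in>K. (f (pt T) - f x) * ?g T x) + of_real (?s - 1) * f x"
    proof -
      have "(\<Sum>T\<in>K. (f (pt T) - f x) * ?g T x) = (\<Sum>T\<in>K. f (pt T) * ?g T x) - f x * of_real ?s"
        by (simp only: left_diff_distrib sum_subtractf sum_distrib_left of_real_sum)
      then show ?thesis by (simp only:) (simp add: right_diff_distrib mult.commute)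
    qed
    also have "cmod \<dots> \<le> (\<Sum>T\<in>K. \<delta> * G T x) + \<bar>?s - 1\<bar> * cmod (f x)"
    proof (intro order_trans[OF norm_triangle_ineq] add_mono order_trans[OF norm_sum] sum_mono)
      fix T assume T: "T \<in> K"
      have "cmod (f (pt T) - f x) * G T x \<le> \<delta> * G T x"
        using Gosc[OF pt[OF T] _ K\<T>[OF T] f, of x] Gnn[of T x] by (cases "G T x = 0") (auto intro: mult_right_mono)
      then show "cmod ((f (pt T) - f x) * ?g T x) \<le> \<delta> * G T x" using Gnn by (simp add: norm_mult)
    qed (simp add: norm_mult norm_of_real del: of_real_diff of_real_sum)
    also have "\<dots> \<le> \<delta> + \<delta>"
    proof (rule add_mono)
      show "(\<Sum>T\<in>K. \<delta> * G T x) \<le> \<delta>"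
        using mult_left_mono[OF s(2), of \<delta>] \<delta> by (simp add: sum_distrib_left[symmetric])
      show "\<bar>?s - 1\<bar> * cmod (f x) \<le> \<delta>"
      proof (cases "E x = 1")
        case True
        then show ?thesis using Gsum_eq[OF True] \<delta> by (simp add: GK)
      next
        case False
        have "\<bar>?s - 1\<bar> * cmod (f x) \<le> 1 * \<delta>" using s cE[OF f False] by (intro mult_mono) auto
        then show ?thesis by simp
      qed
    qed
    finally show ?thesis by (simp add: \<delta>_def)
  qed
  have "(\<Sum>T\<in>K. Re (?g T x)) \<le> 1" for x using Gsum1[of x] by (simp add: GK)
  then show "\<exists>(K :: 'x set set set) c g \<mu>. coloured_system X n K c g \<mu> \<and> (\<forall>x. (\<Sum>k\<in>K. Re (g k x)) \<le> 1) \<and>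
      (\<forall>f\<in>S. approximates K g \<mu> f e)"
    using sys app by (intro exI[of _ K] exI[of _ ?c] exI[of _ ?g] exI[of _ ?\<mu>] conjI allI ballI)
qed

subsection \<open>Nuclear dimension bounds the covering dimension\<close>

text \<open>At one point, functions that do not vanish have distinct colours among 0 to
  \<open>n\<close>.\<close>

lemma coloured_system_card:
  assumes sys: "coloured_system X n K c g \<mu>"
  shows "card {k \<in> K. g k x \<noteq> 0} \<le> n + 1"
proof -
  note D = coloured_systemD[OF sys]
  have "inj_on c {k \<in> K. g k x \<noteq> 0}"
  proof (rule inj_onI, rule ccontr)
    fix k l assume "k \<in> {k \<in> K. g k x \<noteq> 0}" "l \<in> {k \<in> K. g k x \<noteq> 0}" "c k = c l" "k \<noteq> l"
    then show False using D(8)[of k l x] by simp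
  qed
  moreover have "c ` {k \<in> K. g k x \<noteq> 0} \<subseteq> {..n}" using D(2) by auto
  ultimately have "card {k \<in> K. g k x \<noteq> 0} \<le> card {..n}" by (intro card_inj_on_le) auto
  then show ?thesis by simp
qed

text \<open>
  The variance \<open>\<Sum>\<^sub>k g\<^sub>k(x) \<mu>\<^sub>k(e (f - f(x))\<^sup>2)\<close> is close to the value of \<open>e (f - f(x))\<^sup>2\<close> at \<open>x\<close>,
  which is \<open>0\<close>. As all its terms are nonnegative, \<open>\<mu>\<^sub>k\<close> is concentrated where \<open>f\<close> is close to
  \<open>f(x)\<close> for every point \<open>x\<close> at which \<open>g\<^sub>k\<close> is not small.
\<close>

lemma coloured_system_variance:
  assumes sys: "coloured_system X n K c g \<mu>"
    and e: "e \<in> C0_functions X" "\<And>x. e x \<in> \<real>\<^sub>\<ge>\<^sub>0"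
    and f: "f \<in> C0_functions X" "\<And>x. f x \<in> \<real>\<^sub>\<ge>\<^sub>0" "\<And>x. cmod (f x) \<le> 1"
    and app0: "\<And>x. cmod ((\<Sum>k\<in>K. \<mu> k e * g k x) - e x) \<le> \<epsilon>"
    and app1: "\<And>x. cmod ((\<Sum>k\<in>K. \<mu> k (\<lambda>x. e x * f x) * g k x) - e x * f x) \<le> \<epsilon>"
    and app2: "\<And>x. cmod ((\<Sum>k\<in>K. \<mu> k (\<lambda>x. e x * f x * f x) * g k x) - e x * f x * f x) \<le> \<epsilon>"
    and k: "k \<in> K"
  shows "(\<lambda>y. e y * (f y - f x)\<^sup>2) \<in> C0_functions X"
    and "\<mu> k (\<lambda>y. e y * (f y - f x)\<^sup>2) \<in> \<real>\<^sub>\<ge>\<^sub>0"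
    and "Re (\<mu> k (\<lambda>y. e y * (f y - f x)\<^sup>2)) * Re (g k x) \<le> 4 * \<epsilon>"
proof -
  note D = coloured_systemD[OF sys]
  define t where "t = f x"
  define q where "q y = e y * (f y - t)\<^sup>2" for y
  have C: "(\<lambda>y. e y * f y) \<in> C0_functions X" "(\<lambda>y. e y * f y * f y) \<in> C0_functions X"
    using e f by (auto intro!: C0_mult)
  have C': "(\<lambda>y. t\<^sup>2 * e y) \<in> C0_functions X" "(\<lambda>y. - 2 * t * (e y * f y)) \<in> C0_functions X"
    by (rule C0_smult[OF e(1)], rule C0_smult[OF C(1)])
  have q_eq: "q = (\<lambda>y. (t\<^sup>2 * e y + - 2 * t * (e y * f y)) + e y * f y * f y)"
    by (simp add: q_def fun_eq_iff power2_eq_square algebra_simps)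
  have qC: "q \<in> C0_functions X" unfolding q_eq by (intro C0_add C C')
  have qn: "q y \<in> \<real>\<^sub>\<ge>\<^sub>0" for y
  proof -
    obtain a b where "f y = of_real a" "t = of_real b"
      using f(2)[of y] f(2)[of x] unfolding t_def by (auto elim!: nonneg_Reals_cases)
    then have "(f y - t)\<^sup>2 \<in> \<real>\<^sub>\<ge>\<^sub>0" by (simp flip: of_real_diff of_real_power)
    then show ?thesis unfolding q_def by (intro nonneg_Reals_mult_I e)
  qed
  have \<mu>q: "\<mu> l q = t\<^sup>2 * \<mu> l e + - 2 * t * \<mu> l (\<lambda>y. e y * f y) + \<mu> l (\<lambda>y. e y * f y * f y)" if l: "l \<in> K" for l
    unfolding q_eq
    using positive_functionalD(1)[OF D(6)[OF l] C0_add[OF C'] C(2)] positive_functionalD(1)[OF D(6)[OF l] C']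
      positive_functionalD(2)[OF D(6)[OF l] e(1), of "t\<^sup>2"] positive_functionalD(2)[OF D(6)[OF l] C(1), of "- 2 * t"]
    by simp
  have \<mu>qn: "\<mu> l q \<in> \<real>\<^sub>\<ge>\<^sub>0" if "l \<in> K" for l by (rule positive_functionalD(3)[OF D(6)[OF that] qC qn])
  have summand: "\<mu> l q * g l x = of_real (Re (\<mu> l q) * Re (g l x))" "0 \<le> Re (\<mu> l q) * Re (g l x)" if l: "l \<in> K" for l
    using \<mu>qn[OF l] D(4)[OF l, of x] by (auto simp: complex_nonneg_Reals_iff complex_eq_iff)
  let ?A = "(\<Sum>k\<in>K. \<mu> k e * g k x) - e x"
    and ?B = "(\<Sum>k\<in>K. \<mu> k (\<lambda>x. e x * f x) * g k x) - e x * f x"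
    and ?C = "(\<Sum>k\<in>K. \<mu> k (\<lambda>x. e x * f x * f x) * g k x) - e x * f x * f x"
  have "(\<Sum>l\<in>K. \<mu> l q * g l x) = (\<Sum>l\<in>K. t\<^sup>2 * (\<mu> l e * g l x) + - 2 * t * (\<mu> l (\<lambda>y. e y * f y) * g l x)
      + \<mu> l (\<lambda>y. e y * f y * f y) * g l x)"
    by (intro sum.cong refl) (simp add: \<mu>q algebra_simps)
  also have "\<dots> = t\<^sup>2 * (\<Sum>l\<in>K. \<mu> l e * g l x) + - 2 * t * (\<Sum>l\<in>K. \<mu> l (\<lambda>y. e y * f y) * g l x)
      + (\<Sum>l\<in>K. \<mu> l (\<lambda>y. e y * f y * f y) * g l x)"
    by (simp only: sum.distrib sum_distrib_left)
  also have "\<dots> = t\<^sup>2 * ?A + - 2 * t * ?B + ?C"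
    by (simp add: t_def power2_eq_square algebra_simps)
  finally have sum: "(\<Sum>l\<in>K. \<mu> l q * g l x) = t\<^sup>2 * ?A + - 2 * t * ?B + ?C" .
  have t1: "cmod t \<le> 1" using f(3) by (simp add: t_def)
  have "cmod (t\<^sup>2 * ?A) \<le> 1 * \<epsilon>"
    unfolding norm_mult norm_power using t1 by (intro mult_mono app0) (auto simp: power_le_one)
  moreover have "cmod (- 2 * t * ?B) \<le> 2 * \<epsilon>"
    unfolding norm_mult using t1 by (intro mult_mono app1) auto
  \<comment> \<open>The three coefficients have modulus at most 1, 2 and 1, whence the constant
    4.\<close>
  ultimately have "cmod (t\<^sup>2 * ?A + - 2 * t * ?B + ?C) \<le> 4 * \<epsilon>"
    using app2[of x] norm_triangle_ineq[of "t\<^sup>2 * ?A + - 2 * t * ?B" ?C] norm_triangle_ineq[of "t\<^sup>2 * ?A" "- 2 * t * ?B"]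
    by linarith
  then have "Re (\<Sum>l\<in>K. \<mu> l q * g l x) \<le> 4 * \<epsilon>"
    unfolding sum using complex_Re_le_cmod order_trans by blast
  moreover have "Re (\<Sum>l\<in>K. \<mu> l q * g l x) = (\<Sum>l\<in>K. Re (\<mu> l q) * Re (g l x))"
    unfolding Re_sum by (intro sum.cong refl) (simp add: summand(1))
  moreover have "Re (\<mu> k q) * Re (g k x) \<le> (\<Sum>l\<in>K. Re (\<mu> l q) * Re (g l x))"
    using D(1) k summand(2) by (intro member_le_sum) auto
  ultimately have "Re (\<mu> k q) * Re (g k x) \<le> 4 * \<epsilon>" by linarith
  then show "(\<lambda>y. e y * (f y - f x)\<^sup>2) \<in> C0_functions X"
    "\<mu> k (\<lambda>y. e y * (f y - f x)\<^sup>2) \<in> \<real>\<^sub>\<ge>\<^sub>0"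
    "Re (\<mu> k (\<lambda>y. e y * (f y - f x)\<^sup>2)) * Re (g k x) \<le> 4 * \<epsilon>"
    using qC \<mu>qn[OF k] unfolding q_def t_def by auto
qed

text \<open>With \<open>d = f x - f y\<close>, at every point \<open>d^2\<close> is at most twice
  the sum of the squared deviations of \<open>f\<close> from \<open>f x\<close> and from
  \<open>f y\<close>. Applying \<open>\<mu> k\<close> with weight \<open>e\<close> gives at most
  \<open>\<delta> / 16\<close> on the right, while \<open>\<mu> k e > \<delta>\<close> on the
  left.\<close>

lemma coloured_system_oscillation:
  assumes sys: "coloured_system X n K c g \<mu>"
    and e: "e \<in> C0_functions X" "\<And>x. e x \<in> \<real>\<^sub>\<ge>\<^sub>0" "\<And>x. cmod (e x) \<le> 1"
    and f: "f \<in> C0_functions X" "\<And>x. f x \<in> \<real>\<^sub>\<ge>\<^sub>0" "\<And>x. cmod (f x) \<le> 1"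
    and app0: "\<And>x. cmod ((\<Sum>k\<in>K. \<mu> k e * g k x) - e x) \<le> \<epsilon>"
    and app1: "\<And>x. cmod ((\<Sum>k\<in>K. \<mu> k (\<lambda>x. e x * f x) * g k x) - e x * f x) \<le> \<epsilon>"
    and app2: "\<And>x. cmod ((\<Sum>k\<in>K. \<mu> k (\<lambda>x. e x * f x * f x) * g k x) - e x * f x * f x) \<le> \<epsilon>"
    and k: "k \<in> K" and \<delta>: "0 < \<delta>" and \<epsilon>: "\<epsilon> = \<delta>\<^sup>2 / 256"
    and x: "\<delta> < Re (\<mu> k e) * Re (g k x)" and y: "\<delta> < Re (\<mu> k e) * Re (g k y)"
  shows "\<bar>Re (f x) - Re (f y)\<bar> \<le> 1/4"
proof -
  note D = coloured_systemD[OF sys]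
  note V = coloured_system_variance[OF sys e(1,2) f app0 app1 app2 k]
  have \<mu>e: "\<mu> k e \<in> \<real>\<^sub>\<ge>\<^sub>0" by (rule positive_functionalD(3)[OF D(6)[OF k] e(1,2)])
  have \<mu>e1: "Re (\<mu> k e) \<le> 1"
    using D(7)[OF k e(1)] C0_norm_le[of e 1 X, OF e(3)] complex_Re_le_cmod[of "\<mu> k e"] by linarith
  have g: "0 \<le> Re (g k z)" "Re (g k z) \<le> 1" for z
    using D(4)[OF k, of z] D(5)[OF k, of z] complex_Re_le_cmod[of "g k z"] by (auto simp: complex_nonneg_Reals_iff)
  have \<mu>e0: "0 \<le> Re (\<mu> k e)" using \<mu>e by (simp add: complex_nonneg_Reals_iff)
  have \<mu>\<delta>: "\<delta> < Re (\<mu> k e)" using x mult_left_mono[OF g(2)[of x] \<mu>e0] by simp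
  let ?q = "\<lambda>z y. e y * (f y - f z)\<^sup>2"
  \<comment> \<open>As \<open>\<mu> k e\<close> is at most 1, \<open>g k z\<close> exceeds
    \<open>\<delta>\<close>; the variance bound \<open>4 * \<epsilon>\<close>, which is
    \<open>\<delta>\<close> times \<open>\<delta> / 64\<close>, can be divided by it.\<close>
  have small: "Re (\<mu> k (?q z)) \<le> \<delta> / 64" if z: "\<delta> < Re (\<mu> k e) * Re (g k z)" for z
  proof -
    have "\<delta> < Re (g k z)" using z mult_right_mono[OF \<mu>e1 g(1)[of z]] by simp
    then have "Re (\<mu> k (?q z)) * \<delta> \<le> Re (\<mu> k (?q z)) * Re (g k z)"
      using V(2)[of z] by (intro mult_left_mono) (auto simp: complex_nonneg_Reals_iff)
    also have "\<dots> \<le> \<delta> / 64 * \<delta>" using V(3)[of z] by (simp add: \<epsilon> power2_eq_square)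
    finally show ?thesis using \<delta> by simp
  qed
  define d where "d = Re (f x) - Re (f y)"
  let ?r = "\<lambda>z. 2 * (e z * (f z - f x)\<^sup>2) + 2 * (e z * (f z - f y)\<^sup>2)"
  \<comment> \<open>This function equals \<open>e z * (2 * f z - f x - f y)^2\<close>, hence is
    nonnegative.\<close>
  let ?p = "\<lambda>z. ?r z + of_real (- d\<^sup>2) * e z"
  have pC: "?p \<in> C0_functions X" "?r \<in> C0_functions X" by (intro C0_add C0_smult V(1) e(1))+
  have "?p z \<in> \<real>\<^sub>\<ge>\<^sub>0" for z
  proof -
    obtain a where a: "f z = of_real a" using f(2)[of z] by (auto elim!: nonneg_Reals_cases)
    obtain b where b: "f x = of_real b" using f(2)[of x] by (auto elim!: nonneg_Reals_cases)
    obtain b' where b': "f y = of_real b'" using f(2)[of y] by (auto elim!: nonneg_Reals_cases)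
    obtain r where r: "e z = of_real r" "0 \<le> r" using e(2)[of z] by (auto elim!: nonneg_Reals_cases)
    have "?p z = of_real (r * (2 * (a - b)\<^sup>2 + 2 * (a - b')\<^sup>2 - (b - b')\<^sup>2))"
      unfolding a b b' r d_def by (simp add: algebra_simps)
    also have "2 * (a - b)\<^sup>2 + 2 * (a - b')\<^sup>2 - (b - b')\<^sup>2 = (2 * a - b - b')\<^sup>2"
      by (simp add: power2_eq_square algebra_simps)
    finally have "?p z = of_real (r * (2 * a - b - b')\<^sup>2)" .
    then show ?thesis using r by (simp del: of_real_mult)
  qed
  then have "\<mu> k ?p \<in> \<real>\<^sub>\<ge>\<^sub>0" by (rule positive_functionalD(3)[OF D(6)[OF k] pC(1)])
  moreover have "\<mu> k ?p = 2 * \<mu> k (?q x) + 2 * \<mu> k (?q y) + of_real (- d\<^sup>2) * \<mu> k e"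
  proof -
    note P = positive_functionalD[OF D(6)[OF k]]
    have "\<mu> k ?p = \<mu> k ?r + \<mu> k (\<lambda>z. of_real (- d\<^sup>2) * e z)"
      by (rule P(1)[OF pC(2) C0_smult[OF e(1)]])
    also have "\<mu> k ?r = \<mu> k (\<lambda>z. 2 * ?q x z) + \<mu> k (\<lambda>z. 2 * ?q y z)"
      by (rule P(1)[OF C0_smult[OF V(1)] C0_smult[OF V(1)]])
    also have "\<mu> k (\<lambda>z. 2 * ?q x z) = 2 * \<mu> k (?q x)" by (rule P(2)[OF V(1)])
    also have "\<mu> k (\<lambda>z. 2 * ?q y z) = 2 * \<mu> k (?q y)" by (rule P(2)[OF V(1)])
    also have "\<mu> k (\<lambda>z. of_real (- d\<^sup>2) * e z) = of_real (- d\<^sup>2) * \<mu> k e" by (rule P(2)[OF e(1)])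
    finally show ?thesis .
  qed
  ultimately have "d\<^sup>2 * Re (\<mu> k e) \<le> 2 * Re (\<mu> k (?q x)) + 2 * Re (\<mu> k (?q y))"
    by (simp add: complex_nonneg_Reals_iff flip: of_real_power)
  also have "\<dots> \<le> \<delta> / 16" using small[OF x] small[OF y] by simp
  finally have "d\<^sup>2 * Re (\<mu> k e) \<le> \<delta> / 16" .
  moreover have "d\<^sup>2 * \<delta> \<le> d\<^sup>2 * Re (\<mu> k e)" using \<mu>\<delta> by (intro mult_left_mono) auto
  ultimately have "d\<^sup>2 * \<delta> \<le> 1/16 * \<delta>" by simp
  then have "d\<^sup>2 \<le> (1/4)\<^sup>2" using \<delta> by (simp add: power2_eq_square)
  then have "\<bar>d\<bar> \<le> 1/4" using abs_le_square_iff[of d "1/4"] by simp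
  then show ?thesis by (simp add: d_def)
qed

text \<open>Approximate bump functions subordinate to the cover. If one of them exceeds 1/2 at some
  point of \<open>Z k\<close>, it has no zero on \<open>Z k\<close>, so \<open>Z k\<close> lies in a
  member of the cover; the colours bound the order.\<close>

lemma compact_refinement:
  fixes X :: "'x topology"
  assumes lc: "locally_compact_space X" and H: "Hausdorff_space X"
    and Q: "coloured_approximable TYPE('k) X n"
    and C: "compactin X C" and \<U>: "\<forall>U\<in>\<U>. openin X U" "C \<subseteq> \<Union>\<U>"
  shows "\<exists>\<Z>. finite \<Z> \<and> (\<forall>Z\<in>\<Z>. openin X Z) \<and> C \<subseteq> \<Union>\<Z> \<and> (\<forall>Z\<in>\<Z>. \<exists>U\<in>\<U>. Z \<subseteq> U) \<and>
    (\<forall>x. card {Z \<in> \<Z>. x \<in> Z} \<le> n + 1)"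
proof -
  obtain S where S: "finite S" "S \<subseteq> C0_functions X" "\<And>f y. f \<in> S \<Longrightarrow> f y \<in> \<real>\<^sub>\<ge>\<^sub>0" "\<And>f y. f \<in> S \<Longrightarrow> cmod (f y) \<le> 1"
    "\<forall>f\<in>S. \<exists>U. U \<in> \<U> \<and> (\<forall>y. f y \<noteq> 0 \<longrightarrow> y \<in> U)" and big: "\<And>x. x \<in> C \<Longrightarrow> \<exists>f\<in>S. 1/2 < Re (f x)"
    by (rule compact_bump_cover[OF lc H C \<U>]) (rule that)
  \<comment> \<open>Tolerance 1/4 makes \<open>e x = 1\<close> wherever some function of
    \<open>S\<close> exceeds 1/2, in particular on \<open>C\<close>.\<close>
  obtain e where e: "e \<in> C0_functions X" "\<And>x. e x \<in> \<real>\<^sub>\<ge>\<^sub>0" "\<And>x. cmod (e x) \<le> 1"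
    and ce: "\<And>f x. \<lbrakk>f \<in> S; e x \<noteq> 1\<rbrakk> \<Longrightarrow> cmod (f x) \<le> 1/4"
    by (rule C0_cutoff[OF S(1,2), of "1/4"]) (simp, rule that)
  \<comment> \<open>At most \<open>n + 1\<close> terms are nonzero at a point; if none exceeded
    \<open>\<delta>\<close>, their sum would be at most 1/4, but on \<open>C\<close> it is at least
    1/2.\<close>
  define \<delta> where "\<delta> = 1 / (4 * real (n + 1))"
  have \<delta>: "0 < \<delta>" "\<delta> \<le> 1" by (auto simp: \<delta>_def field_simps)
  define \<epsilon> where "\<epsilon> = \<delta>\<^sup>2 / 256"
  have \<epsilon>: "0 < \<epsilon>" "\<epsilon> \<le> 1/2" using \<delta> power_le_one[of \<delta> 2] by (auto simp: \<epsilon>_def)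
  \<comment> \<open>The moments of order 0, 1 and 2 that enter the variance.\<close>
  let ?S = "insert e ((\<lambda>f x. e x * f x) ` S \<union> (\<lambda>f x. e x * f x * f x) ` S)"
  have "finite ?S \<and> ?S \<subseteq> C0_functions X \<and> 0 < \<epsilon>"
    using S(1,2) e(1) \<epsilon> by (auto intro!: C0_mult)
  then have "\<exists>(K :: 'k set) c g \<mu>. coloured_system X n K c g \<mu> \<and>
      (\<forall>f\<in>?S. approximates K g \<mu> f \<epsilon>)"
    by (rule Q[unfolded coloured_approximable_def, THEN spec, THEN spec, THEN mp])
  then obtain K :: "'k set" and c g \<mu> where all: "coloured_system X n K c g \<mu> \<and>
      (\<forall>f\<in>?S. approximates K g \<mu> f \<epsilon>)"
    by (elim exE) (rule that)
  then have sys: "coloured_system X n K c g \<mu>" by blast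
  have app0: "cmod ((\<Sum>k\<in>K. \<mu> k e * g k x) - e x) \<le> \<epsilon>" for x using all by blast
  have app1: "cmod ((\<Sum>k\<in>K. \<mu> k (\<lambda>x. e x * f x) * g k x) - e x * f x) \<le> \<epsilon>" if "f \<in> S" for f x
    by (rule bspec[OF conjunct2[OF all], THEN spec]) (use that in blast)
  have app2: "cmod ((\<Sum>k\<in>K. \<mu> k (\<lambda>x. e x * f x * f x) * g k x) - e x * f x * f x) \<le> \<epsilon>" if "f \<in> S" for f x
    by (rule bspec[OF conjunct2[OF all], THEN spec]) (use that in blast)
  note D = coloured_systemD[OF sys]
  define Z where "Z k = {x \<in> topspace X. \<delta> < Re (\<mu> k e) * Re (g k x)}" for k
  \<comment> \<open>Sets that miss \<open>C\<close> are dropped: no bump function is known to be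
    large on them, so they need not refine the cover.\<close>
  define \<Z> where "\<Z> = Z ` {k \<in> K. Z k \<inter> C \<noteq> {}}"
  have Zo: "openin X (Z k)" if k: "k \<in> K" for k
  proof -
    have "continuous_map X euclideanreal (\<lambda>x. Re (\<mu> k e) * Re (g k x))"
      using D(3)[OF k] by (intro continuous_map_complex_compose[of X "g k" "\<lambda>z. Re (\<mu> k e) * Re z"])
        (auto simp: C0_functions_def intro!: continuous_intros)
    from openin_continuous_map_preimage[OF this, of "{\<delta><..}"] show ?thesis by (simp add: Z_def)
  qed
  have osc: "\<bar>Re (f x) - Re (f y)\<bar> \<le> 1/4" if k: "k \<in> K" and f: "f \<in> S" and xy: "x \<in> Z k" "y \<in> Z k" for k f x y
  proof (rule coloured_system_oscillation[OF sys e _ _ _ app0 app1[OF f] app2[OF f] k \<delta>(1) \<epsilon>_def])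
    show "f \<in> C0_functions X" using f S(2) by blast
    show "f z \<in> \<real>\<^sub>\<ge>\<^sub>0" "cmod (f z) \<le> 1" for z using S(3,4) f by blast+
  qed (use xy in \<open>simp_all add: Z_def\<close>)
  have gn: "Re (\<mu> k e) * Re (g k x) = Re (\<mu> k e * g k x)" if k: "k \<in> K" for k x
    using D(4)[OF k, of x] by (simp add: complex_nonneg_Reals_iff)
  have cover: "\<exists>k\<in>K. x \<in> Z k" if x: "x \<in> C" for x
  proof (rule ccontr)
    assume no: "\<not> ?thesis"
    have xX: "x \<in> topspace X" using x C compactin_subset_topspace by blast
    obtain f where f: "f \<in> S" "1/2 < Re (f x)" using big[OF x] by blast
    have "e x = 1"
    proof (rule ccontr)
      assume "e x \<noteq> 1"
      then have "cmod (f x) \<le> 1/4" using ce[OF f(1)] by blast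
      then show False using f(2) complex_Re_le_cmod[of "f x"] by linarith
    qed
    then have "1 - \<epsilon> \<le> Re (\<Sum>k\<in>K. \<mu> k e * g k x)"
      using app0[of x] abs_Re_le_cmod[of "(\<Sum>k\<in>K. \<mu> k e * g k x) - e x"] by simp
    then have "1/2 \<le> Re (\<Sum>k\<in>K. \<mu> k e * g k x)" using \<epsilon>(2) by linarith
    also have "\<dots> = (\<Sum>k\<in>K. Re (\<mu> k e) * Re (g k x))"
      unfolding Re_sum by (intro sum.cong refl gn[symmetric])
    also have "\<dots> = (\<Sum>k\<in>{k \<in> K. g k x \<noteq> 0}. Re (\<mu> k e) * Re (g k x))"
      using D(1) by (intro sum.mono_neutral_right) auto
    also have "\<dots> \<le> (\<Sum>k\<in>{k \<in> K. g k x \<noteq> 0}. \<delta>)"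
      using no xX by (intro sum_mono) (force simp: Z_def not_less)
    also have "\<dots> = real (card {k \<in> K. g k x \<noteq> 0}) * \<delta>" by simp
    also have "\<dots> \<le> real (n + 1) * \<delta>"
      using coloured_system_card[OF sys, of x] \<delta>(1) by (intro mult_right_mono) (simp_all only: of_nat_le_iff less_imp_le)
    also have "\<dots> = 1/4" by (simp add: \<delta>_def field_simps)
    finally show False by simp
  qed
  have "finite \<Z>" using D(1) by (simp add: \<Z>_def)
  moreover have "\<forall>W\<in>\<Z>. openin X W" using Zo by (auto simp: \<Z>_def)
  moreover have "C \<subseteq> \<Union>\<Z>"
  proof
    fix x assume x: "x \<in> C"
    obtain k where "k \<in> K" "x \<in> Z k" using cover[OF x] by blast
    then show "x \<in> \<Union>\<Z>" using x unfolding \<Z>_def by blast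
  qed
  moreover have "\<forall>W\<in>\<Z>. \<exists>U\<in>\<U>. W \<subseteq> U"
  proof
    fix W assume "W \<in> \<Z>"
    then obtain k x where k: "k \<in> K" "W = Z k" and x: "x \<in> Z k" "x \<in> C" unfolding \<Z>_def by blast
    obtain f where f: "f \<in> S" "1/2 < Re (f x)" using big[OF x(2)] by blast
    obtain U where U: "U \<in> \<U>" "\<And>y. f y \<noteq> 0 \<Longrightarrow> y \<in> U" using bspec[OF S(5) f(1)] by blast
    have "y \<in> U" if y: "y \<in> Z k" for y
    proof -
      have "Re (f y) \<noteq> 0" using osc[OF k(1) f(1) x(1) y] f(2) by auto
      then have "f y \<noteq> 0" by auto
      then show ?thesis by (rule U(2))
    qed
    then show "\<exists>U\<in>\<U>. W \<subseteq> U" using U(1) k(2) by blast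
  qed
  moreover have "card {W \<in> \<Z>. x \<in> W} \<le> n + 1" for x
  proof -
    have "{W \<in> \<Z>. x \<in> W} \<subseteq> Z ` {k \<in> K. g k x \<noteq> 0}" using \<delta>(1) by (auto simp: \<Z>_def Z_def)
    then have "card {W \<in> \<Z>. x \<in> W} \<le> card {k \<in> K. g k x \<noteq> 0}"
      using D(1) by (intro surj_card_le) auto
    then show ?thesis using coloured_system_card[OF sys, of x] by linarith
  qed
  ultimately show ?thesis by blast
qed

text \<open>The open sets contained in compact ones cover the space; a countable subcover exists by
  the Lindelof property, and finite unions of its members exhaust the space.\<close>

lemma compact_exhaustion:
  assumes lc: "locally_compact_space X" and sc: "second_countable X"
  obtains G C :: "nat \<Rightarrow> 'x set" where "G 0 = {}" "\<And>m. openin X (G m)" "\<And>m. G m \<subseteq> G (Suc m)"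
    "\<And>m. compactin X (C m)" "\<And>m. G m \<subseteq> C m" "(\<Union>m. G m) = topspace X"
proof -
  let ?\<U> = "{U. openin X U \<and> (\<exists>C. compactin X C \<and> U \<subseteq> C)}"
  have "\<Union>?\<U> = topspace X"
  proof
    show "\<Union>?\<U> \<subseteq> topspace X" using openin_subset by auto
    show "topspace X \<subseteq> \<Union>?\<U>" using lc unfolding locally_compact_space_def by blast
  qed
  then obtain \<V> where \<V>: "countable \<V>" "\<V> \<subseteq> ?\<U>" "\<Union>\<V> = topspace X"
    using Lindelof_spaceD[OF second_countable_imp_Lindelof_space[OF sc], of ?\<U>] by auto
  \<comment> \<open>The empty set is added so that the enumeration is possible also when the
    subcover is empty.\<close>
  let ?\<W> = "insert {} \<V>"
  define A where "A = from_nat_into ?\<W>"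
  have A: "range A = ?\<W>" unfolding A_def using \<V>(1) by (intro range_from_nat_into) auto
  have "\<exists>C. compactin X C \<and> A m \<subseteq> C" for m
  proof -
    have "A m \<in> ?\<W>" using A by blast
    then show ?thesis
    proof
      assume "A m = {}"
      then show ?thesis using compactin_empty by blast
    next
      assume "A m \<in> \<V>"
      then show ?thesis using \<V>(2) by blast
    qed
  qed
  then obtain B where B: "\<And>m. compactin X (B m)" "\<And>m. A m \<subseteq> B m" by metis
  have Ao: "openin X (A m)" for m
  proof -
    have "A m \<in> ?\<W>" using A by blast
    then show ?thesis using \<V>(2) by auto
  qed
  show ?thesis
  proof (rule that[of "\<lambda>m. \<Union>i<m. A i" "\<lambda>m. \<Union>i<m. B i"])
    show "compactin X (\<Union>i<m. B i)" for m using B by (intro compactin_Union) auto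
    show "openin X (\<Union>i<m. A i)" for m using Ao by (intro openin_Union) auto
    show "(\<Union>i<m. A i) \<subseteq> (\<Union>i<m. B i)" for m using B by blast
    have "(\<Union>m. \<Union>i<m. A i) = \<Union>(range A)" by blast
    then show "(\<Union>m. \<Union>i<m. A i) = topspace X" using A \<V>(3) by simp
  qed (auto simp: less_Suc_eq)
qed

text \<open>
  The order of a cover \<open>(W\<^sub>s)\<close> is lowered successively on the members of an exhaustion. Outside
  \<open>G\<^sub>m\<close> the sets are replaced by a refinement of order \<open>\<le> n + 1\<close> near \<open>C\<^sub>m\<^sub>+\<^sub>1\<close>; inside \<open>G\<^sub>m\<close>
  they do not change, so that they stabilise.
\<close>

lemma covering_dim_leI_exhaustion:
  fixes G C :: "nat \<Rightarrow> 'x set"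
  assumes H: "Hausdorff_space X" and G0: "G 0 = {}" and Go: "\<And>m. openin X (G m)"
    and Ginc: "\<And>m. G m \<subseteq> G (Suc m)" and Cc: "\<And>m. compactin X (C m)" and GC: "\<And>m. G m \<subseteq> C m"
    and GX: "(\<Union>m. G m) = topspace X"
    and loc: "\<And>m \<U>. \<lbrakk>\<forall>U\<in>\<U>. openin X U; C m \<subseteq> \<Union>\<U>\<rbrakk> \<Longrightarrow>
      \<exists>\<Z>. finite \<Z> \<and> (\<forall>Z\<in>\<Z>. openin X Z) \<and> C m \<subseteq> \<Union>\<Z> \<and> (\<forall>Z\<in>\<Z>. \<exists>U\<in>\<U>. Z \<subseteq> U) \<and>
        (\<forall>x. card {Z \<in> \<Z>. x \<in> Z} \<le> n + 1)"
  shows "covering_dim_le X n"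
  unfolding covering_dim_le_def
proof (intro allI impI)
  fix \<U> assume \<U>: "finite \<U> \<and> (\<forall>U\<in>\<U>. openin X U) \<and> \<Union>\<U> = topspace X"
  define Inv where "Inv m W \<longleftrightarrow> (\<forall>s\<in>\<U>. openin X (W s) \<and> W s \<subseteq> s) \<and> (\<Union>s\<in>\<U>. W s) = topspace X \<and>
    (\<forall>x\<in>G m. card {s \<in> \<U>. x \<in> W s} \<le> n + 1)" for m and W :: "'x set \<Rightarrow> 'x set"
  have base: "\<exists>W. Inv 0 W" using \<U> by (intro exI[of _ "\<lambda>s. s"]) (auto simp: Inv_def G0)
  have step: "\<exists>W'. Inv (Suc m) W' \<and> (\<forall>s\<in>\<U>. W' s \<inter> G m = W s \<inter> G m)" if W: "Inv m W" for m W
  proof -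
    have Wo: "openin X (W s)" "W s \<subseteq> s" if "s \<in> \<U>" for s using W that unfolding Inv_def by blast+
    have Wc: "(\<Union>s\<in>\<U>. W s) = topspace X" and Wn: "\<And>x. x \<in> G m \<Longrightarrow> card {s \<in> \<U>. x \<in> W s} \<le> n + 1"
      using W unfolding Inv_def by blast+
    have "C (Suc m) \<subseteq> \<Union>(W ` \<U>)" using Wc compactin_subset_topspace[OF Cc[of "Suc m"]] by simp
    then have "\<exists>\<Z>. finite \<Z> \<and> (\<forall>Z\<in>\<Z>. openin X Z) \<and> C (Suc m) \<subseteq> \<Union>\<Z> \<and> (\<forall>Z\<in>\<Z>. \<exists>U\<in>W ` \<U>. Z \<subseteq> U) \<and>
        (\<forall>x. card {Z \<in> \<Z>. x \<in> Z} \<le> n + 1)"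
      using Wo(1) by (intro loc) auto
    then obtain \<Z> where \<Z>: "finite \<Z>" "\<forall>Z\<in>\<Z>. openin X Z" "C (Suc m) \<subseteq> \<Union>\<Z>" "\<forall>Z\<in>\<Z>. \<exists>U\<in>W ` \<U>. Z \<subseteq> U"
      and ord: "\<And>x. card {Z \<in> \<Z>. x \<in> Z} \<le> n + 1"
      by blast
    have "\<forall>Z\<in>\<Z>. \<exists>s. s \<in> \<U> \<and> Z \<subseteq> W s" using \<Z>(4) by blast
    from bchoice[OF this] obtain \<sigma> where \<sigma>: "\<forall>Z\<in>\<Z>. \<sigma> Z \<in> \<U> \<and> Z \<subseteq> W (\<sigma> Z)" ..
    \<comment> \<open>All pieces lie in \<open>W s\<close>, so the order on \<open>G m\<close>
      cannot grow. A point of \<open>G (Suc m)\<close> outside \<open>G m\<close> belongs to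
      \<open>C (Suc m)\<close>, so only the middle piece can contain it.\<close>
    define W' where "W' s = (W s \<inter> G m) \<union> \<Union>{Z \<in> \<Z>. \<sigma> Z = s} \<union> (W s - C (Suc m))" for s
    have sub: "W' s \<subseteq> W s" if "s \<in> \<U>" for s using \<sigma> by (auto simp: W'_def)
    have "openin X (W' s)" if s: "s \<in> \<U>" for s
    proof -
      have "closedin X (C (Suc m))" using compactin_imp_closedin[OF H Cc] .
      then show ?thesis
        unfolding W'_def using \<Z>(2) Wo(1)[OF s] Go
        by (intro openin_Un openin_Union openin_Int openin_diff) auto
    qed
    moreover have "W' s \<subseteq> s" if "s \<in> \<U>" for s using sub[OF that] Wo(2)[OF that] by blast
    moreover have "(\<Union>s\<in>\<U>. W' s) = topspace X"
    proof
      show "(\<Union>s\<in>\<U>. W' s) \<subseteq> topspace X" using sub Wc by blast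
      show "topspace X \<subseteq> (\<Union>s\<in>\<U>. W' s)"
      proof
        fix x assume x: "x \<in> topspace X"
        show "x \<in> (\<Union>s\<in>\<U>. W' s)"
        proof (cases "x \<in> C (Suc m)")
          case True
          then obtain Z where "Z \<in> \<Z>" "x \<in> Z" using \<Z>(3) by blast
          then show ?thesis using \<sigma> by (auto simp: W'_def)
        next
          case False
          obtain s where "s \<in> \<U>" "x \<in> W s" using x Wc by blast
          then show ?thesis using False by (auto simp: W'_def)
        qed
      qed
    qed
    moreover have "card {s \<in> \<U>. x \<in> W' s} \<le> n + 1" if x: "x \<in> G (Suc m)" for x
    proof (cases "x \<in> G m")
      case True
      have "card {s \<in> \<U>. x \<in> W' s} \<le> card {s \<in> \<U>. x \<in> W s}"
        using \<U> sub by (intro card_mono) auto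
      then show ?thesis using Wn[OF True] by linarith
    next
      case False
      have "x \<in> C (Suc m)" using x GC by blast
      then have "{s \<in> \<U>. x \<in> W' s} \<subseteq> \<sigma> ` {Z \<in> \<Z>. x \<in> Z}" using False by (auto simp: W'_def)
      then have "card {s \<in> \<U>. x \<in> W' s} \<le> card {Z \<in> \<Z>. x \<in> Z}"
        using \<Z>(1) by (intro surj_card_le) auto
      then show ?thesis using ord[of x] by linarith
    qed
    ultimately have "Inv (Suc m) W'" unfolding Inv_def by blast
    moreover have "W' s \<inter> G m = W s \<inter> G m" if s: "s \<in> \<U>" for s
      using sub[OF s] by (auto simp: W'_def)
    ultimately show ?thesis by blast
  qed
  have "\<exists>W. \<forall>m. Inv m (W m) \<and> (\<forall>s\<in>\<U>. W (Suc m) s \<inter> G m = W m s \<inter> G m)"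
    by (rule dependent_nat_choice[where P = Inv and Q = "\<lambda>m W W'. \<forall>s\<in>\<U>. W' s \<inter> G m = W s \<inter> G m"])
       (rule base, rule step)
  then obtain W where all: "\<forall>m. Inv m (W m) \<and> (\<forall>s\<in>\<U>. W (Suc m) s \<inter> G m = W m s \<inter> G m)" ..
  have W: "Inv m (W m)" and agree: "\<forall>s\<in>\<U>. W (Suc m) s \<inter> G m = W m s \<inter> G m" for m
    using spec[OF all, of m] by (rule conjunct1, rule conjunct2)
  have Gmono: "G m \<subseteq> G k" if "m \<le> k" for m k
    using that by (rule lift_Suc_mono_le[of G, rotated]) (rule Ginc)
  have agree': "W (m + p) s \<inter> G m = W m s \<inter> G m" if s: "s \<in> \<U>" for m p s
  proof (induction p)
    case (Suc p)
    have "W (Suc (m + p)) s \<inter> G (m + p) = W (m + p) s \<inter> G (m + p)" using agree s by blast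
    then show ?case using Suc.IH Gmono[of m "m + p"] by auto
  qed simp
  have mem: "x \<in> W k s \<longleftrightarrow> x \<in> W m s" if s: "s \<in> \<U>" and x: "x \<in> G m" "x \<in> G k" for s x m k
  proof (cases "m \<le> k")
    case True
    then have "W k s \<inter> G m = W m s \<inter> G m" using agree'[OF s, of m "k - m"] by simp
    then show ?thesis using x by blast
  next
    case False
    then have "W m s \<inter> G k = W k s \<inter> G k" using agree'[OF s, of k "m - k"] by simp
    then show ?thesis using x by blast
  qed
  \<comment> \<open>The stable limit: on \<open>G m\<close> it coincides with \<open>W m s\<close>,
    which transfers covering and order from the single stages.\<close>
  define V where "V s = (\<Union>m. W m s \<inter> G m)" for s
  have V: "x \<in> V s \<longleftrightarrow> x \<in> W m s" if s: "s \<in> \<U>" and x: "x \<in> G m" for s x m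
  proof
    assume "x \<in> V s"
    then obtain k where "x \<in> W k s" "x \<in> G k" unfolding V_def by blast
    then show "x \<in> W m s" using mem[OF s x] by blast
  next
    assume "x \<in> W m s"
    then show "x \<in> V s" unfolding V_def using x by blast
  qed
  have Wm: "openin X (W m s)" "W m s \<subseteq> s" if "s \<in> \<U>" for m s
    using W[of m] that unfolding Inv_def by blast+
  have V1: "finite (V ` \<U>)" using \<U> by simp
  have V2: "\<forall>A\<in>V ` \<U>. openin X A"
    using Wm(1) Go by (auto simp: V_def intro!: openin_Union openin_Int)
  have V3: "\<Union>(V ` \<U>) = topspace X"
  proof
    show "\<Union>(V ` \<U>) \<subseteq> topspace X" using GX by (auto simp: V_def)
    show "topspace X \<subseteq> \<Union>(V ` \<U>)"
    proof
      fix x assume "x \<in> topspace X"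
      then obtain m where m: "x \<in> G m" using GX by blast
      have "x \<in> (\<Union>s\<in>\<U>. W m s)" using W[of m] \<open>x \<in> topspace X\<close> unfolding Inv_def by blast
      then obtain s where "s \<in> \<U>" "x \<in> W m s" by blast
      then show "x \<in> \<Union>(V ` \<U>)" using V m by blast
    qed
  qed
  have "V s \<subseteq> s" if "s \<in> \<U>" for s
    unfolding V_def using Wm(2)[OF that] by blast
  then have V4: "\<forall>A\<in>V ` \<U>. \<exists>U\<in>\<U>. A \<subseteq> U" by blast
  have V5: "card {A \<in> V ` \<U>. x \<in> A} \<le> n + 1" if x: "x \<in> topspace X" for x
  proof -
    obtain m where m: "x \<in> G m" using x GX by blast
    have "{A \<in> V ` \<U>. x \<in> A} \<subseteq> V ` {s \<in> \<U>. x \<in> W m s}" using V m by blast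
    then have "card {A \<in> V ` \<U>. x \<in> A} \<le> card {s \<in> \<U>. x \<in> W m s}"
      using \<U> by (intro surj_card_le) auto
    also have "\<dots> \<le> n + 1" using W[of m] m unfolding Inv_def by blast
    finally show ?thesis .
  qed
  show "\<exists>\<V>. finite \<V> \<and> (\<forall>V\<in>\<V>. openin X V) \<and> \<Union>\<V> = topspace X \<and>
      (\<forall>V\<in>\<V>. \<exists>U\<in>\<U>. V \<subseteq> U) \<and> (\<forall>x\<in>topspace X. card {V \<in> \<V>. x \<in> V} \<le> n + 1)"
    by (intro exI[of _ "V ` \<U>"] conjI ballI V1 V2[rule_format] V3 V4[rule_format] V5)
qed

lemma covering_dim_le_if_coloured_approximable:
  assumes lc: "locally_compact_space X" and H: "Hausdorff_space X" and sc: "second_countable X"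
    and Q: "coloured_approximable TYPE('k) X n"
  shows "covering_dim_le X n"
proof -
  obtain G C :: "nat \<Rightarrow> 'a set" where GC: "G 0 = {}" "\<And>m. openin X (G m)" "\<And>m. G m \<subseteq> G (Suc m)"
    "\<And>m. compactin X (C m)" "\<And>m. G m \<subseteq> C m" "(\<Union>m. G m) = topspace X"
    by (rule compact_exhaustion[OF lc sc]) (rule that)
  show ?thesis
    by (rule covering_dim_leI_exhaustion[OF H GC]) (rule compact_refinement[OF lc H Q GC(4)])
qed

theorem proposition2p4:
  fixes X :: "'x topology"
  assumes "locally_compact_space X" and "Hausdorff_space X"
  shows "nuclear_dimension (C0 X) = decomposition_rank (C0 X) \<and>
    (second_countable X \<longrightarrow>
       nuclear_dimension (C0 X) = decomposition_rank (C0 X) \<and>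
       decomposition_rank (C0 X) = covering_dimension X)"
proof -
  have eq: "nuclear_dimension (C0 X) = decomposition_rank (C0 X)"
    unfolding nuclear_dimension_def decomposition_rank_def nuclear_dim_le_iff_decomp_rank_le ..
  have "decomp_rank_le (C0 X) n \<longleftrightarrow> covering_dim_le X n" if sc: "second_countable X" for n
    using decomp_rank_le_if_covering_dim_le[OF assms]
      covering_dim_le_if_coloured_approximable[OF assms sc
        coloured_approximable_if_nuclear_dim_le[OF decomp_rank_le_imp_nuclear_dim_le]]
    by blast
  then have "second_countable X \<Longrightarrow> decomposition_rank (C0 X) = covering_dimension X"
    unfolding decomposition_rank_def covering_dimension_def by simp
  then show ?thesis using eq by blast
qed

end
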